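(* Let $k$ be a field of characteristic $p>0$, let $Q$ be a finite connected quiver, and let $A=kQ/\langle Z\rangle$ be a finite-dimensional monomial algebra. Then $HH_1(A)=0$ if and only if every non trivial circuit contains a zero cycle and every circuit $C$ with $(Q_1\odot B)_C\neq\emptyset\neq (Z\odot B)_C$ is a $p'$-circuit such that there is exactly one pair $(\xi,\beta)\in (Z\odot B)_C$ for which the cycle $\xi\beta$ contains no zero relation (no subpath belonging to $Z$) apart from $\xi$.
   Context: Quiver: vertices $Q_0$, arrows $Q_1$, source and terminal maps $s,t:Q_1\to Q_0$. A path of length $l\ge 1$ is a sequence $a_l\cdots a_1$ of arrows with $t(a_i)=s(a_{i+1})$; its source is $s(a_1)$, its terminal vertex is $t(a_l)$. Vertices are the (trivial) paths of length $0$. A cycle is a path whose source and terminal vertex coincide. The product in $kQ$ is concatenation. $Z$ is a set of paths of length at least two, minimal for the subpath order (no strict subpath of an element of $Z$ is in $Z$), and $A=kQ/\langle Z\rangle$. $B$ is the set of paths (including vertices) containing no path of $Z$ as a subpath; it is identified with a $k$-basis of $A$. A zero path (zero cycle) is a path (cycle) containing a path of $Z$. $HH_1(A)=H_1(A,A)$ is the first Hochschild homology group $\mathrm{Tor}_1(A,A)$ over $A$-$A$-bimodules. For sets of paths $X,Y$: $X\odot Y=\{(\alpha,\beta)\in X\times Y: t(\beta)=s(\alpha),\ t(\alpha)=s(\beta)\}$. A circuit is an equivalence class of cycles under the equivalence relation generated by rotation $a_n\cdots a_1\sim a_1a_n\cdots a_2$ ($a_i$ arrows); it is trivial if it corresponds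 to a vertex. For a circuit $C$, $(X\odot Y)_C=\{(\alpha,\beta)\in X\odot Y:\alpha\beta\in C\}$. Subpaths are counted as occurrences: "apart from $\xi$" means apart from the occurrence of $\xi$ as the final part of $\xi\beta$. Multiplicity: for a non trivial circuit $C$ containing a cycle $\gamma$ of length $n$, the period $l$ is the smallest positive integer such that the $l$-th iterated rotation of $\gamma$ equals $\gamma$; then $l\mid n$ and the multiplicity is $m=n/l$. $C$ is a $p'$-circuit if its multiplicity is not divisible by $p$. *)

theory Defs
  imports
    "Graph_Theory.Graph_Theory"
    "HOL-Library.Poly_Mapping"
    "HOL-Algebra.QuotRing"
    "HOL-Algebra.Module"
    "HOL-Algebra.Generated_Groups"
    "HOL-Algebra.Elementary_Groups"
    "HOL-Algebra.Free_Abelian_Groups"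
begin

section \<open>Paths in a quiver\<close>

text \<open>
  A quiver is a \<^typ>\<open>('v, 'e) pre_digraph\<close> (loops and parallel arrows are allowed), with
  \<^const>\<open>tail\<close> as source map and \<^const>\<open>head\<close> as terminal map. The path \<open>a\<^sub>l \<dots> a\<^sub>1\<close> is represented
  by the pair of its source and the list \<open>[a\<^sub>1, \<dots>, a\<^sub>l]\<close> of its arrows in the order in which they
  are traversed, i.e. reversed with respect to the written word; \<open>(v, [])\<close> is the vertex \<open>v\<close>.
\<close>

type_synonym ('v, 'e) qpath = "'v \<times> 'e list"

definition qpaths :: "('v, 'e) pre_digraph \<Rightarrow> ('v, 'e) qpath set" where
  "qpaths Q = {(u, as) | u as. \<exists>v. pre_digraph.awalk Q u as v}"

definition qsource :: "('v, 'e) qpath \<Rightarrow> 'v" where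
  "qsource \<alpha> = fst \<alpha>"

definition qtarget :: "('v, 'e) pre_digraph \<Rightarrow> ('v, 'e) qpath \<Rightarrow> 'v" where
  "qtarget Q \<alpha> = (if snd \<alpha> = [] then fst \<alpha> else head Q (last (snd \<alpha>)))"

definition qlength :: "('v, 'e) qpath \<Rightarrow> nat" where
  "qlength \<alpha> = length (snd \<alpha>)"

text \<open>\<open>qconcat \<alpha> \<beta>\<close> is the word \<open>\<alpha>\<beta>\<close>, a path if \<open>t(\<beta>) = s(\<alpha>)\<close>: first \<open>\<beta>\<close> is traversed, then \<open>\<alpha>\<close>.\<close>

definition qconcat :: "('v, 'e) qpath \<Rightarrow> ('v, 'e) qpath \<Rightarrow> ('v, 'e) qpath" where
  "qconcat \<alpha> \<beta> = (qsource \<beta>, snd \<beta> @ snd \<alpha>)"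

text \<open>\<open>occurs_at Q \<gamma> \<beta> \<delta> \<alpha>\<close> is one occurrence \<open>\<alpha> = \<gamma>\<beta>\<delta>\<close> of \<open>\<beta>\<close> as a subpath of \<open>\<alpha>\<close>.\<close>

definition occurs_at :: "('v, 'e) pre_digraph \<Rightarrow> ('v, 'e) qpath \<Rightarrow> ('v, 'e) qpath \<Rightarrow>
    ('v, 'e) qpath \<Rightarrow> ('v, 'e) qpath \<Rightarrow> bool" where
  "occurs_at Q \<gamma> \<beta> \<delta> \<alpha> \<longleftrightarrow> \<gamma> \<in> qpaths Q \<and> \<beta> \<in> qpaths Q \<and> \<delta> \<in> qpaths Q \<and>
     qtarget Q \<delta> = qsource \<beta> \<and> qtarget Q \<beta> = qsource \<gamma> \<and> \<alpha> = qconcat \<gamma> (qconcat \<beta> \<delta>)"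

definition subpath :: "('v, 'e) pre_digraph \<Rightarrow> ('v, 'e) qpath \<Rightarrow> ('v, 'e) qpath \<Rightarrow> bool" where
  "subpath Q \<beta> \<alpha> \<longleftrightarrow> (\<exists>\<gamma> \<delta>. occurs_at Q \<gamma> \<beta> \<delta> \<alpha>)"

definition qarrows :: "('v, 'e) pre_digraph \<Rightarrow> ('v, 'e) qpath set" where
  "qarrows Q = (\<lambda>a. (tail Q a, [a])) ` arcs Q"

definition minimal_relations :: "('v, 'e) pre_digraph \<Rightarrow> ('v, 'e) qpath set \<Rightarrow> bool" where
  "minimal_relations Q Z \<longleftrightarrow> Z \<subseteq> qpaths Q \<and> (\<forall>\<zeta>\<in>Z. qlength \<zeta> \<ge> 2) \<and>
     (\<forall>\<zeta>\<in>Z. \<forall>\<eta>\<in>Z. subpath Q \<eta> \<zeta> \<longrightarrow> \<eta> = \<zeta>)"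

definition zero_path :: "('v, 'e) pre_digraph \<Rightarrow> ('v, 'e) qpath set \<Rightarrow> ('v, 'e) qpath \<Rightarrow> bool" where
  "zero_path Q Z \<alpha> \<longleftrightarrow> (\<exists>\<zeta>\<in>Z. subpath Q \<zeta> \<alpha>)"

definition nonzero_paths ::
    "('v, 'e) pre_digraph \<Rightarrow> ('v, 'e) qpath set \<Rightarrow> ('v, 'e) qpath set" where
  "nonzero_paths Q Z = {\<alpha> \<in> qpaths Q. \<not> zero_path Q Z \<alpha>}"


section \<open>Circuits\<close>

definition qcycles :: "('v, 'e) pre_digraph \<Rightarrow> ('v, 'e) qpath set" where
  "qcycles Q = {\<gamma> \<in> qpaths Q. qsource \<gamma> = qtarget Q \<gamma>}"

text \<open>The rotation \<open>a\<^sub>n \<dots> a\<^sub>1 \<mapsto> a\<^sub>1 a\<^sub>n \<dots> a\<^sub>2\<close>; the source of the result is \<open>s(a\<^sub>2) = t(a\<^sub>1)\<close>.\<close>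

fun qrotate :: "('v, 'e) pre_digraph \<Rightarrow> ('v, 'e) qpath \<Rightarrow> ('v, 'e) qpath" where
  "qrotate Q (u, []) = (u, [])"
| "qrotate Q (u, a # as) = (head Q a, as @ [a])"

definition rotation_equiv ::
    "('v, 'e) pre_digraph \<Rightarrow> (('v, 'e) qpath \<times> ('v, 'e) qpath) set" where
  "rotation_equiv Q =
     (let r = {(\<gamma>, qrotate Q \<gamma>) | \<gamma>. \<gamma> \<in> qcycles Q}
      in (r \<union> r\<inverse>)\<^sup>* \<inter> qcycles Q \<times> qcycles Q)"

definition circuits :: "('v, 'e) pre_digraph \<Rightarrow> ('v, 'e) qpath set set" where
  "circuits Q = qcycles Q // rotation_equiv Q"

definition trivial_circuit :: "('v, 'e) pre_digraph \<Rightarrow> ('v, 'e) qpath set \<Rightarrow> bool" where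
  "trivial_circuit Q C \<longleftrightarrow> (\<exists>v\<in>verts Q. (v, []) \<in> C)"

definition cycle_period :: "('v, 'e) pre_digraph \<Rightarrow> ('v, 'e) qpath \<Rightarrow> nat" where
  "cycle_period Q \<gamma> = (LEAST l. l > 0 \<and> (qrotate Q ^^ l) \<gamma> = \<gamma>)"

definition circuit_multiplicity :: "('v, 'e) pre_digraph \<Rightarrow> ('v, 'e) qpath set \<Rightarrow> nat" where
  "circuit_multiplicity Q C = (let \<gamma> = (SOME \<gamma>. \<gamma> \<in> C) in qlength \<gamma> div cycle_period Q \<gamma>)"

definition odot :: "('v, 'e) pre_digraph \<Rightarrow> ('v, 'e) qpath set \<Rightarrow> ('v, 'e) qpath set \<Rightarrow>
    (('v, 'e) qpath \<times> ('v, 'e) qpath) set" where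
  "odot Q X Y = {(\<alpha>, \<beta>) \<in> X \<times> Y. qtarget Q \<beta> = qsource \<alpha> \<and> qtarget Q \<alpha> = qsource \<beta>}"

definition odot_circuit :: "('v, 'e) pre_digraph \<Rightarrow> ('v, 'e) qpath set \<Rightarrow> ('v, 'e) qpath set \<Rightarrow>
    ('v, 'e) qpath set \<Rightarrow> (('v, 'e) qpath \<times> ('v, 'e) qpath) set" where
  "odot_circuit Q X Y C = {(\<alpha>, \<beta>) \<in> odot Q X Y. qconcat \<alpha> \<beta> \<in> C}"

text \<open>
  The only occurrence of a path of \<open>Z\<close> in the path \<open>\<xi>\<beta>\<close> (read linearly, not cyclically) is the
  evident one \<open>\<xi>\<beta> = e\<xi>\<beta>\<close>, where \<open>e\<close> is the vertex \<open>t(\<xi>)\<close>. Other occurrences of the path \<open>\<xi>\<close> itself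
  are excluded as well.
\<close>

definition no_other_zero_relation ::
    "('v, 'e) pre_digraph \<Rightarrow> ('v, 'e) qpath set \<Rightarrow> ('v, 'e) qpath \<Rightarrow> ('v, 'e) qpath \<Rightarrow> bool" where
  "no_other_zero_relation Q Z \<xi> \<beta> \<longleftrightarrow>
     (\<forall>\<zeta>\<in>Z. \<forall>\<gamma> \<delta>. occurs_at Q \<gamma> \<zeta> \<delta> (qconcat \<xi> \<beta>) \<longrightarrow>
        \<gamma> = (qtarget Q \<xi>, []) \<and> \<zeta> = \<xi> \<and> \<delta> = \<beta>)"


section \<open>Monomial algebras\<close>

text \<open>
  An associative \<open>k\<close>-algebra is a record \<^typ>\<open>('k, 'a) module\<close>: a ring together with a scalar
  multiplication. The path algebra consists of the finitely supported functions on paths.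
\<close>

definition path_algebra ::
    "('v, 'e) pre_digraph \<Rightarrow> ('k::field, ('v, 'e) qpath \<Rightarrow>\<^sub>0 'k) module" where
  "path_algebra Q =
     \<lparr> carrier = {f. Poly_Mapping.keys f \<subseteq> qpaths Q},
       monoid.mult = (\<lambda>f g. \<Sum>\<alpha>\<in>Poly_Mapping.keys f. \<Sum>\<beta>\<in>Poly_Mapping.keys g.
                 if qtarget Q \<beta> = qsource \<alpha>
                 then Poly_Mapping.single (qconcat \<alpha> \<beta>)
                        (Poly_Mapping.lookup f \<alpha> * Poly_Mapping.lookup g \<beta>)
                 else 0),
       one = (\<Sum>v\<in>verts Q. Poly_Mapping.single (v, []) 1),
       ring.zero = 0,
       add = (+),
       smult = (\<lambda>c. Poly_Mapping.map ((*) c)) \<rparr>"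

definition quotient_algebra :: "('k, 'a) module \<Rightarrow> 'a set \<Rightarrow> ('k, 'a set) module" where
  "quotient_algebra R I = ring.extend (R Quot I)
     (module.fields (\<lambda>c X. \<Union>x\<in>X. I +>\<^bsub>R\<^esub> (c \<odot>\<^bsub>R\<^esub> x)))"

definition monomial_algebra ::
    "('v, 'e) pre_digraph \<Rightarrow> ('v, 'e) qpath set \<Rightarrow>
     ('k::field, (('v, 'e) qpath \<Rightarrow>\<^sub>0 'k) set) module" where
  "monomial_algebra Q Z =
     quotient_algebra (path_algebra Q)
       (Idl\<^bsub>path_algebra Q\<^esub> ((\<lambda>\<zeta>. Poly_Mapping.single \<zeta> 1) ` Z))"

definition finite_dimensional :: "('k, 'a) module \<Rightarrow> bool" where
  "finite_dimensional M \<longleftrightarrow>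
     (\<exists>S. finite S \<and> S \<subseteq> carrier M \<and>
        (\<forall>x\<in>carrier M. \<exists>c. x = (\<Oplus>\<^bsub>M\<^esub>s\<in>S. c s \<odot>\<^bsub>M\<^esub> s)))"


section \<open>Bimodules and Hochschild homology\<close>

text \<open>A bimodule is an abelian group (written multiplicatively) with a left and a right action.\<close>

record ('a, 'm) bimodule = "'m monoid" +
  lact :: "'a \<Rightarrow> 'm \<Rightarrow> 'm"
  ract :: "'m \<Rightarrow> 'a \<Rightarrow> 'm"

definition regular_bimodule :: "('a, 'r) ring_scheme \<Rightarrow> ('a, 'a) bimodule" where
  "regular_bimodule A =
     \<lparr> carrier = carrier A, monoid.mult = (\<oplus>\<^bsub>A\<^esub>), one = \<zero>\<^bsub>A\<^esub>,
       lact = (\<lambda>a x. a \<otimes>\<^bsub>A\<^esub> x), ract = (\<lambda>x a. x \<otimes>\<^bsub>A\<^esub> a) \<rparr>"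

text \<open>
  The map into \<open>G Mod H\<close> induced on cosets by a map \<open>f\<close> with values in \<open>G\<close>.
\<close>

definition coset_map :: "('b, 'r) monoid_scheme \<Rightarrow> 'b set \<Rightarrow> ('c \<Rightarrow> 'b) \<Rightarrow> 'c set \<Rightarrow> 'b set" where
  "coset_map G H f X = (\<Union>x\<in>X. H #>\<^bsub>G\<^esub> f x)"

text \<open>
  The tensor product \<open>M \<otimes> N\<close> over the enveloping algebra \<open>A\<^sup>e\<close>, for \<open>A\<close>-bimodules \<open>M\<close> and \<open>N\<close>
  regarded as a right and a left \<open>A\<^sup>e\<close>-module: besides bilinearity it satisfies
  \<open>ma \<otimes> n = m \<otimes> an\<close> and \<open>am \<otimes> n = m \<otimes> na\<close>. Compatibility with the scalars is a consequence.
\<close>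

definition bitensor_free ::
    "('a, 'm) bimodule \<Rightarrow> ('a, 'n) bimodule \<Rightarrow> (('m \<times> 'n) \<Rightarrow>\<^sub>0 int) monoid" where
  "bitensor_free M N = free_Abelian_group (carrier M \<times> carrier N)"

definition bitensor_relations ::
    "('a, 'r) ring_scheme \<Rightarrow> ('a, 'm) bimodule \<Rightarrow> ('a, 'n) bimodule \<Rightarrow> (('m \<times> 'n) \<Rightarrow>\<^sub>0 int) set" where
  "bitensor_relations A M N = generate (bitensor_free M N)
     ({frag_of (m \<otimes>\<^bsub>M\<^esub> m', n) - frag_of (m, n) - frag_of (m', n) | m m' n.
         m \<in> carrier M \<and> m' \<in> carrier M \<and> n \<in> carrier N} \<union>
      {frag_of (m, n \<otimes>\<^bsub>N\<^esub> n') - frag_of (m, n) - frag_of (m, n') | m n n'.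
         m \<in> carrier M \<and> n \<in> carrier N \<and> n' \<in> carrier N} \<union>
      {frag_of (ract M m a, n) - frag_of (m, lact N a n) | m a n.
         m \<in> carrier M \<and> a \<in> carrier A \<and> n \<in> carrier N} \<union>
      {frag_of (lact M a m, n) - frag_of (m, ract N n a) | m a n.
         m \<in> carrier M \<and> a \<in> carrier A \<and> n \<in> carrier N})"

definition bitensor ::
    "('a, 'r) ring_scheme \<Rightarrow> ('a, 'm) bimodule \<Rightarrow> ('a, 'n) bimodule \<Rightarrow>
     (('m \<times> 'n) \<Rightarrow>\<^sub>0 int) set monoid" where
  "bitensor A M N = bitensor_free M N Mod bitensor_relations A M N"

text \<open>\<open>id \<otimes> f\<close> for a bimodule homomorphism \<open>f\<close> from \<open>N\<close> to \<open>N'\<close>; the source \<open>N\<close> is not needed.\<close>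

definition bitensor_map ::
    "('a, 'r) ring_scheme \<Rightarrow> ('a, 'm) bimodule \<Rightarrow> ('a, 'n) bimodule \<Rightarrow> ('l \<Rightarrow> 'n) \<Rightarrow>
     (('m \<times> 'l) \<Rightarrow>\<^sub>0 int) set \<Rightarrow> (('m \<times> 'n) \<Rightarrow>\<^sub>0 int) set" where
  "bitensor_map A M N' f =
     coset_map (bitensor_free M N') (bitensor_relations A M N')
       (frag_extend (\<lambda>(m, n). frag_of (m, f n)))"

text \<open>
  The \<open>n\<close>-fold tensor power of \<open>A\<close> over \<open>k\<close>; a list of length \<open>n\<close> stands for the pure tensor
  of its entries.
\<close>

definition tensor_power_free :: "('k, 'a) module \<Rightarrow> nat \<Rightarrow> ('a list \<Rightarrow>\<^sub>0 int) monoid" where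
  "tensor_power_free A n = free_Abelian_group {xs. length xs = n \<and> set xs \<subseteq> carrier A}"

definition tensor_power_relations :: "('k, 'a) module \<Rightarrow> nat \<Rightarrow> ('a list \<Rightarrow>\<^sub>0 int) set" where
  "tensor_power_relations A n = generate (tensor_power_free A n)
     ({frag_of (xs @ [a \<oplus>\<^bsub>A\<^esub> b] @ ys) - frag_of (xs @ [a] @ ys) - frag_of (xs @ [b] @ ys)
        | xs a b ys. set xs \<union> {a, b} \<union> set ys \<subseteq> carrier A \<and> length xs + 1 + length ys = n} \<union>
      {frag_of (xs @ [c \<odot>\<^bsub>A\<^esub> a] @ ys @ [b] @ zs) - frag_of (xs @ [a] @ ys @ [c \<odot>\<^bsub>A\<^esub> b] @ zs)
        | xs c a ys b zs. set xs \<union> {a, b} \<union> set ys \<union> set zs \<subseteq> carrier A \<and>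
            length xs + 1 + length ys + 1 + length zs = n})"

text \<open>
  The bar resolution of \<open>A\<close>. Its degree \<open>n\<close> term is the bimodule \<open>A \<otimes> A\<^bsup>\<otimes>n\<^esup> \<otimes> A\<close>, with \<open>A\<close> acting
  on the outer factors. As \<open>k\<close> is a field, these bimodules are free, so that the complex is a
  projective resolution of \<open>A\<close> by the multiplication map from degree 0 to \<open>A\<close>.
\<close>

definition bar_bimodule :: "('k, 'a) module \<Rightarrow> nat \<Rightarrow> ('a, ('a list \<Rightarrow>\<^sub>0 int) set) bimodule" where
  "bar_bimodule A n =
     (let F = tensor_power_free A (n + 2); R = tensor_power_relations A (n + 2)
      in monoid.extend (F Mod R) (bimodule.fields
           (\<lambda>a. coset_map F R (frag_extend (\<lambda>xs. frag_of ((a \<otimes>\<^bsub>A\<^esub> hd xs) # tl xs))))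
           (\<lambda>X a. coset_map F R (frag_extend (\<lambda>xs. frag_of (butlast xs @ [last xs \<otimes>\<^bsub>A\<^esub> a]))) X)))"

text \<open>
  The differential from degree \<open>n\<close> to degree \<open>n - 1\<close>, for \<open>n > 0\<close>:
  \<open>a\<^sub>0 \<otimes> \<dots> \<otimes> a\<^bsub>n+1\<^esub> \<mapsto> \<Sum>i\<le>n. (-1)\<^sup>i a\<^sub>0 \<otimes> \<dots> \<otimes> a\<^sub>i a\<^bsub>i+1\<^esub> \<otimes> \<dots> \<otimes> a\<^bsub>n+1\<^esub>\<close>.
\<close>

definition bar_differential ::
    "('k, 'a) module \<Rightarrow> nat \<Rightarrow> ('a list \<Rightarrow>\<^sub>0 int) set \<Rightarrow> ('a list \<Rightarrow>\<^sub>0 int) set" where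
  "bar_differential A n =
     coset_map (tensor_power_free A (n + 1)) (tensor_power_relations A (n + 1))
       (frag_extend (\<lambda>xs. \<Sum>i\<le>n. frag_cmul ((- 1) ^ i)
          (frag_of (take i xs @ [xs ! i \<otimes>\<^bsub>A\<^esub> xs ! (i + 1)] @ drop (i + 2) xs))))"

text \<open>
  Hochschild homology \<open>HH\<^sub>n(A) = Tor\<^sub>n(A, A)\<close> over \<open>A\<^sup>e\<close>, computed by the bar resolution of the
  second argument.
\<close>

definition hochschild_chains ::
    "('k, 'a) module \<Rightarrow> nat \<Rightarrow> (('a \<times> ('a list \<Rightarrow>\<^sub>0 int) set) \<Rightarrow>\<^sub>0 int) set monoid" where
  "hochschild_chains A n = bitensor A (regular_bimodule A) (bar_bimodule A n)"

definition hochschild_boundary ::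
    "('k, 'a) module \<Rightarrow> nat \<Rightarrow> (('a \<times> ('a list \<Rightarrow>\<^sub>0 int) set) \<Rightarrow>\<^sub>0 int) set \<Rightarrow>
     (('a \<times> ('a list \<Rightarrow>\<^sub>0 int) set) \<Rightarrow>\<^sub>0 int) set" where
  "hochschild_boundary A n =
     bitensor_map A (regular_bimodule A) (bar_bimodule A (n - 1)) (bar_differential A n)"

definition hochschild_cycles ::
    "('k, 'a) module \<Rightarrow> nat \<Rightarrow> (('a \<times> ('a list \<Rightarrow>\<^sub>0 int) set) \<Rightarrow>\<^sub>0 int) set set" where
  "hochschild_cycles A n =
     (if n = 0 then carrier (hochschild_chains A 0)
      else kernel (hochschild_chains A n) (hochschild_chains A (n - 1)) (hochschild_boundary A n))"

definition hochschild_homology ::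
    "('k, 'a) module \<Rightarrow> nat \<Rightarrow> (('a \<times> ('a list \<Rightarrow>\<^sub>0 int) set) \<Rightarrow>\<^sub>0 int) set set monoid" where
  "hochschild_homology A n =
     (hochschild_chains A n)\<lparr>carrier := hochschild_cycles A n\<rparr> Mod
       (hochschild_boundary A (n + 1) ` carrier (hochschild_chains A (n + 1)))"

end

theory Submission
  imports Defs "HOL-Library.Sublist"
begin

text \<open>
  In degrees at most two, the Hochschild complex of a monomial algebra reduces to
  \<open>k(Z \<odot> B) \<rightarrow> k(Q\<^sub>1 \<odot> B) \<rightarrow> k(Q\<^sub>0 \<odot> B)\<close>, which is graded by circuits. A pair \<open>(a, \<beta>)\<close> is encoded by the
  cyclic word \<open>a\<beta>\<close>, whose differential is \<open>a\<beta> - \<beta>a\<close>; hence a 1-cycle has coefficients that stay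
  constant under rotation as long as the word is nonzero. For a circuit with a zero cycle, the kernel
  thus has one dimension for each word \<open>a\<beta>\<close> which is zero although \<open>\<beta>\<close> is not, and these words
  correspond to the pairs \<open>(\<xi>, \<beta>)\<close> without other zero relation. If \<open>\<beta>\<close> is nonzero then every zero
  relation on the circuit passes through the arrow \<open>a\<close>; therefore the boundary of every pair in
  \<open>Z \<odot> B\<close> is the sum over all rotations, which is the multiplicity times the sum over the
  distinct words. Hence the homology at the circuit vanishes iff there is only one such word and the
  multiplicity is invertible in \<open>k\<close>. For a circuit without zero cycle the sum over all rotations is a
  nontrivial 1-cycle.

  Nontriviality is detected by Hochschild 1-cocycles \<open>f : A \<times> A \<rightarrow> k\<close>, so that no comparison of
  resolutions is needed.
\<close>

section \<open>Subgroups and cosets in free abelian groups\<close>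

text \<open>The groups to be computed consist of cosets of formal sums of pairs whose second entries
  are again cosets, so neither maps out of them nor normal forms inside them are at hand. Each
  direction therefore gets its own interface. For nonvanishing, a functional on pairs (x, y) is
  built that kills boundaries. For vanishing, the calculation is carried out with formal pairs
  modulo an arbitrary subgroup H containing the bilinearity and boundary relations; a scalar
  multiple of a symbol is then an unrelated symbol, which is why coefficients are carried inside the
  symbols and added only modulo H. Tensor products are formed over k, not over the span of the
  vertices. Pairs whose composites are not both defined thus appear and must be reduced, which is
  the origin of the words that are not closed. Lists follow the order of traversal: the arrow a of
  the word a\<beta> is the last entry, \<beta> is \<open>butlast\<close>, and \<beta>a is
  \<open>rotate_back\<close>. A zero word with nonzero \<open>butlast\<close> is an
  \<open>end_walk\<close>; from any word with nonzero \<open>butlast\<close> on a circuit with a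
  zero cycle, the first zero word met in rotating forward is one.\<close>

definition add_subgroup :: "'a::ab_group_add set \<Rightarrow> bool" where
  "add_subgroup H \<longleftrightarrow> 0 \<in> H \<and> (\<forall>x\<in>H. \<forall>y\<in>H. x - y \<in> H)"

lemma add_subgroupI:
  "\<lbrakk>0 \<in> H; \<And>x y. \<lbrakk>x \<in> H; y \<in> H\<rbrakk> \<Longrightarrow> x - y \<in> H\<rbrakk> \<Longrightarrow> add_subgroup H"
  by (simp add: add_subgroup_def)

lemma add_subgroup_zero: "add_subgroup H \<Longrightarrow> 0 \<in> H"
  by (simp add: add_subgroup_def)

lemma add_subgroup_diff: "\<lbrakk>add_subgroup H; x \<in> H; y \<in> H\<rbrakk> \<Longrightarrow> x - y \<in> H"
  by (simp add: add_subgroup_def)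

lemma add_subgroup_minus: "\<lbrakk>add_subgroup H; x \<in> H\<rbrakk> \<Longrightarrow> - x \<in> H"
  using add_subgroup_diff [of H 0 x] by (simp add: add_subgroup_zero)

lemma add_subgroup_add: "\<lbrakk>add_subgroup H; x \<in> H; y \<in> H\<rbrakk> \<Longrightarrow> x + y \<in> H"
  using add_subgroup_diff [of H x "- y"] by (simp add: add_subgroup_minus)

lemma add_subgroup_sum: "\<lbrakk>add_subgroup H; \<And>i. i \<in> I \<Longrightarrow> f i \<in> H\<rbrakk> \<Longrightarrow> sum f I \<in> H"
  by (induction I rule: infinite_finite_induct) (auto simp: add_subgroup_zero add_subgroup_add)

lemma add_subgroup_trans:
  "\<lbrakk>add_subgroup H; x - y \<in> H; y - z \<in> H\<rbrakk> \<Longrightarrow> x - z \<in> H"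
  using add_subgroup_add [of H "x - y" "y - z"] by simp

lemma add_subgroup_diff_diff:
  "\<lbrakk>add_subgroup H; x - x' \<in> H; y - y' \<in> H\<rbrakk> \<Longrightarrow> x - y - (x' - y') \<in> H"
  using add_subgroup_diff [of H "x - x'" "y - y'"] by (simp add: algebra_simps)

lemma add_subgroup_commute: "add_subgroup H \<Longrightarrow> x - y \<in> H \<longleftrightarrow> y - x \<in> H"
  using add_subgroup_minus [of H "x - y"] add_subgroup_minus [of H "y - x"] by auto

lemma add_subgroup_cong_iff: "\<lbrakk>add_subgroup H; x - y \<in> H\<rbrakk> \<Longrightarrow> x \<in> H \<longleftrightarrow> y \<in> H"
  using add_subgroup_diff [of H x "x - y"] add_subgroup_add [of H "x - y" y] by auto

lemma add_subgroup_sum_cong: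
  "\<lbrakk>add_subgroup H; \<And>i. i \<in> I \<Longrightarrow> f i - g i \<in> H\<rbrakk> \<Longrightarrow> sum f I - sum g I \<in> H"
  by (simp add: sum_subtractf [symmetric] add_subgroup_sum)

lemma add_subgroup_frag_cmul: "\<lbrakk>add_subgroup H; x \<in> H\<rbrakk> \<Longrightarrow> frag_cmul c x \<in> H"
  using frag_closure_minus_cmul [of "\<lambda>x. x \<in> H" x c]
  by (simp add: add_subgroup_zero add_subgroup_diff)

lemma add_subgroup_vimage:
  "\<lbrakk>Modules.additive f; add_subgroup H\<rbrakk> \<Longrightarrow> add_subgroup {x. f x \<in> H}"
  by (auto intro!: add_subgroupI simp: additive.zero additive.diff add_subgroup_zero add_subgroup_diff)

lemma add_subgroup_singleton_zero: "add_subgroup {0}"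
  by (simp add: add_subgroup_def)

lemma add_subgroup_keys: "add_subgroup {c :: 'a \<Rightarrow>\<^sub>0 'b::ab_group_add. Poly_Mapping.keys c \<subseteq> S}"
  by (auto intro!: add_subgroupI dest!: subsetD simp: in_keys_iff lookup_minus)

lemma keys_diff_subset:
  "\<lbrakk>Poly_Mapping.keys a \<subseteq> S; Poly_Mapping.keys b \<subseteq> S\<rbrakk> \<Longrightarrow> Poly_Mapping.keys (a - b) \<subseteq> S"
  for a b :: "'x \<Rightarrow>\<^sub>0 int"
  using keys_diff [of a b] by blast

lemma keys_add_subset:
  "\<lbrakk>Poly_Mapping.keys f \<subseteq> S; Poly_Mapping.keys g \<subseteq> S\<rbrakk> \<Longrightarrow> Poly_Mapping.keys (f + g) \<subseteq> S"
  using keys_add [of f g] by blast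

text \<open>The form F receives the coefficients together with the basis elements, so that one
  scheme covers the product of the path algebra as well as scalar-valued forms.\<close>

definition bilinear_sum ::
    "('a \<Rightarrow> 'b \<Rightarrow> 'k \<Rightarrow> 'k \<Rightarrow> 'c) \<Rightarrow> ('a \<Rightarrow>\<^sub>0 'k::zero) \<Rightarrow> ('b \<Rightarrow>\<^sub>0 'k) \<Rightarrow> 'c::comm_monoid_add" where
  "bilinear_sum F f g = (\<Sum>\<alpha>\<in>Poly_Mapping.keys f. \<Sum>\<beta>\<in>Poly_Mapping.keys g.
     F \<alpha> \<beta> (Poly_Mapping.lookup f \<alpha>) (Poly_Mapping.lookup g \<beta>))"

text \<open>Fixed finite index sets replace the supports; additivity in one argument needs this
  because f, f' and f + f' have different supports.\<close>

lemma bilinear_sum_superset: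
  assumes "finite S" "Poly_Mapping.keys f \<subseteq> S" "finite T" "Poly_Mapping.keys g \<subseteq> T"
    and "\<And>\<alpha> \<beta> c. F \<alpha> \<beta> 0 c = 0" "\<And>\<alpha> \<beta> c. F \<alpha> \<beta> c 0 = 0"
  shows "bilinear_sum F f g = (\<Sum>\<alpha>\<in>S. \<Sum>\<beta>\<in>T. F \<alpha> \<beta> (Poly_Mapping.lookup f \<alpha>) (Poly_Mapping.lookup g \<beta>))"
proof -
  have "bilinear_sum F f g =
      (\<Sum>\<alpha>\<in>Poly_Mapping.keys f. \<Sum>\<beta>\<in>T. F \<alpha> \<beta> (Poly_Mapping.lookup f \<alpha>) (Poly_Mapping.lookup g \<beta>))"
    unfolding bilinear_sum_def
    by (intro sum.cong refl sum.mono_neutral_left) (use assms in \<open>auto simp: in_keys_iff\<close>)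
  also have "\<dots> = (\<Sum>\<alpha>\<in>S. \<Sum>\<beta>\<in>T. F \<alpha> \<beta> (Poly_Mapping.lookup f \<alpha>) (Poly_Mapping.lookup g \<beta>))"
    by (intro sum.mono_neutral_left) (use assms in \<open>auto simp: in_keys_iff\<close>)
  finally show ?thesis .
qed

lemma keys_extend_subset:
  assumes "Poly_Mapping.keys y \<subseteq> S" "\<And>x. x \<in> S \<Longrightarrow> Poly_Mapping.keys (f x) \<subseteq> T"
  shows "Poly_Mapping.keys (frag_extend f y) \<subseteq> T"
  using keys_frag_extend [of f y] assms by blast

lemma additive_frag_extend: "Modules.additive (frag_extend f)"
  by (simp add: Modules.additive_def frag_extend_add)

lemma frag_cmul_diff_distrib2: "frag_cmul c (a - b) = frag_cmul c a - frag_cmul c b"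
  by (simp add: poly_mapping_eqI lookup_minus right_diff_distrib)

lemma additive_compose: "\<lbrakk>Modules.additive f; Modules.additive g\<rbrakk> \<Longrightarrow> Modules.additive (\<lambda>x. f (g x))"
  by (simp add: Modules.additive_def)

text \<open>\<open>frag_extend\<close> takes values in formal sums only; this is the analogous
  extension with values in a ring, used to evaluate chains in k.\<close>

definition frag_eval :: "('a \<Rightarrow> 'b::comm_ring_1) \<Rightarrow> ('a \<Rightarrow>\<^sub>0 int) \<Rightarrow> 'b" where
  "frag_eval f z = (\<Sum>x\<in>Poly_Mapping.keys z. of_int (Poly_Mapping.lookup z x) * f x)"

lemma frag_eval_superset:
  "\<lbrakk>finite S; Poly_Mapping.keys z \<subseteq> S\<rbrakk>
    \<Longrightarrow> frag_eval f z = (\<Sum>x\<in>S. of_int (Poly_Mapping.lookup z x) * f x)"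
  unfolding frag_eval_def by (rule sum.mono_neutral_left) (auto simp: in_keys_iff)

lemma frag_eval_of [simp]: "frag_eval f (frag_of x) = f x"
  by (simp add: frag_eval_def)

lemma additive_frag_eval: "Modules.additive (frag_eval f)"
proof
  fix x y :: "'a \<Rightarrow>\<^sub>0 int"
  let ?S = "Poly_Mapping.keys x \<union> Poly_Mapping.keys y"
  have "Poly_Mapping.keys (x + y) \<subseteq> ?S"
    by (rule keys_add)
  then show "frag_eval f (x + y) = frag_eval f x + frag_eval f y"
    by (simp add: frag_eval_superset [of ?S] lookup_add algebra_simps sum.distrib)
qed

lemmas frag_eval_simps =
  additive.zero [OF additive_frag_eval] additive.add [OF additive_frag_eval]
  additive.diff [OF additive_frag_eval] additive.minus [OF additive_frag_eval]

lemmas frag_extend_simps = frag_extend_add frag_extend_diff frag_extend_minus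

text \<open>A common form for all cosets that occur: the right cosets in
  \<open>free_Abelian_group S\<close> do not depend on S, and the additive cosets of the path
  algebra have the same shape.\<close>

definition add_coset :: "'a::ab_group_add set \<Rightarrow> 'a \<Rightarrow> 'a set" where
  "add_coset H x = (\<lambda>h. h + x) ` H"

lemma mem_add_coset_iff: "y \<in> add_coset H x \<longleftrightarrow> y - x \<in> H"
  unfolding add_coset_def image_iff
  by (metis add_diff_cancel_right' diff_add_cancel)

lemma add_coset_eq_iff:
  assumes "add_subgroup H"
  shows "add_coset H x = add_coset H y \<longleftrightarrow> x - y \<in> H"
proof
  assume "add_coset H x = add_coset H y"
  moreover have "x \<in> add_coset H x"
    using add_subgroup_zero [OF assms] by (simp add: mem_add_coset_iff)
  ultimately show "x - y \<in> H"
    by (auto simp: add_coset_def)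
next
  have *: "add_coset H x \<subseteq> add_coset H y" if "x - y \<in> H" for x y
  proof
    fix z assume "z \<in> add_coset H x"
    then obtain h where "h \<in> H" "z = h + x"
      by (auto simp: add_coset_def)
    with that have "z = (h + (x - y)) + y" "h + (x - y) \<in> H"
      by (auto intro: add_subgroup_add assms)
    then show "z \<in> add_coset H y"
      unfolding add_coset_def by blast
  qed
  assume "x - y \<in> H"
  with * show "add_coset H x = add_coset H y"
    using add_subgroup_commute [OF assms] by blast
qed

lemma add_coset_self: "add_subgroup H \<Longrightarrow> x \<in> add_coset H x"
  by (simp add: mem_add_coset_iff add_subgroup_zero)

lemma add_coset_zero: "add_coset H 0 = H"
  by (simp add: add_coset_def)

lemma add_coset_eq_zero_iff: "add_subgroup H \<Longrightarrow> add_coset H x = H \<longleftrightarrow> x \<in> H"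
  using add_coset_eq_iff [of H x 0] by (simp add: add_coset_zero)

lemma r_coset_free: "H #>\<^bsub>free_Abelian_group S\<^esub> x = add_coset H x"
  by (auto simp: r_coset_def add_coset_def)

lemma set_mult_free:
  assumes H: "add_subgroup H"
  shows "add_coset H x <#>\<^bsub>free_Abelian_group S\<^esub> add_coset H y = add_coset H (x + y)"
proof (intro equalityI subsetI)
  fix z assume "z \<in> add_coset H x <#>\<^bsub>free_Abelian_group S\<^esub> add_coset H y"
  then obtain u v where "u - x \<in> H" "v - y \<in> H" "z = u + v"
    by (auto simp: set_mult_def mem_add_coset_iff)
  then show "z \<in> add_coset H (x + y)"
    using add_subgroup_add [OF H, of "u - x" "v - y"] by (simp add: mem_add_coset_iff algebra_simps)
next
  fix z assume "z \<in> add_coset H (x + y)"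
  then have "z - y \<in> add_coset H x" "y \<in> add_coset H y"
    by (auto simp: mem_add_coset_iff algebra_simps add_subgroup_zero [OF H])
  then show "z \<in> add_coset H x <#>\<^bsub>free_Abelian_group S\<^esub> add_coset H y"
    unfolding set_mult_def by force
qed

text \<open>\<open>coset_map\<close> is a union over representatives; all of them contribute the
  same coset as soon as f is additive and maps H into H'.\<close>

lemma coset_map_add_coset:
  assumes H: "add_subgroup H" "add_subgroup H'"
    and f: "Modules.additive f" "\<And>x. x \<in> H \<Longrightarrow> f x \<in> H'"
  shows "coset_map (free_Abelian_group S) H' f (add_coset H x) = add_coset H' (f x)"
proof -
  have "add_coset H' (f y) = add_coset H' (f x)" if "y \<in> add_coset H x" for y
    using that f(2) [of "y - x"] by (simp add: add_coset_eq_iff mem_add_coset_iff H additive.diff [OF f(1)])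
  then show ?thesis
    using add_coset_self [OF H(1), of x] unfolding coset_map_def r_coset_free by blast
qed

lemma carrier_free_Mod:
  "carrier (free_Abelian_group S Mod H) = add_coset H ` {c. Poly_Mapping.keys c \<subseteq> S}"
  by (auto simp: carrier_FactGroup r_coset_free)

text \<open>The supports of the generators enter because the inverse in
  \<open>free_Abelian_group S\<close> is known to be the negative only for elements of the
  carrier.\<close>

lemma generate_free_least:
  assumes "add_subgroup H" "X \<subseteq> H" "\<And>x. x \<in> X \<Longrightarrow> Poly_Mapping.keys x \<subseteq> S"
  shows "generate (free_Abelian_group S) X \<subseteq> H"
proof
  fix x assume "x \<in> generate (free_Abelian_group S) X"
  then show "x \<in> H"
    by induction (use assms in \<open>auto simp: add_subgroup_zero add_subgroup_minus add_subgroup_add\<close>)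
qed

lemma keys_generate_free:
  assumes "\<And>x. x \<in> X \<Longrightarrow> Poly_Mapping.keys x \<subseteq> S" "x \<in> generate (free_Abelian_group S) X"
  shows "Poly_Mapping.keys x \<subseteq> S"
  using generate_free_least [OF add_subgroup_keys _ assms(1), of X S] assms by blast

lemma add_subgroup_generate_free:
  assumes "\<And>x. x \<in> X \<Longrightarrow> Poly_Mapping.keys x \<subseteq> S"
  shows "add_subgroup (generate (free_Abelian_group S) X)"
proof (rule add_subgroupI)
  show "0 \<in> generate (free_Abelian_group S) X"
    using generate.one [of "free_Abelian_group S" X] by simp
next
  have sub: "subgroup (generate (free_Abelian_group S) X) (free_Abelian_group S)"
    using assms by (intro group.generate_is_subgroup) auto
  fix x y assume xy: "x \<in> generate (free_Abelian_group S) X" "y \<in> generate (free_Abelian_group S) X"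
  have "- y \<in> generate (free_Abelian_group S) X"
    using subgroup.m_inv_closed [OF sub xy(2)] keys_generate_free [OF assms xy(2)] by simp
  then show "x - y \<in> generate (free_Abelian_group S) X"
    using subgroup.m_closed [OF sub xy(1)] by force
qed

lemma comm_group_free_Mod:
  assumes "add_subgroup H" "\<And>x. x \<in> H \<Longrightarrow> Poly_Mapping.keys x \<subseteq> S"
  shows "comm_group (free_Abelian_group S Mod H)"
proof (rule comm_group.abelian_FactGroup [OF abelian_free_Abelian_group])
  show "subgroup H (free_Abelian_group S)"
    by (rule group.subgroupI [OF group_free_Abelian_group])
       (use assms in \<open>auto simp: add_subgroup_minus add_subgroup_add dest: add_subgroup_zero\<close>)
qed

section \<open>The bar resolution of an algebra\<close>

lemma setcompr_cong3:
  "(\<And>m a y. P m a y \<Longrightarrow> f m a y = g m a y) \<Longrightarrow> {f m a y | m a y. P m a y} = {g m a y | m a y. P m a y}"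
  by metis

lemma Collect_mem_image: "{x \<in> f ` K. P x} = f ` {z \<in> K. P (f z)}"
  by blast

lemma image_subset_image_iff:
  "f ` {z. P z} \<subseteq> f ` g ` {w. R w} \<longleftrightarrow> (\<forall>z. P z \<longrightarrow> (\<exists>w. R w \<and> f z = f (g w)))"
  by auto

text \<open>Stated for a subset containing the unit, so that the set of boundaries can be inserted
  directly: if every coset of H equals H, then x = 1x lies in H.\<close>

lemma trivial_group_quotient_iff:
  assumes G: "group G" and H: "H \<subseteq> carrier G" "\<one>\<^bsub>G\<^esub> \<in> H"
  shows "trivial_group (G Mod H) \<longleftrightarrow> carrier G = H"
proof
  interpret G: group G by (rule G)
  assume triv: "trivial_group (G Mod H)"
  have "x \<in> H" if x: "x \<in> carrier G" for x
  proof -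
    have "H #>\<^bsub>G\<^esub> x = H"
      using triv x by (auto simp: trivial_group_def carrier_FactGroup)
    moreover have "\<one>\<^bsub>G\<^esub> \<otimes>\<^bsub>G\<^esub> x \<in> H #>\<^bsub>G\<^esub> x"
      using H unfolding r_coset_def by blast
    ultimately show ?thesis
      using x by simp
  qed
  then show "carrier G = H"
    using H by blast
next
  interpret G: group G by (rule G)
  assume eq: "carrier G = H"
  have "carrier G #>\<^bsub>G\<^esub> x = carrier G" if "x \<in> carrier G" for x
    using G.coset_join2 [OF that G.subgroup_self that] .
  then have "carrier (G Mod carrier G) = {\<one>\<^bsub>G Mod carrier G\<^esub>}"
    by (auto simp: carrier_FactGroup intro!: image_eqI [of _ _ "\<one>\<^bsub>G\<^esub>"])
  moreover have "group (G Mod carrier G)"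
    by (rule normal.factorgroup_is_group [OF G.normal_self])
  ultimately show "trivial_group (G Mod H)"
    by (simp add: trivial_group_def eq [symmetric])
qed

section \<open>Pure tensors and multilinear maps\<close>

definition pure_tensors :: "('k, 'a) module \<Rightarrow> nat \<Rightarrow> 'a list set" where
  "pure_tensors A n = {xs. length xs = n \<and> set xs \<subseteq> carrier A}"

lemma pure_tensors_update:
  "\<lbrakk>l \<in> pure_tensors A n; x \<in> carrier A\<rbrakk> \<Longrightarrow> l[i := x] \<in> pure_tensors A n"
  using set_update_subset_insert [of l i x] by (auto simp: pure_tensors_def)

lemma pure_tensors_nth: "\<lbrakk>l \<in> pure_tensors A n; i < n\<rbrakk> \<Longrightarrow> l ! i \<in> carrier A"
  by (auto simp: pure_tensors_def)

text \<open>Scalars enter the tensor relations by being moved from one factor to another; these laws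
  let a product of two neighbouring factors absorb them.\<close>

locale field_algebra = ring A for A :: "('k::field, 'a) module" (structure) +
  assumes smult_closed: "x \<in> carrier A \<Longrightarrow> c \<odot> x \<in> carrier A"
    and smult_mult: "\<lbrakk>x \<in> carrier A; y \<in> carrier A\<rbrakk> \<Longrightarrow> (c \<odot> x) \<otimes> y = c \<odot> (x \<otimes> y)"
    and mult_smult: "\<lbrakk>x \<in> carrier A; y \<in> carrier A\<rbrakk> \<Longrightarrow> x \<otimes> (c \<odot> y) = c \<odot> (x \<otimes> y)"
begin

abbreviation tensors :: "nat \<Rightarrow> ('a list \<Rightarrow>\<^sub>0 int) set" where
  "tensors n \<equiv> {y. Poly_Mapping.keys y \<subseteq> pure_tensors A n}"

text \<open>Multilinearity modulo H. The target is only an abelian group, so homogeneity is replaced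
  by the balance of a scalar between two entries.\<close>

definition multilinear_into :: "nat \<Rightarrow> ('a list \<Rightarrow> 'c::ab_group_add) \<Rightarrow> 'c set \<Rightarrow> bool" where
  "multilinear_into n g H \<longleftrightarrow>
     (\<forall>l\<in>pure_tensors A n. \<forall>i<n. \<forall>a\<in>carrier A. \<forall>b\<in>carrier A.
        g (l[i := a \<oplus>\<^bsub>A\<^esub> b]) - g (l[i := a]) - g (l[i := b]) \<in> H) \<and>
     (\<forall>l\<in>pure_tensors A n. \<forall>i<n. \<forall>j<n. \<forall>c. g (l[i := c \<odot> l ! i]) - g (l[j := c \<odot> l ! j]) \<in> H)"

abbreviation (input) tensor_generators :: "nat \<Rightarrow> ('a list \<Rightarrow>\<^sub>0 int) set" where
  "tensor_generators n \<equiv>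
     ({frag_of (xs @ [a \<oplus>\<^bsub>A\<^esub> b] @ ys) - frag_of (xs @ [a] @ ys) - frag_of (xs @ [b] @ ys)
        | xs a b ys. set xs \<union> {a, b} \<union> set ys \<subseteq> carrier A \<and> length xs + 1 + length ys = n} \<union>
      {frag_of (xs @ [c \<odot> a] @ ys @ [b] @ zs) - frag_of (xs @ [a] @ ys @ [c \<odot> b] @ zs)
        | xs c a ys b zs. set xs \<union> {a, b} \<union> set ys \<union> set zs \<subseteq> carrier A \<and>
            length xs + 1 + length ys + 1 + length zs = n})"

lemma keys_tensor_generators:
  assumes "x \<in> tensor_generators n"
  shows "Poly_Mapping.keys x \<subseteq> pure_tensors A n"
proof -
  have d: "Poly_Mapping.keys (frag_of u - frag_of v) \<subseteq> {u, v}" for u v :: "'a list"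
    using keys_diff [of "frag_of u" "frag_of v"] by auto
  have d3: "Poly_Mapping.keys (frag_of u - frag_of v - frag_of w) \<subseteq> {u, v, w}" for u v w :: "'a list"
    using keys_diff [of "frag_of u - frag_of v" "frag_of w"] d [of u v] by auto
  show ?thesis
    using assms
    by (elim UnE CollectE exE conjE) (auto dest!: d [THEN subsetD] d3 [THEN subsetD]
        simp: pure_tensors_def smult_closed)
qed

lemma tensor_power_relations_eq:
  "tensor_power_relations A n = generate (free_Abelian_group (pure_tensors A n)) (tensor_generators n)"
  by (simp add: tensor_power_relations_def tensor_power_free_def pure_tensors_def)

lemma add_subgroup_tensor: "add_subgroup (tensor_power_relations A n)"
  unfolding tensor_power_relations_eq
  by (rule add_subgroup_generate_free) (rule keys_tensor_generators)

lemma tensor_add: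
  assumes "l \<in> pure_tensors A n" "i < n" "a \<in> carrier A" "b \<in> carrier A"
  shows "frag_of (l[i := a \<oplus>\<^bsub>A\<^esub> b]) - frag_of (l[i := a]) - frag_of (l[i := b]) \<in> tensor_power_relations A n"
  unfolding tensor_power_relations_eq
proof (rule generate.incl, rule UnI1, intro CollectI exI conjI)
  show "set (take i l) \<union> {a, b} \<union> set (drop (Suc i) l) \<subseteq> carrier A"
    using assms by (auto simp: pure_tensors_def dest: in_set_takeD in_set_dropD)
qed (use assms in \<open>auto simp: pure_tensors_def upd_conv_take_nth_drop\<close>)

lemma tensor_smult:
  assumes l: "l \<in> pure_tensors A n" and "i < n" "j < n"
  shows "frag_of (l[i := c \<odot> l ! i]) - frag_of (l[j := c \<odot> l ! j]) \<in> tensor_power_relations A n"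
proof -
  have *: "frag_of (l[i := c \<odot> l ! i]) - frag_of (l[j := c \<odot> l ! j]) \<in> tensor_power_relations A n"
    if "i < j" "j < n" for i j
    unfolding tensor_power_relations_eq
  proof (rule generate.incl, rule UnI2, intro CollectI exI conjI)
    let ?xs = "take i l" and ?ys = "take (j - i - 1) (drop (Suc i) l)" and ?zs = "drop (Suc j) l"
    have len: "length l = n"
      using l by (simp add: pure_tensors_def)
    show "set ?xs \<union> {l ! i, l ! j} \<union> set ?ys \<union> set ?zs \<subseteq> carrier A"
      using l that by (auto simp: pure_tensors_def dest!: in_set_takeD in_set_dropD)
    show "length ?xs + 1 + length ?ys + 1 + length ?zs = n"
      using that len by simp
    have eq: "l[i := a, j := b] = ?xs @ [a] @ ?ys @ [b] @ ?zs" for a b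
      by (rule nth_equalityI) (use that len in \<open>auto simp: nth_list_update nth_append nth_Cons'\<close>)
    show "frag_of (l[i := c \<odot> l ! i]) - frag_of (l[j := c \<odot> l ! j]) =
        frag_of (?xs @ [c \<odot> l ! i] @ ?ys @ [l ! j] @ ?zs) - frag_of (?xs @ [l ! i] @ ?ys @ [c \<odot> l ! j] @ ?zs)"
      unfolding eq [symmetric] using that by (simp add: list_update_swap)
  qed
  show ?thesis
    using * [of i j] * [of j i] assms add_subgroup_commute [OF add_subgroup_tensor]
    by (cases i j rule: linorder_cases) (auto simp: add_subgroup_zero [OF add_subgroup_tensor])
qed

text \<open>The universal property of the tensor power: the preimage of H under f is a subgroup, so
  it is enough to check the generating relations.\<close>

lemma tensor_relations_map:
  assumes f: "Modules.additive f" and H: "add_subgroup H"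
    and g: "multilinear_into n (\<lambda>l. f (frag_of l)) H" and x: "x \<in> tensor_power_relations A n"
  shows "f x \<in> H"
proof -
  have "tensor_power_relations A n \<subseteq> {x. f x \<in> H}"
    unfolding tensor_power_relations_eq
  proof (rule generate_free_least)
    show "add_subgroup {x. f x \<in> H}"
      by (rule add_subgroup_vimage [OF f H])
    show "tensor_generators n \<subseteq> {x. f x \<in> H}"
    proof (intro Un_least subsetI; elim CollectE exE conjE)
      fix x xs a b ys
      assume x: "x = frag_of (xs @ [a \<oplus>\<^bsub>A\<^esub> b] @ ys) - frag_of (xs @ [a] @ ys) - frag_of (xs @ [b] @ ys)"
        and *: "set xs \<union> {a, b} \<union> set ys \<subseteq> carrier A" "length xs + 1 + length ys = n"
      let ?l = "xs @ [a] @ ys" and ?i = "length xs"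
      have "?l \<in> pure_tensors A n" "?i < n"
        using * by (auto simp: pure_tensors_def)
      then have "f (frag_of (?l[?i := a \<oplus>\<^bsub>A\<^esub> b])) - f (frag_of (?l[?i := a])) - f (frag_of (?l[?i := b])) \<in> H"
        using g * unfolding multilinear_into_def by blast
      then show "x \<in> {x. f x \<in> H}"
        by (simp add: x additive.diff [OF f])
    next
      fix x xs c a ys b zs
      assume x: "x = frag_of (xs @ [c \<odot> a] @ ys @ [b] @ zs) - frag_of (xs @ [a] @ ys @ [c \<odot> b] @ zs)"
        and *: "set xs \<union> {a, b} \<union> set ys \<union> set zs \<subseteq> carrier A"
          "length xs + 1 + length ys + 1 + length zs = n"
      let ?l = "xs @ [a] @ ys @ [b] @ zs" and ?i = "length xs" and ?j = "length xs + 1 + length ys"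
      have "?l \<in> pure_tensors A n" "?i < n" "?j < n"
        using * by (auto simp: pure_tensors_def)
      then have "f (frag_of (?l[?i := c \<odot> ?l ! ?i])) - f (frag_of (?l[?j := c \<odot> ?l ! ?j])) \<in> H"
        using g unfolding multilinear_into_def by blast
      then show "x \<in> {x. f x \<in> H}"
        by (simp add: x additive.diff [OF f] nth_append list_update_append)
    qed
  qed (rule keys_tensor_generators)
  with x show ?thesis
    by blast
qed

section \<open>The bar differential and the outer actions on representatives\<close>

definition contract :: "nat \<Rightarrow> 'a list \<Rightarrow> 'a list" where
  "contract i l = take i l @ [l ! i \<otimes> l ! (i + 1)] @ drop (i + 2) l"

lemma contract_pure:
  "\<lbrakk>l \<in> pure_tensors A (Suc n); i < n\<rbrakk> \<Longrightarrow> contract i l \<in> pure_tensors A n"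
  using nth_mem [of i l] nth_mem [of "Suc i" l] unfolding contract_def pure_tensors_def
  by (auto simp del: nth_mem dest!: in_set_takeD in_set_dropD)

lemma length_contract: "length l = Suc n \<Longrightarrow> i < n \<Longrightarrow> length (contract i l) = n"
  by (simp add: contract_def)

lemma nth_contract: "\<lbrakk>length l = Suc n; i < n; j < n\<rbrakk> \<Longrightarrow>
   contract i l ! j = (if j < i then l ! j else if j = i then l ! i \<otimes> l ! (i + 1) else l ! (j + 1))"
  by (auto simp: contract_def nth_append)

lemma contract_update:
  assumes "length l = Suc n" "i < n" "j \<le> n"
  shows "contract i (l[j := x]) =
     (if j < i then (contract i l)[j := x] else if j = i then (contract i l)[i := x \<otimes> l ! (i + 1)]
      else if j = i + 1 then (contract i l)[i := l ! i \<otimes> x] else (contract i l)[j - 1 := x])"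
  by (rule nth_equalityI)
     (use assms in \<open>auto simp: length_contract nth_contract nth_list_update split: if_splits\<close>)

text \<open>Changing entry i or i + 1 changes one factor of the product, where distributivity
  applies; every other entry survives, possibly shifted by one.\<close>

lemma multilinear_contract:
  assumes i: "i < n"
  shows "multilinear_into (Suc n) (\<lambda>l. frag_of (contract i l)) (tensor_power_relations A n)"
  unfolding multilinear_into_def
proof (intro conjI ballI allI impI)
  fix l j a b
  assume l: "l \<in> pure_tensors A (Suc n)" and j: "j < Suc n" and ab: "a \<in> carrier A" "b \<in> carrier A"
  have len: "length l = Suc n" and mem: "l ! i \<in> carrier A" "l ! (i + 1) \<in> carrier A"
    using l i by (auto simp: pure_tensors_def)
  note c = contract_pure [OF l i]
  show "frag_of (contract i (l[j := a \<oplus>\<^bsub>A\<^esub> b])) - frag_of (contract i (l[j := a])) -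
      frag_of (contract i (l[j := b])) \<in> tensor_power_relations A n"
    using j ab mem i tensor_add [OF c]
    by (simp add: contract_update [OF len i] l_distr r_distr)
next
  fix l j j' k
  assume l: "l \<in> pure_tensors A (Suc n)" and j: "j < Suc n" "j' < Suc n"
  have len: "length l = Suc n" and mem: "l ! i \<in> carrier A" "l ! (i + 1) \<in> carrier A"
    using l i by (auto simp: pure_tensors_def)
  note c = contract_pure [OF l i]
  \<comment> \<open>Entries to the right of position i move one place to the left; in particular
    entry i + 1 is merged into entry i.\<close>
  have *: "contract i (l[j := k \<odot> l ! j]) =
      (contract i l)[(if j \<le> i then j else j - 1) := k \<odot> contract i l ! (if j \<le> i then j else j - 1)]"
    if "j < Suc n" for j
    using that i mem by (auto simp: contract_update [OF len i] nth_contract [OF len] smult_mult mult_smult)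
  show "frag_of (contract i (l[j := k \<odot> l ! j])) - frag_of (contract i (l[j' := k \<odot> l ! j']))
      \<in> tensor_power_relations A n"
    unfolding * [OF j(1)] * [OF j(2)] using j i by (intro tensor_smult c) auto
qed

definition bar_map :: "nat \<Rightarrow> ('a list \<Rightarrow>\<^sub>0 int) \<Rightarrow> ('a list \<Rightarrow>\<^sub>0 int)" where
  "bar_map n = frag_extend (\<lambda>xs. \<Sum>i\<le>n. frag_cmul ((- 1) ^ i) (frag_of (contract i xs)))"

definition lmult :: "'a \<Rightarrow> ('a list \<Rightarrow>\<^sub>0 int) \<Rightarrow> ('a list \<Rightarrow>\<^sub>0 int)" where
  "lmult a = frag_extend (\<lambda>xs. frag_of ((a \<otimes> hd xs) # tl xs))"

definition rmult :: "'a \<Rightarrow> ('a list \<Rightarrow>\<^sub>0 int) \<Rightarrow> ('a list \<Rightarrow>\<^sub>0 int)" where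
  "rmult a = frag_extend (\<lambda>xs. frag_of (butlast xs @ [last xs \<otimes> a]))"

lemma additive_bar_map: "Modules.additive (bar_map n)"
  by (simp add: bar_map_def additive_frag_extend)

lemma additive_lmult: "Modules.additive (lmult a)"
  by (simp add: lmult_def additive_frag_extend)

lemma additive_rmult: "Modules.additive (rmult a)"
  by (simp add: rmult_def additive_frag_extend)

lemma multilinear_sum:
  assumes H: "add_subgroup H" and "\<And>i. i \<in> I \<Longrightarrow> multilinear_into n (g i) H"
  shows "multilinear_into n (\<lambda>l. \<Sum>i\<in>I. frag_cmul (c i) (g i l)) H"
  using assms unfolding multilinear_into_def
  by (auto simp: sum_subtractf [symmetric] intro!: add_subgroup_sum)
     (auto simp: frag_cmul_diff_distrib2 [symmetric] intro!: add_subgroup_frag_cmul)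

lemma bar_map_relations:
  assumes "x \<in> tensor_power_relations A (n + 2)"
  shows "bar_map n x \<in> tensor_power_relations A (n + 1)"
  by (rule tensor_relations_map [OF additive_bar_map add_subgroup_tensor _ assms])
     (auto simp: bar_map_def intro!: multilinear_sum add_subgroup_tensor multilinear_contract)

lemma lmult_frag_of: "length l = Suc n \<Longrightarrow> lmult a (frag_of l) = frag_of (l[0 := a \<otimes> l ! 0])"
  by (cases l) (auto simp: lmult_def)

lemma rmult_frag_of: "length l = Suc n \<Longrightarrow> rmult a (frag_of l) = frag_of (l[n := l ! n \<otimes> a])"
  by (cases l rule: rev_cases) (auto simp: rmult_def)

text \<open>Both outer actions are of this kind, with i the first or the last position and h a
  multiplication.\<close>

lemma multilinear_update:
  assumes i: "i < n" and h: "\<And>x. x \<in> carrier A \<Longrightarrow> h x \<in> carrier A"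
    and add: "\<And>x y. \<lbrakk>x \<in> carrier A; y \<in> carrier A\<rbrakk> \<Longrightarrow> h (x \<oplus>\<^bsub>A\<^esub> y) = h x \<oplus>\<^bsub>A\<^esub> h y"
    and smult: "\<And>c x. x \<in> carrier A \<Longrightarrow> h (c \<odot> x) = c \<odot> h x"
  shows "multilinear_into n (\<lambda>l. frag_of (l[i := h (l ! i)])) (tensor_power_relations A n)"
  unfolding multilinear_into_def
proof (intro conjI ballI allI impI)
  fix l j a b
  assume l: "l \<in> pure_tensors A n" and j: "j < n" and ab: "a \<in> carrier A" "b \<in> carrier A"
  have li: "l[i := h (l ! i)] \<in> pure_tensors A n"
    by (intro pure_tensors_update h pure_tensors_nth [of l A n] l i)
  show "frag_of (l[j := a \<oplus>\<^bsub>A\<^esub> b, i := h (l[j := a \<oplus>\<^bsub>A\<^esub> b] ! i)]) -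
      frag_of (l[j := a, i := h (l[j := a] ! i)]) - frag_of (l[j := b, i := h (l[j := b] ! i)])
      \<in> tensor_power_relations A n"
  proof (cases "i = j")
    case True
    then show ?thesis
      using tensor_add [OF l i, of "h a" "h b"] ab l i by (simp add: add h pure_tensors_def)
  next
    case False
    then show ?thesis
      using tensor_add [OF li j ab] by (simp add: list_update_swap)
  qed
next
  fix l j j' c
  assume l: "l \<in> pure_tensors A n" and j: "j < n" "j' < n"
  have li: "l[i := h (l ! i)] \<in> pure_tensors A n" and len: "length l = n" and m: "l ! i \<in> carrier A"
    using l i pure_tensors_update [OF l h [OF pure_tensors_nth [OF l i]], of i]
    by (auto simp: pure_tensors_def)
  have "l[j := c \<odot> l ! j, i := h (l[j := c \<odot> l ! j] ! i)] =
      l[i := h (l ! i), j := c \<odot> l[i := h (l ! i)] ! j]" if "j < n" for j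
    using that i len m by (cases "i = j") (auto simp: smult list_update_swap)
  then show "frag_of (l[j := c \<odot> l ! j, i := h (l[j := c \<odot> l ! j] ! i)]) -
      frag_of (l[j' := c \<odot> l ! j', i := h (l[j' := c \<odot> l ! j'] ! i)]) \<in> tensor_power_relations A n"
    using tensor_smult [OF li j, of c] j by simp
qed

lemma multilinear_cong:
  assumes "\<And>l. l \<in> pure_tensors A n \<Longrightarrow> g l = g' l" "multilinear_into n g H"
  shows "multilinear_into n g' H"
  using assms unfolding multilinear_into_def
  by (simp add: pure_tensors_update smult_closed pure_tensors_nth)

lemma lmult_relations:
  assumes "a \<in> carrier A" "x \<in> tensor_power_relations A (Suc n)"
  shows "lmult a x \<in> tensor_power_relations A (Suc n)"
proof (rule tensor_relations_map [OF additive_lmult add_subgroup_tensor _ assms(2)])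
  show "multilinear_into (Suc n) (\<lambda>l. lmult a (frag_of l)) (tensor_power_relations A (Suc n))"
    by (rule multilinear_cong [OF _ multilinear_update [of 0 "Suc n" "\<lambda>x. a \<otimes> x"]])
       (use assms in \<open>auto simp: lmult_frag_of pure_tensors_def r_distr mult_smult\<close>)
qed

lemma rmult_relations:
  assumes "a \<in> carrier A" "x \<in> tensor_power_relations A (Suc n)"
  shows "rmult a x \<in> tensor_power_relations A (Suc n)"
proof (rule tensor_relations_map [OF additive_rmult add_subgroup_tensor _ assms(2)])
  show "multilinear_into (Suc n) (\<lambda>l. rmult a (frag_of l)) (tensor_power_relations A (Suc n))"
    by (rule multilinear_cong [OF _ multilinear_update [of n "Suc n" "\<lambda>x. x \<otimes> a"]])
       (use assms in \<open>auto simp: rmult_frag_of pure_tensors_def l_distr smult_mult\<close>)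
qed

lemma keys_lmult:
  "\<lbrakk>a \<in> carrier A; y \<in> tensors (Suc n)\<rbrakk> \<Longrightarrow> lmult a y \<in> tensors (Suc n)"
  unfolding lmult_def mem_Collect_eq
  by (erule keys_extend_subset) (auto simp: pure_tensors_def length_Suc_conv)

lemma keys_rmult:
  "\<lbrakk>a \<in> carrier A; y \<in> tensors (Suc n)\<rbrakk> \<Longrightarrow> rmult a y \<in> tensors (Suc n)"
  unfolding rmult_def mem_Collect_eq
  by (erule keys_extend_subset) (auto simp: pure_tensors_def length_Suc_conv_rev)

lemma keys_bar_map:
  "y \<in> tensors (n + 2) \<Longrightarrow> bar_map n y \<in> tensors (n + 1)"
  unfolding bar_map_def mem_Collect_eq
proof (erule keys_extend_subset)
  fix x assume x: "x \<in> pure_tensors A (n + 2)"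
  have "Poly_Mapping.keys (\<Sum>i\<le>n. frag_cmul ((- 1) ^ i) (frag_of (contract i x)))
      \<subseteq> (\<Union>i\<in>{..n}. {contract i x})"
    by (rule order_trans [OF keys_sum]) (use keys_cmul in force)
  also have "\<dots> \<subseteq> pure_tensors A (n + 1)"
    using x by (auto intro!: contract_pure)
  finally show "Poly_Mapping.keys (\<Sum>i\<le>n. frag_cmul ((- 1) ^ i) (frag_of (contract i x)))
      \<subseteq> pure_tensors A (n + 1)" .
qed

lemma tensors_induct:
  assumes "y \<in> tensors n" "add_subgroup H" "\<And>l. l \<in> pure_tensors A n \<Longrightarrow> frag_of l \<in> H"
  shows "y \<in> H"
  using assms(1) [simplified]
  by (induction rule: frag_induction) (use assms in \<open>auto simp: add_subgroup_zero add_subgroup_diff\<close>)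

lemma tensors_eqI:
  assumes "y \<in> tensors n" "Modules.additive f" "Modules.additive g"
    and "\<And>l. l \<in> pure_tensors A n \<Longrightarrow> f (frag_of l) = g (frag_of l)"
  shows "f y = g y"
  using assms(1) [simplified]
  by (induction rule: frag_induction) (use assms in \<open>auto simp: additive.zero additive.diff\<close>)

lemma bar_map_frag_of:
  "bar_map n (frag_of l) = (\<Sum>i\<le>n. frag_cmul ((- 1) ^ i) (frag_of (contract i l)))"
  by (simp add: bar_map_def)

lemma lmult_cmul: "lmult a (frag_cmul c y) = frag_cmul c (lmult a y)"
  by (simp add: lmult_def frag_extend_cmul)

lemma rmult_cmul: "rmult a (frag_cmul c y) = frag_cmul c (rmult a y)"
  by (simp add: rmult_def frag_extend_cmul)

lemma bar_map_lmult:
  assumes a: "a \<in> carrier A" and y: "y \<in> tensors (n + 3)"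
  shows "bar_map (Suc n) (lmult a y) = lmult a (bar_map (Suc n) y)"
proof (rule tensors_eqI [OF y, of "\<lambda>y. bar_map (Suc n) (lmult a y)" "\<lambda>y. lmult a (bar_map (Suc n) y)"])
  fix l assume l: "l \<in> pure_tensors A (n + 3)"
  have len: "length l = Suc (n + 2)" "length l = Suc (Suc (Suc n))" and mem: "\<And>i. i < n + 3 \<Longrightarrow> l ! i \<in> carrier A"
    using l by (auto simp: pure_tensors_def)
  \<comment> \<open>Only the contraction at i = 0 involves the first entry, and there the claim is
    associativity.\<close>
  have *: "contract i (l[0 := a \<otimes> l ! 0]) = (contract i l)[0 := a \<otimes> contract i l ! 0]" if "i \<le> Suc n" for i
    using that a mem [of 0] mem [of 1] by (simp add: contract_update [OF len(1)] nth_contract [OF len(1)] m_assoc)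
  show "bar_map (Suc n) (lmult a (frag_of l)) = lmult a (bar_map (Suc n) (frag_of l))"
    unfolding bar_map_frag_of lmult_frag_of [OF len(2)] additive.sum [OF additive_lmult] lmult_cmul
    using len by (intro sum.cong) (auto simp: * lmult_frag_of [of _ "Suc n"] length_contract)
qed (rule additive_compose [OF additive_bar_map additive_lmult] additive_compose [OF additive_lmult additive_bar_map])+

lemma bar_map_rmult:
  assumes a: "a \<in> carrier A" and y: "y \<in> tensors (n + 3)"
  shows "bar_map (Suc n) (rmult a y) = rmult a (bar_map (Suc n) y)"
proof (rule tensors_eqI [OF y, of "\<lambda>y. bar_map (Suc n) (rmult a y)" "\<lambda>y. rmult a (bar_map (Suc n) y)"])
  fix l assume l: "l \<in> pure_tensors A (n + 3)"
  have len: "length l = Suc (n + 2)" "length l = Suc (Suc (Suc n))" and mem: "\<And>i. i < n + 3 \<Longrightarrow> l ! i \<in> carrier A"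
    using l by (auto simp: pure_tensors_def)
  \<comment> \<open>Only the contraction at i = n + 1 involves the last entry, and there the claim
    is associativity.\<close>
  have *: "contract i (l[n + 2 := l ! (n + 2) \<otimes> a]) = (contract i l)[n + 1 := contract i l ! (n + 1) \<otimes> a]"
    if "i \<le> Suc n" for i
    using that a mem [of "n + 1"] mem [of "n + 2"]
    by (auto simp: contract_update [OF len(1)] nth_contract [OF len(1)] m_assoc)
  show "bar_map (Suc n) (rmult a (frag_of l)) = rmult a (bar_map (Suc n) (frag_of l))"
    unfolding bar_map_frag_of rmult_frag_of [OF len(2)] additive.sum [OF additive_rmult] rmult_cmul
    using len * by (intro sum.cong) (auto simp: rmult_frag_of [of _ "Suc n"] length_contract)
qed (rule additive_compose [OF additive_bar_map additive_rmult] additive_compose [OF additive_rmult additive_bar_map])+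

abbreviation tensor_class :: "nat \<Rightarrow> ('a list \<Rightarrow>\<^sub>0 int) \<Rightarrow> ('a list \<Rightarrow>\<^sub>0 int) set" where
  "tensor_class n \<equiv> add_coset (tensor_power_relations A n)"

lemma tensor_power_free_eq: "tensor_power_free A n = free_Abelian_group (pure_tensors A n)"
  by (simp add: tensor_power_free_def pure_tensors_def)

lemma carrier_bar: "carrier (bar_bimodule A n) = tensor_class (n + 2) ` tensors (n + 2)"
  by (simp add: bar_bimodule_def Let_def monoid.defs bimodule.defs tensor_power_free_eq carrier_free_Mod
      del: add_2_eq_Suc')

lemma mult_bar: "tensor_class (n + 2) x \<otimes>\<^bsub>bar_bimodule A n\<^esub> tensor_class (n + 2) y = tensor_class (n + 2) (x + y)"
  by (simp add: bar_bimodule_def Let_def monoid.defs bimodule.defs tensor_power_free_eq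
      set_mult_free add_subgroup_tensor del: add_2_eq_Suc')

lemma lact_bar:
  assumes "a \<in> carrier A"
  shows "lact (bar_bimodule A n) a (tensor_class (n + 2) y) = tensor_class (n + 2) (lmult a y)"
proof -
  have "lact (bar_bimodule A n) a (tensor_class (n + 2) y) =
      coset_map (free_Abelian_group (pure_tensors A (n + 2))) (tensor_power_relations A (n + 2)) (lmult a)
        (tensor_class (n + 2) y)"
    by (simp add: bar_bimodule_def Let_def monoid.defs bimodule.defs tensor_power_free_eq lmult_def
       del: add_2_eq_Suc')
  also have "\<dots> = tensor_class (n + 2) (lmult a y)"
    using lmult_relations [OF assms, of _ "n + 1"]
    by (intro coset_map_add_coset add_subgroup_tensor additive_lmult) simp
  finally show ?thesis .
qed

lemma ract_bar:
  assumes "a \<in> carrier A"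
  shows "ract (bar_bimodule A n) (tensor_class (n + 2) y) a = tensor_class (n + 2) (rmult a y)"
proof -
  have "ract (bar_bimodule A n) (tensor_class (n + 2) y) a =
      coset_map (free_Abelian_group (pure_tensors A (n + 2))) (tensor_power_relations A (n + 2)) (rmult a)
        (tensor_class (n + 2) y)"
    by (simp add: bar_bimodule_def Let_def monoid.defs bimodule.defs tensor_power_free_eq rmult_def
       del: add_2_eq_Suc')
  also have "\<dots> = tensor_class (n + 2) (rmult a y)"
    using rmult_relations [OF assms, of _ "n + 1"]
    by (intro coset_map_add_coset add_subgroup_tensor additive_rmult) simp
  finally show ?thesis .
qed

lemma bar_differential_class:
  "bar_differential A n (tensor_class (n + 2) y) = tensor_class (n + 1) (bar_map n y)"
proof -
  have "bar_differential A n (tensor_class (n + 2) y) =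
      coset_map (free_Abelian_group (pure_tensors A (n + 1))) (tensor_power_relations A (n + 1)) (bar_map n)
        (tensor_class (n + 2) y)"
    by (simp only: bar_differential_def tensor_power_free_eq bar_map_def contract_def)
  also have "\<dots> = tensor_class (n + 1) (bar_map n y)"
    by (intro coset_map_add_coset add_subgroup_tensor additive_bar_map bar_map_relations)
  finally show ?thesis .
qed

subsection \<open>Chains over the enveloping algebra\<close>

abbreviation chain_relations :: "nat \<Rightarrow> ('a \<times> ('a list \<Rightarrow>\<^sub>0 int) set \<Rightarrow>\<^sub>0 int) set" where
  "chain_relations n \<equiv> bitensor_relations A (regular_bimodule A) (bar_bimodule A n)"

abbreviation chain_basis :: "nat \<Rightarrow> ('a \<times> ('a list \<Rightarrow>\<^sub>0 int) set) set" where
  "chain_basis n \<equiv> carrier A \<times> tensor_class (n + 2) ` tensors (n + 2)"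

text \<open>The symbol of m \<otimes> y, where y is a formal sum of pure tensors representing a
  coset.\<close>

definition chain_of :: "nat \<Rightarrow> 'a \<Rightarrow> ('a list \<Rightarrow>\<^sub>0 int) \<Rightarrow> ('a \<times> ('a list \<Rightarrow>\<^sub>0 int) set \<Rightarrow>\<^sub>0 int)" where
  "chain_of n m y = frag_of (m, tensor_class (n + 2) y)"

definition chain_generators :: "nat \<Rightarrow> ('a \<times> ('a list \<Rightarrow>\<^sub>0 int) set \<Rightarrow>\<^sub>0 int) set" where
  "chain_generators n =
     {chain_of n (m \<oplus>\<^bsub>A\<^esub> m') y - chain_of n m y - chain_of n m' y | m m' y.
         m \<in> carrier A \<and> m' \<in> carrier A \<and> y \<in> tensors (n + 2)} \<union>
     {chain_of n m (y + y') - chain_of n m y - chain_of n m y' | m y y'.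
         m \<in> carrier A \<and> y \<in> tensors (n + 2) \<and> y' \<in> tensors (n + 2)} \<union>
     {chain_of n (m \<otimes> a) y - chain_of n m (lmult a y) | m a y.
         m \<in> carrier A \<and> a \<in> carrier A \<and> y \<in> tensors (n + 2)} \<union>
     {chain_of n (a \<otimes> m) y - chain_of n m (rmult a y) | m a y.
         m \<in> carrier A \<and> a \<in> carrier A \<and> y \<in> tensors (n + 2)}"

text \<open>Expressing the relations by representatives allows the formal maps \<open>lmult\<close>,
  \<open>rmult\<close> and \<open>bar_map\<close> to be used in place of maps between
  cosets.\<close>

lemma chain_relations_eq:
  "chain_relations n = generate (free_Abelian_group (chain_basis n)) (chain_generators n)"
proof -
  let ?M = "regular_bimodule A" and ?N = "bar_bimodule A n" and ?T = "tensors (n + 2)"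
  have 1: "{frag_of (m \<otimes>\<^bsub>?M\<^esub> m', Y) - frag_of (m, Y) - frag_of (m', Y) | m m' Y.
         m \<in> carrier ?M \<and> m' \<in> carrier ?M \<and> Y \<in> carrier ?N} =
      {chain_of n (m \<oplus>\<^bsub>A\<^esub> m') y - chain_of n m y - chain_of n m' y | m m' y.
         m \<in> carrier A \<and> m' \<in> carrier A \<and> y \<in> ?T}"
    unfolding carrier_bar chain_of_def regular_bimodule_def by (simp del: add_2_eq_Suc') blast
  have 2: "{frag_of (m, Y \<otimes>\<^bsub>?N\<^esub> Y') - frag_of (m, Y) - frag_of (m, Y') | m Y Y'.
         m \<in> carrier ?M \<and> Y \<in> carrier ?N \<and> Y' \<in> carrier ?N} =
      {chain_of n m (y + y') - chain_of n m y - chain_of n m y' | m y y'.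
         m \<in> carrier A \<and> y \<in> ?T \<and> y' \<in> ?T}" (is "?L = ?R")
  proof -
    have "?L = {frag_of (m, tensor_class (n + 2) y \<otimes>\<^bsub>?N\<^esub> tensor_class (n + 2) y') -
        chain_of n m y - chain_of n m y' | m y y'. m \<in> carrier A \<and> y \<in> ?T \<and> y' \<in> ?T}"
      unfolding carrier_bar chain_of_def regular_bimodule_def by (simp del: add_2_eq_Suc') blast
    then show ?thesis
      unfolding mult_bar chain_of_def .
  qed
  have 3: "{frag_of (ract ?M m a, Y) - frag_of (m, lact ?N a Y) | m a Y.
         m \<in> carrier ?M \<and> a \<in> carrier A \<and> Y \<in> carrier ?N} =
      {chain_of n (m \<otimes> a) y - chain_of n m (lmult a y) | m a y.
         m \<in> carrier A \<and> a \<in> carrier A \<and> y \<in> ?T}" (is "?L = ?R")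
  proof -
    have "?L = {chain_of n (m \<otimes> a) y - frag_of (m, lact ?N a (tensor_class (n + 2) y)) | m a y.
        m \<in> carrier A \<and> a \<in> carrier A \<and> y \<in> ?T}"
      unfolding carrier_bar chain_of_def regular_bimodule_def by (simp del: add_2_eq_Suc') blast
    also have "\<dots> = ?R"
      by (rule setcompr_cong3) (metis chain_of_def lact_bar)
    finally show ?thesis .
  qed
  have 4: "{frag_of (lact ?M a m, Y) - frag_of (m, ract ?N Y a) | m a Y.
         m \<in> carrier ?M \<and> a \<in> carrier A \<and> Y \<in> carrier ?N} =
      {chain_of n (a \<otimes> m) y - chain_of n m (rmult a y) | m a y.
         m \<in> carrier A \<and> a \<in> carrier A \<and> y \<in> ?T}" (is "?L = ?R")
  proof -
    have "?L = {chain_of n (a \<otimes> m) y - frag_of (m, ract ?N (tensor_class (n + 2) y) a) | m a y.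
        m \<in> carrier A \<and> a \<in> carrier A \<and> y \<in> ?T}"
      unfolding carrier_bar chain_of_def regular_bimodule_def by (simp del: add_2_eq_Suc') blast
    also have "\<dots> = ?R"
      by (rule setcompr_cong3) (metis chain_of_def ract_bar)
    finally show ?thesis .
  qed
  have 5: "carrier ?M \<times> carrier ?N = chain_basis n"
    by (simp add: carrier_bar regular_bimodule_def del: add_2_eq_Suc')
  show ?thesis
    unfolding bitensor_relations_def bitensor_free_def 1 2 3 4 5 chain_generators_def ..
qed

lemma keys_chain_of:
  "\<lbrakk>m \<in> carrier A; y \<in> tensors (n + 2)\<rbrakk> \<Longrightarrow> Poly_Mapping.keys (chain_of n m y) \<subseteq> chain_basis n"
  by (auto simp: chain_of_def)

lemma keys_chain_generators:
  "x \<in> chain_generators n \<Longrightarrow> Poly_Mapping.keys x \<subseteq> chain_basis n"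
  unfolding chain_generators_def
  by (elim UnE CollectE exE conjE; hypsubst; intro keys_diff_subset keys_chain_of)
     (use keys_lmult [of _ _ "n + 1"] keys_rmult [of _ _ "n + 1"] in \<open>simp_all add: keys_add_subset\<close>)

lemma add_subgroup_chain: "add_subgroup (chain_relations n)"
  unfolding chain_relations_eq by (rule add_subgroup_generate_free) (rule keys_chain_generators)

lemma keys_chain: "x \<in> chain_relations n \<Longrightarrow> Poly_Mapping.keys x \<subseteq> chain_basis n"
  unfolding chain_relations_eq
  by (rule keys_generate_free [of "chain_generators n"]) (rule keys_chain_generators)

lemma chain_relations_incl: "x \<in> chain_generators n \<Longrightarrow> x \<in> chain_relations n"
  unfolding chain_relations_eq by (rule generate.incl)

lemma chain_add_left:
  assumes "m \<in> carrier A" "m' \<in> carrier A" "y \<in> tensors (n + 2)"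
  shows "chain_of n (m \<oplus>\<^bsub>A\<^esub> m') y - chain_of n m y - chain_of n m' y \<in> chain_relations n"
  by (rule chain_relations_incl) (use assms in \<open>unfold chain_generators_def, blast\<close>)

lemma chain_add_right:
  assumes "m \<in> carrier A" "y \<in> tensors (n + 2)" "y' \<in> tensors (n + 2)"
  shows "chain_of n m (y + y') - chain_of n m y - chain_of n m y' \<in> chain_relations n"
  by (rule chain_relations_incl) (use assms in \<open>unfold chain_generators_def, blast\<close>)

lemma chain_lmult:
  assumes "m \<in> carrier A" "a \<in> carrier A" "y \<in> tensors (n + 2)"
  shows "chain_of n (m \<otimes> a) y - chain_of n m (lmult a y) \<in> chain_relations n"
  by (rule chain_relations_incl) (use assms in \<open>unfold chain_generators_def, blast\<close>)

lemma chain_rmult: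
  assumes "m \<in> carrier A" "a \<in> carrier A" "y \<in> tensors (n + 2)"
  shows "chain_of n (a \<otimes> m) y - chain_of n m (rmult a y) \<in> chain_relations n"
  by (rule chain_relations_incl) (use assms in \<open>unfold chain_generators_def, blast\<close>)

lemma chain_zero_right:
  assumes "m \<in> carrier A"
  shows "chain_of n m 0 \<in> chain_relations n"
  using add_subgroup_minus [OF add_subgroup_chain chain_add_right [of m 0 n 0]] assms by simp

lemma chain_diff_right:
  assumes "m \<in> carrier A" "y \<in> tensors (n + 2)" "y' \<in> tensors (n + 2)"
  shows "chain_of n m (y - y') - (chain_of n m y - chain_of n m y') \<in> chain_relations n"
  using add_subgroup_minus [OF add_subgroup_chain chain_add_right [of m "y - y'" n y']]
    assms keys_diff_subset [of y "pure_tensors A (n + 2)" y'] by (simp add: algebra_simps)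

lemma chain_zero_left:
  assumes "y \<in> tensors (n + 2)"
  shows "chain_of n \<zero> y \<in> chain_relations n"
  using add_subgroup_minus [OF add_subgroup_chain chain_add_left [of \<zero> \<zero> y n]] assms by simp

lemma chain_diff_left:
  assumes "m \<in> carrier A" "m' \<in> carrier A" "y \<in> tensors (n + 2)"
  shows "chain_of n (m \<ominus> m') y - (chain_of n m y - chain_of n m' y) \<in> chain_relations n"
proof -
  have "m \<ominus> m' \<oplus>\<^bsub>A\<^esub> m' = m"
    using assms by (simp add: minus_eq a_assoc l_neg)
  then show ?thesis
    using add_subgroup_minus [OF add_subgroup_chain chain_add_left [of "m \<ominus> m'" m' y n]] assms
    by (simp add: algebra_simps)
qed

text \<open>The universal property of the tensor product over the enveloping algebra, again through
  the preimage of a subgroup.\<close>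

lemma chain_relations_map:
  assumes f: "Modules.additive f" and H: "add_subgroup H"
    and addl: "\<And>m m' y. \<lbrakk>m \<in> carrier A; m' \<in> carrier A; y \<in> tensors (n + 2)\<rbrakk> \<Longrightarrow>
       f (chain_of n (m \<oplus>\<^bsub>A\<^esub> m') y) - f (chain_of n m y) - f (chain_of n m' y) \<in> H"
    and addr: "\<And>m y y'. \<lbrakk>m \<in> carrier A; y \<in> tensors (n + 2); y' \<in> tensors (n + 2)\<rbrakk> \<Longrightarrow>
       f (chain_of n m (y + y')) - f (chain_of n m y) - f (chain_of n m y') \<in> H"
    and l: "\<And>m a y. \<lbrakk>m \<in> carrier A; a \<in> carrier A; y \<in> tensors (n + 2)\<rbrakk> \<Longrightarrow>
       f (chain_of n (m \<otimes> a) y) - f (chain_of n m (lmult a y)) \<in> H"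
    and r: "\<And>m a y. \<lbrakk>m \<in> carrier A; a \<in> carrier A; y \<in> tensors (n + 2)\<rbrakk> \<Longrightarrow>
       f (chain_of n (a \<otimes> m) y) - f (chain_of n m (rmult a y)) \<in> H"
    and x: "x \<in> chain_relations n"
  shows "f x \<in> H"
proof -
  have "chain_relations n \<subseteq> {x. f x \<in> H}"
    unfolding chain_relations_eq
  proof (rule generate_free_least)
    show "chain_generators n \<subseteq> {x. f x \<in> H}"
      unfolding chain_generators_def
      by (intro Un_least subsetI CollectI; elim CollectE exE conjE; hypsubst)
         (simp_all add: additive.diff [OF f] addl addr l r del: add_2_eq_Suc')
  qed (use keys_chain_generators add_subgroup_vimage [OF f H] in auto)
  with x show ?thesis
    by blast
qed

lemma chain_induct:
  assumes z: "Poly_Mapping.keys z \<subseteq> chain_basis n" and H: "add_subgroup H"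
    and "\<And>m y. \<lbrakk>m \<in> carrier A; y \<in> tensors (n + 2)\<rbrakk> \<Longrightarrow> chain_of n m y \<in> H"
  shows "z \<in> H"
  using z by (induction rule: frag_induction)
    (use assms in \<open>auto simp: add_subgroup_zero add_subgroup_diff chain_of_def\<close>)

text \<open>H has to contain the relations, since m \<otimes> (u - v) and m \<otimes> u - m
  \<otimes> v are different formal sums that agree only modulo them.\<close>

lemma chain_induct_pure:
  assumes z: "Poly_Mapping.keys z \<subseteq> chain_basis n" and H: "add_subgroup H" "chain_relations n \<subseteq> H"
    and pure: "\<And>m l. \<lbrakk>m \<in> carrier A; l \<in> pure_tensors A (n + 2)\<rbrakk> \<Longrightarrow> chain_of n m (frag_of l) \<in> H"
  shows "z \<in> H"
proof (rule chain_induct [OF z H(1)])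
  fix m y assume m: "m \<in> carrier A" and y: "y \<in> tensors (n + 2)"
  have "y \<in> {y \<in> tensors (n + 2). chain_of n m y \<in> H}"
  proof (rule tensors_induct [OF y add_subgroupI])
    show "0 \<in> {y \<in> tensors (n + 2). chain_of n m y \<in> H}"
      using chain_zero_right [OF m] H by auto
  next
    fix u v assume uv: "u \<in> {y \<in> tensors (n + 2). chain_of n m y \<in> H}"
      "v \<in> {y \<in> tensors (n + 2). chain_of n m y \<in> H}"
    then have "chain_of n m (u - v) - (chain_of n m u - chain_of n m v) \<in> H"
      using chain_diff_right [OF m] H by blast
    then show "u - v \<in> {y \<in> tensors (n + 2). chain_of n m y \<in> H}"
      using uv add_subgroup_cong_iff [OF H(1)] add_subgroup_diff [OF H(1)] keys_diff_subset by blast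
  qed (use pure m in auto)
  then show "chain_of n m y \<in> H"
    by blast
qed

section \<open>The Hochschild boundary on formal chains\<close>

definition chain_boundary where
  "chain_boundary n = frag_extend (\<lambda>(m, X). frag_of (m, bar_differential A n X))"

lemma additive_chain_boundary: "Modules.additive (chain_boundary n)"
  by (simp add: chain_boundary_def additive_frag_extend)

lemma chain_boundary_chain_of:
  "chain_boundary (Suc n) (chain_of (Suc n) m y) = chain_of n m (bar_map (Suc n) y)"
  using bar_differential_class [of "Suc n" y] by (simp add: chain_boundary_def chain_of_def)

lemma keys_chain_boundary:
  assumes "Poly_Mapping.keys z \<subseteq> chain_basis (Suc n)"
  shows "Poly_Mapping.keys (chain_boundary (Suc n) z) \<subseteq> chain_basis n"
proof -
  have "z \<in> {z. chain_boundary (Suc n) z \<in> {c. Poly_Mapping.keys c \<subseteq> chain_basis n}}"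
    by (rule chain_induct [OF assms add_subgroup_vimage [OF additive_chain_boundary add_subgroup_keys]])
      (use keys_bar_map [of _ "Suc n"] keys_chain_of in \<open>auto simp: chain_boundary_chain_of\<close>)
  then show ?thesis
    by simp
qed

lemma chain_boundary_relations:
  assumes "x \<in> chain_relations (Suc n)"
  shows "chain_boundary (Suc n) x \<in> chain_relations n"
proof (rule chain_relations_map [OF additive_chain_boundary add_subgroup_chain _ _ _ _ assms])
  have *: "bar_map (Suc n) y \<in> tensors (n + 2)" if "y \<in> tensors (Suc n + 2)" for y
    using keys_bar_map [OF that] by simp
  note lr = bar_map_lmult [of _ _ n] bar_map_rmult [of _ _ n]
  fix m m' a y y' assume m: "m \<in> carrier A" "m' \<in> carrier A" "a \<in> carrier A"
    and y: "y \<in> tensors (Suc n + 2)" "y' \<in> tensors (Suc n + 2)"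
  have y3: "y \<in> tensors (n + 3)"
    using y(1) by (simp add: eval_nat_numeral)
  show "chain_boundary (Suc n) (chain_of (Suc n) (m \<oplus>\<^bsub>A\<^esub> m') y) - chain_boundary (Suc n) (chain_of (Suc n) m y) -
     chain_boundary (Suc n) (chain_of (Suc n) m' y) \<in> chain_relations n"
    unfolding chain_boundary_chain_of by (rule chain_add_left [OF m(1,2) * [OF y(1)]])
  show "chain_boundary (Suc n) (chain_of (Suc n) m (y + y')) - chain_boundary (Suc n) (chain_of (Suc n) m y) -
     chain_boundary (Suc n) (chain_of (Suc n) m y') \<in> chain_relations n"
    unfolding chain_boundary_chain_of additive.add [OF additive_bar_map]
    by (rule chain_add_right [OF m(1) * [OF y(1)] * [OF y(2)]])
  show "chain_boundary (Suc n) (chain_of (Suc n) (m \<otimes> a) y) -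
     chain_boundary (Suc n) (chain_of (Suc n) m (lmult a y)) \<in> chain_relations n"
    unfolding chain_boundary_chain_of lr(1) [OF m(3) y3] by (rule chain_lmult [OF m(1,3) * [OF y(1)]])
  show "chain_boundary (Suc n) (chain_of (Suc n) (a \<otimes> m) y) -
     chain_boundary (Suc n) (chain_of (Suc n) m (rmult a y)) \<in> chain_relations n"
    unfolding chain_boundary_chain_of lr(2) [OF m(3) y3] by (rule chain_rmult [OF m(1,3) * [OF y(1)]])
qed

section \<open>The first homology group as cycles modulo boundaries\<close>

lemma bitensor_free_eq:
  "bitensor_free (regular_bimodule A) (bar_bimodule A n) = free_Abelian_group (chain_basis n)"
  by (simp add: bitensor_free_def carrier_bar regular_bimodule_def del: add_2_eq_Suc')

lemma carrier_chains:
  "carrier (hochschild_chains A n) = add_coset (chain_relations n) ` {z. Poly_Mapping.keys z \<subseteq> chain_basis n}"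
  by (simp add: hochschild_chains_def bitensor_def bitensor_free_eq carrier_free_Mod del: add_2_eq_Suc')

lemma one_chains: "\<one>\<^bsub>hochschild_chains A n\<^esub> = chain_relations n"
  by (simp add: hochschild_chains_def bitensor_def)

lemma mult_chains:
  "add_coset (chain_relations n) x \<otimes>\<^bsub>hochschild_chains A n\<^esub> add_coset (chain_relations n) y =
   add_coset (chain_relations n) (x + y)"
  by (simp add: hochschild_chains_def bitensor_def bitensor_free_eq set_mult_free add_subgroup_chain del: add_2_eq_Suc')

lemma comm_group_chains: "comm_group (hochschild_chains A n)"
  unfolding hochschild_chains_def bitensor_def bitensor_free_eq
  by (rule comm_group_free_Mod [OF add_subgroup_chain keys_chain])

lemma boundary_chains:
  "hochschild_boundary A (Suc n) (add_coset (chain_relations (Suc n)) z) =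
   add_coset (chain_relations n) (chain_boundary (Suc n) z)"
  unfolding hochschild_boundary_def bitensor_map_def bitensor_free_eq diff_Suc_1 chain_boundary_def
  by (rule coset_map_add_coset)
     (use add_subgroup_chain additive_frag_extend chain_boundary_relations in \<open>auto simp: chain_boundary_def\<close>)

lemma chain_boundary_boundary:
  assumes "Poly_Mapping.keys w \<subseteq> chain_basis 2"
  shows "chain_boundary 1 (chain_boundary 2 w) \<in> chain_relations 0"
proof -
  \<comment> \<open>This is the degree that enters the first homology group; the six terms cancel in
    pairs by associativity.\<close>
  have *: "bar_map 1 (bar_map 2 y) = 0" if "y \<in> tensors (2 + 2)" for y
  proof (rule tensors_eqI [OF that, of "\<lambda>y. bar_map 1 (bar_map 2 y)" "\<lambda>y. 0"])
    fix l assume "l \<in> pure_tensors A (2 + 2)"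
    then obtain a b c d where l: "l = [a, b, c, d]" "a \<in> carrier A" "b \<in> carrier A" "c \<in> carrier A" "d \<in> carrier A"
      by (auto simp: pure_tensors_def numeral_eq_Suc length_Suc_conv)
    show "bar_map 1 (bar_map 2 (frag_of l)) = 0"
      using l(2-) by (simp add: l(1) bar_map_def frag_extend_simps contract_def numeral_eq_Suc m_assoc)
  qed (auto simp: Modules.additive_def additive.add [OF additive_bar_map])
  have "w \<in> {w. chain_boundary 1 (chain_boundary 2 w) \<in> chain_relations 0}"
  proof (rule chain_induct [OF assms add_subgroup_vimage
        [OF additive_compose [OF additive_chain_boundary additive_chain_boundary] add_subgroup_chain]])
    fix m y assume my: "m \<in> carrier A" "y \<in> tensors (2 + 2)"
    then show "chain_of 2 m y \<in> {w. chain_boundary 1 (chain_boundary 2 w) \<in> chain_relations 0}"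
      using chain_boundary_chain_of [of 1 m y] chain_boundary_chain_of [of 0 m] * [OF my(2)]
        chain_zero_right [of m 0] by (simp add: numeral_2_eq_2)
  qed
  then show ?thesis
    by simp
qed

lemma kernel_chains:
  "hochschild_cycles A 1 = add_coset (chain_relations 1) `
     {z. Poly_Mapping.keys z \<subseteq> chain_basis 1 \<and> chain_boundary 1 z \<in> chain_relations 0}"
proof -
  have "hochschild_boundary A 1 (add_coset (chain_relations 1) z) = chain_relations 0 \<longleftrightarrow>
      chain_boundary 1 z \<in> chain_relations 0" for z
    using boundary_chains [of 0] by (simp add: add_coset_eq_zero_iff add_subgroup_chain)
  moreover have "hochschild_cycles A 1 =
      {x \<in> carrier (hochschild_chains A 1). hochschild_boundary A 1 x = chain_relations 0}"
    by (simp add: hochschild_cycles_def kernel_def one_chains)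
  ultimately show ?thesis
    by (simp add: carrier_chains Collect_mem_image)
qed

lemma image_boundary:
  "hochschild_boundary A (1 + 1) ` carrier (hochschild_chains A (1 + 1)) =
   add_coset (chain_relations 1) ` chain_boundary 2 ` {w. Poly_Mapping.keys w \<subseteq> chain_basis 2}"
  using boundary_chains [of 1]
  by (auto simp: carrier_chains image_image numeral_2_eq_2)

lemma keys_chain_boundary2:
  "Poly_Mapping.keys w \<subseteq> chain_basis 2 \<Longrightarrow> Poly_Mapping.keys (chain_boundary 2 w) \<subseteq> chain_basis 1"
  using keys_chain_boundary [of w 1] by (simp add: numeral_2_eq_2)

lemma boundary_hom:
  "hochschild_boundary A 1 \<in> hom (hochschild_chains A 1) (hochschild_chains A 0)"
proof (rule homI)
  fix x assume "x \<in> carrier (hochschild_chains A 1)"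
  then show "hochschild_boundary A 1 x \<in> carrier (hochschild_chains A 0)"
    using boundary_chains [of 0] keys_chain_boundary [of _ 0] by (fastforce simp: carrier_chains)
next
  fix x y assume "x \<in> carrier (hochschild_chains A 1)" "y \<in> carrier (hochschild_chains A 1)"
  then show "hochschild_boundary A 1 (x \<otimes>\<^bsub>hochschild_chains A 1\<^esub> y) =
      hochschild_boundary A 1 x \<otimes>\<^bsub>hochschild_chains A 0\<^esub> hochschild_boundary A 1 y"
    using boundary_chains [of 0]
    by (auto simp: carrier_chains mult_chains additive.add [OF additive_chain_boundary])
qed

lemma trivial_hochschild_homology_iff:
  "trivial_group (hochschild_homology A 1) \<longleftrightarrow>
     (\<forall>z. Poly_Mapping.keys z \<subseteq> chain_basis 1 \<and> chain_boundary 1 z \<in> chain_relations 0 \<longrightarrow>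
       (\<exists>w. Poly_Mapping.keys w \<subseteq> chain_basis 2 \<and> z - chain_boundary 2 w \<in> chain_relations 1))"
  (is "_ \<longleftrightarrow> (\<forall>z. ?cycle z \<longrightarrow> (\<exists>w. ?bounds z w))")
proof -
  let ?G = "(hochschild_chains A 1)\<lparr>carrier := hochschild_cycles A 1\<rparr>"
  let ?B = "hochschild_boundary A (1 + 1) ` carrier (hochschild_chains A (1 + 1))"
  interpret C1: comm_group "hochschild_chains A 1" by (rule comm_group_chains)
  interpret C0: comm_group "hochschild_chains A 0" by (rule comm_group_chains)
  interpret d: group_hom "hochschild_chains A 1" "hochschild_chains A 0" "hochschild_boundary A 1"
    using boundary_hom by unfold_locales
  have "subgroup (hochschild_cycles A 1) (hochschild_chains A 1)"
    using d.subgroup_kernel by (simp add: hochschild_cycles_def)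
  then have G: "group ?G"
    by (rule subgroup.subgroup_is_group) (rule C1.is_group)
  have cycles: "carrier ?G = hochschild_cycles A 1"
    by simp
  have sub: "?B \<subseteq> carrier ?G"
    unfolding cycles unfolding image_boundary kernel_chains
    by (intro image_mono subsetI CollectI; elim imageE CollectE)
      (hypsubst, intro conjI keys_chain_boundary2 chain_boundary_boundary)
  have one: "\<one>\<^bsub>?G\<^esub> \<in> ?B"
    unfolding image_boundary
    by (auto simp: one_chains image_image additive.zero [OF additive_chain_boundary] add_coset_zero
        intro!: image_eqI [of _ _ 0])
  have "trivial_group (hochschild_homology A 1) \<longleftrightarrow> carrier ?G = ?B"
    unfolding hochschild_homology_def by (rule trivial_group_quotient_iff [OF G sub one])
  also have "\<dots> \<longleftrightarrow> hochschild_cycles A 1 \<subseteq> ?B"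
    using sub unfolding cycles by blast
  also have "\<dots> \<longleftrightarrow> (\<forall>z. ?cycle z \<longrightarrow> (\<exists>w. ?bounds z w))"
    unfolding image_boundary kernel_chains image_subset_image_iff add_coset_eq_iff [OF add_subgroup_chain] ..
  finally show ?thesis .
qed

subsection \<open>First Hochschild homology\<close>

text \<open>A functional on chains is given by its values on m and a pure tensor. Multilinearity
  makes it independent of the representative of a coset, and the last two conditions are the balance
  over the enveloping algebra.\<close>

lemma chain_functional:
  fixes g :: "'a \<Rightarrow> 'a list \<Rightarrow> 'b::comm_ring_1"
  assumes g_add_left: "\<And>m m' l. \<lbrakk>m \<in> carrier A; m' \<in> carrier A; l \<in> pure_tensors A (n + 2)\<rbrakk> \<Longrightarrow>
      g (m \<oplus>\<^bsub>A\<^esub> m') l = g m l + g m' l"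
    and g_add: "\<And>m l i a b. \<lbrakk>m \<in> carrier A; l \<in> pure_tensors A (n + 2); i < n + 2; a \<in> carrier A; b \<in> carrier A\<rbrakk> \<Longrightarrow>
      g m (l[i := a \<oplus>\<^bsub>A\<^esub> b]) = g m (l[i := a]) + g m (l[i := b])"
    and g_smult: "\<And>m l i j c. \<lbrakk>m \<in> carrier A; l \<in> pure_tensors A (n + 2); i < n + 2; j < n + 2\<rbrakk> \<Longrightarrow>
      g m (l[i := c \<odot> l ! i]) = g m (l[j := c \<odot> l ! j])"
    and g_lmult: "\<And>m l a. \<lbrakk>m \<in> carrier A; l \<in> pure_tensors A (n + 2); a \<in> carrier A\<rbrakk> \<Longrightarrow>
      g (m \<otimes> a) l = g m (l[0 := a \<otimes> l ! 0])"
    and g_rmult: "\<And>m l a. \<lbrakk>m \<in> carrier A; l \<in> pure_tensors A (n + 2); a \<in> carrier A\<rbrakk> \<Longrightarrow>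
      g (a \<otimes> m) l = g m (l[n + 1 := l ! (n + 1) \<otimes> a])"
  obtains \<phi> where "Modules.additive \<phi>" "\<And>x. x \<in> chain_relations n \<Longrightarrow> \<phi> x = 0"
    "\<And>m y. m \<in> carrier A \<Longrightarrow> \<phi> (chain_of n m y) = frag_eval (g m) y"
proof
  \<comment> \<open>A representative is chosen for each coset; \<open>ev\<close> below shows that
    the choice does not matter.\<close>
  let ?ev = "\<lambda>m X. frag_eval (g m) (SOME y. y \<in> X)"
  define \<phi> where "\<phi> = frag_eval (\<lambda>(m, X). ?ev m X)"
  have ev: "?ev m (tensor_class (n + 2) y) = frag_eval (g m) y" if m: "m \<in> carrier A" for m y
  proof -
    have mult: "multilinear_into (n + 2) (\<lambda>l. frag_eval (g m) (frag_of l)) {0}"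
      unfolding multilinear_into_def frag_eval_of
    proof (intro conjI ballI allI impI)
      fix l i a b assume "l \<in> pure_tensors A (n + 2)" "i < n + 2" "a \<in> carrier A" "b \<in> carrier A"
      then show "g m (l[i := a \<oplus>\<^bsub>A\<^esub> b]) - g m (l[i := a]) - g m (l[i := b]) \<in> {0}"
        using g_add [OF m, of l i a b] by simp
    next
      fix l i j c assume "l \<in> pure_tensors A (n + 2)" "i < n + 2" "j < n + 2"
      then show "g m (l[i := c \<odot> l ! i]) - g m (l[j := c \<odot> l ! j]) \<in> {0}"
        using g_smult [OF m, of l i j c] by simp
    qed
    let ?y' = "SOME z. z \<in> tensor_class (n + 2) y"
    have "?y' \<in> tensor_class (n + 2) y"
      by (rule someI) (rule add_coset_self [OF add_subgroup_tensor])
    then have "?y' - y \<in> tensor_power_relations A (n + 2)"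
      by (simp add: mem_add_coset_iff)
    then have "frag_eval (g m) (?y' - y) \<in> {0}"
      by (rule tensor_relations_map [OF additive_frag_eval add_subgroup_singleton_zero mult])
    then show ?thesis
      by (simp add: frag_eval_simps)
  qed
  show \<phi>: "Modules.additive \<phi>"
    by (simp add: \<phi>_def additive_frag_eval)
  show \<phi>_chain: "\<phi> (chain_of n m y) = frag_eval (g m) y" if "m \<in> carrier A" for m y
    using ev [OF that] by (simp add: \<phi>_def chain_of_def)
  fix x assume x: "x \<in> chain_relations n"
  have "\<phi> x \<in> {0}"
  proof (rule chain_relations_map [OF \<phi> add_subgroup_singleton_zero _ _ _ _ x])
    fix m m' a y y' assume m: "m \<in> carrier A" "m' \<in> carrier A" "a \<in> carrier A"
      and y: "y \<in> tensors (n + 2)" "y' \<in> tensors (n + 2)"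
    have "frag_eval (g (m \<oplus>\<^bsub>A\<^esub> m')) y = frag_eval (g m) y + frag_eval (g m') y"
      by (rule tensors_eqI [OF y(1) additive_frag_eval, where g = "\<lambda>y. frag_eval (g m) y + frag_eval (g m') y"])
         (use m g_add_left in \<open>auto simp: Modules.additive_def frag_eval_simps\<close>)
    then show "\<phi> (chain_of n (m \<oplus>\<^bsub>A\<^esub> m') y) - \<phi> (chain_of n m y) - \<phi> (chain_of n m' y) \<in> {0}"
      using m by (simp add: \<phi>_chain)
    show "\<phi> (chain_of n m (y + y')) - \<phi> (chain_of n m y) - \<phi> (chain_of n m y') \<in> {0}"
      using m by (simp add: \<phi>_chain frag_eval_simps)
    have "frag_eval (g (m \<otimes> a)) y = frag_eval (g m) (lmult a y)"
      by (rule tensors_eqI [OF y(1) additive_frag_eval additive_compose [OF additive_frag_eval additive_lmult]])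
         (use m g_lmult in \<open>auto simp: pure_tensors_def lmult_frag_of\<close>)
    then show "\<phi> (chain_of n (m \<otimes> a) y) - \<phi> (chain_of n m (lmult a y)) \<in> {0}"
      using m by (simp add: \<phi>_chain)
    have "frag_eval (g (a \<otimes> m)) y = frag_eval (g m) (rmult a y)"
      by (rule tensors_eqI [OF y(1) additive_frag_eval additive_compose [OF additive_frag_eval additive_rmult]])
         (use m g_rmult in \<open>auto simp: pure_tensors_def rmult_frag_of\<close>)
    then show "\<phi> (chain_of n (a \<otimes> m) y) - \<phi> (chain_of n m (rmult a y)) \<in> {0}"
      using m by (simp add: \<phi>_chain)
  qed
  then show "\<phi> x = 0"
    by simp
qed

text \<open>In degree 1 the chain group is isomorphic to A \<otimes> A over k; these chains
  correspond to the usual Hochschild chains x \<otimes> y.\<close>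

definition std_chain :: "'a \<Rightarrow> 'a \<Rightarrow> ('a \<times> ('a list \<Rightarrow>\<^sub>0 int) set \<Rightarrow>\<^sub>0 int)" where
  "std_chain x y = chain_of 1 x (frag_of [\<one>, y, \<one>])"

lemma keys_std_chain:
  "\<lbrakk>x \<in> carrier A; y \<in> carrier A\<rbrakk> \<Longrightarrow> Poly_Mapping.keys (std_chain x y) \<subseteq> chain_basis 1"
  unfolding std_chain_def by (rule keys_chain_of) (auto simp: pure_tensors_def)

text \<open>The bar differential of 1 \<otimes> y \<otimes> 1 is y \<otimes> 1 - 1 \<otimes> y, and
  moving y across the tensor sign multiplies x from the right or from the left.\<close>

lemma chain_boundary_std_chain:
  assumes xy: "x \<in> carrier A" "y \<in> carrier A"
  shows "chain_boundary 1 (std_chain x y) - chain_of 0 (x \<otimes> y \<ominus> y \<otimes> x) (frag_of [\<one>, \<one>]) \<in> chain_relations 0"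
proof -
  have "bar_map 1 (frag_of [\<one>, y, \<one>]) = frag_of [y, \<one>] - frag_of [\<one>, y]"
    using xy by (simp add: bar_map_def contract_def)
  then have "chain_boundary 1 (std_chain x y) = chain_of 0 x (frag_of [y, \<one>] - frag_of [\<one>, y])"
    using chain_boundary_chain_of [of 0] by (simp add: std_chain_def)
  have 1: "chain_of 0 x (frag_of [y, \<one>] - frag_of [\<one>, y]) -
      (chain_of 0 x (frag_of [y, \<one>]) - chain_of 0 x (frag_of [\<one>, y])) \<in> chain_relations 0"
    by (rule chain_diff_right) (use xy in \<open>auto simp: pure_tensors_def\<close>)
  have 2: "chain_of 0 (x \<otimes> y) (frag_of [\<one>, \<one>]) - chain_of 0 x (frag_of [y, \<one>]) \<in> chain_relations 0"
    using chain_lmult [of x y "frag_of [\<one>, \<one>]" 0] xy by (simp add: lmult_def pure_tensors_def)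
  have 3: "chain_of 0 (y \<otimes> x) (frag_of [\<one>, \<one>]) - chain_of 0 x (frag_of [\<one>, y]) \<in> chain_relations 0"
    using chain_rmult [of x y "frag_of [\<one>, \<one>]" 0] xy by (simp add: rmult_def pure_tensors_def)
  have 4: "chain_of 0 (x \<otimes> y \<ominus> y \<otimes> x) (frag_of [\<one>, \<one>]) -
      (chain_of 0 (x \<otimes> y) (frag_of [\<one>, \<one>]) - chain_of 0 (y \<otimes> x) (frag_of [\<one>, \<one>])) \<in> chain_relations 0"
    by (rule chain_diff_left) (use xy in \<open>auto simp: pure_tensors_def\<close>)
  note H = add_subgroup_chain [of 0]
  from add_subgroup_diff [OF H add_subgroup_add [OF H add_subgroup_diff [OF H 1 2] 3] 4]
  show ?thesis
    using \<open>chain_boundary 1 (std_chain x y) = _\<close> by (simp add: algebra_simps)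
qed

lemma chain_of_sum_left:
  assumes "finite I" "u \<in> I \<rightarrow> carrier A" "y \<in> tensors (n + 2)"
  shows "(\<Sum>i\<in>I. chain_of n (u i) y) - chain_of n (\<Oplus>\<^bsub>A\<^esub>i\<in>I. u i) y \<in> chain_relations n"
  using assms(1,2)
proof (induction I rule: finite_induct)
  case empty
  then show ?case
    using chain_zero_left [OF assms(3)] add_subgroup_minus [OF add_subgroup_chain] by simp
next
  case (insert i I)
  then have "chain_of n (u i \<oplus>\<^bsub>A\<^esub> (\<Oplus>\<^bsub>A\<^esub>i\<in>I. u i)) y - chain_of n (u i) y - chain_of n (\<Oplus>\<^bsub>A\<^esub>i\<in>I. u i) y
      \<in> chain_relations n"
    by (intro chain_add_left assms finsum_closed) auto
  from add_subgroup_diff [OF add_subgroup_chain insert.IH this] insert show ?case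
    by (simp add: algebra_simps Pi_iff)
qed

lemma tensor_class_cong:
  "u - v \<in> tensor_power_relations A (n + 2) \<Longrightarrow> chain_of n m u = chain_of n m v"
  by (simp add: chain_of_def frag_of_eq add_coset_eq_iff [OF add_subgroup_tensor] del: add_2_eq_Suc')

text \<open>The outer factors a and c are absorbed by m; hence the standard chains span degree 1
  modulo the relations.\<close>

lemma chain_pure_std:
  assumes "m \<in> carrier A" "a \<in> carrier A" "b \<in> carrier A" "c \<in> carrier A"
  shows "chain_of 1 m (frag_of [a, b, c]) - std_chain (c \<otimes> m \<otimes> a) b \<in> chain_relations 1"
proof -
  have "chain_of 1 (m \<otimes> a) (frag_of [\<one>, b, c]) - chain_of 1 m (frag_of [a, b, c]) \<in> chain_relations 1"
    using chain_lmult [of m a "frag_of [\<one>, b, c]" 1] assms by (simp add: lmult_def pure_tensors_def)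
  moreover have "chain_of 1 (c \<otimes> (m \<otimes> a)) (frag_of [\<one>, b, \<one>]) - chain_of 1 (m \<otimes> a) (frag_of [\<one>, b, c])
      \<in> chain_relations 1"
    using chain_rmult [of "m \<otimes> a" c "frag_of [\<one>, b, \<one>]" 1] assms by (simp add: rmult_def pure_tensors_def)
  ultimately have "chain_of 1 (c \<otimes> (m \<otimes> a)) (frag_of [\<one>, b, \<one>]) - chain_of 1 m (frag_of [a, b, c])
      \<in> chain_relations 1"
    by (rule add_subgroup_trans [OF add_subgroup_chain, rotated])
  then show ?thesis
    using assms add_subgroup_commute [OF add_subgroup_chain] by (simp add: std_chain_def m_assoc)
qed

text \<open>The classical Hochschild boundary of x \<otimes> y \<otimes> z, read off from the three
  contractions of 1 \<otimes> y \<otimes> z \<otimes> 1.\<close>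

lemma chain_boundary_std_chain2:
  assumes xyz: "x \<in> carrier A" "y \<in> carrier A" "z \<in> carrier A"
  shows "chain_boundary 2 (chain_of 2 x (frag_of [\<one>, y, z, \<one>])) -
      (std_chain (x \<otimes> y) z - std_chain x (y \<otimes> z) + std_chain (z \<otimes> x) y) \<in> chain_relations 1"
proof -
  have bar: "bar_map 2 (frag_of [\<one>, y, z, \<one>]) = frag_of [y, z, \<one>] - (frag_of [\<one>, y \<otimes> z, \<one>] - frag_of [\<one>, y, z])"
    using xyz by (simp add: bar_map_def contract_def numeral_2_eq_2)
  have t: "frag_of [a, b, c] \<in> tensors (1 + 2)"
    if "a \<in> carrier A" "b \<in> carrier A" "c \<in> carrier A" for a b c
    using that by (simp add: pure_tensors_def)
  have "chain_boundary 2 (chain_of 2 x (frag_of [\<one>, y, z, \<one>])) =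
      chain_of 1 x (frag_of [y, z, \<one>] - (frag_of [\<one>, y \<otimes> z, \<one>] - frag_of [\<one>, y, z]))"
    using chain_boundary_chain_of [of 1] bar by (simp add: numeral_2_eq_2)
  have 1: "chain_of 1 x (frag_of [y, z, \<one>] - (frag_of [\<one>, y \<otimes> z, \<one>] - frag_of [\<one>, y, z])) -
      (chain_of 1 x (frag_of [y, z, \<one>]) - chain_of 1 x (frag_of [\<one>, y \<otimes> z, \<one>] - frag_of [\<one>, y, z]))
      \<in> chain_relations 1"
    by (intro chain_diff_right xyz t) (use xyz in \<open>simp_all add: keys_diff_subset pure_tensors_def\<close>)
  have 2: "chain_of 1 x (frag_of [\<one>, y \<otimes> z, \<one>] - frag_of [\<one>, y, z]) -
      (chain_of 1 x (frag_of [\<one>, y \<otimes> z, \<one>]) - chain_of 1 x (frag_of [\<one>, y, z])) \<in> chain_relations 1"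
    by (intro chain_diff_right xyz t) (use xyz in auto)
  have 3: "chain_of 1 x (frag_of [y, z, \<one>]) - std_chain (x \<otimes> y) z \<in> chain_relations 1"
    using chain_pure_std [of x y z \<one>] xyz by simp
  have 4: "chain_of 1 x (frag_of [\<one>, y, z]) - std_chain (z \<otimes> x) y \<in> chain_relations 1"
    using chain_pure_std [of x \<one> y z] xyz by simp
  note H = add_subgroup_chain [of 1]
  from add_subgroup_add [OF H add_subgroup_add [OF H add_subgroup_diff [OF H 1 2] 3] 4]
  show ?thesis
    using \<open>chain_boundary 2 _ = _\<close> by (simp add: std_chain_def [of x "y \<otimes> z"] algebra_simps)
qed

text \<open>The identity on f says that y \<mapsto> f(-, y) is a derivation of A into the
  functionals on A; equivalently, f is a functional on 1-chains that kills boundaries. So it has to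
  annihilate every 1-cycle if all of them are boundaries.\<close>

lemma hochschild_cocycle_vanishes:
  fixes f :: "'a \<Rightarrow> 'a \<Rightarrow> 'b::comm_ring_1"
  assumes triv: "trivial_group (hochschild_homology A 1)"
    and f_add_left: "\<And>x x' y. \<lbrakk>x \<in> carrier A; x' \<in> carrier A; y \<in> carrier A\<rbrakk> \<Longrightarrow>
      f (x \<oplus>\<^bsub>A\<^esub> x') y = f x y + f x' y"
    and f_add_right: "\<And>x y y'. \<lbrakk>x \<in> carrier A; y \<in> carrier A; y' \<in> carrier A\<rbrakk> \<Longrightarrow>
      f x (y \<oplus>\<^bsub>A\<^esub> y') = f x y + f x y'"
    and f_smult: "\<And>c x y. \<lbrakk>x \<in> carrier A; y \<in> carrier A\<rbrakk> \<Longrightarrow> f (c \<odot> x) y = f x (c \<odot> y)"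
    and f_cocycle: "\<And>x y z. \<lbrakk>x \<in> carrier A; y \<in> carrier A; z \<in> carrier A\<rbrakk> \<Longrightarrow>
      f (x \<otimes> y) z + f (z \<otimes> x) y = f x (y \<otimes> z)"
    and I: "finite I" and u: "u \<in> I \<rightarrow> carrier A" and v: "v \<in> I \<rightarrow> carrier A"
    and cycle: "(\<Oplus>\<^bsub>A\<^esub>i\<in>I. u i \<otimes> v i \<ominus> v i \<otimes> u i) = \<zero>"
  shows "(\<Sum>i\<in>I. f (u i) (v i)) = 0"
proof -
  \<comment> \<open>Dictated by \<open>chain_pure_std\<close>: the chain m \<otimes> (a \<otimes> b
    \<otimes> c) is congruent to cma \<otimes> (1 \<otimes> b \<otimes> 1).\<close>
  define g where "g = (\<lambda>m l. f (l ! 2 \<otimes> m \<otimes> l ! 0) (l ! 1))"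
  have cases3: "\<exists>a b c. l = [a, b, c] \<and> a \<in> carrier A \<and> b \<in> carrier A \<and> c \<in> carrier A"
    if "l \<in> pure_tensors A (1 + 2)" for l
    using that by (auto simp: pure_tensors_def numeral_eq_Suc length_Suc_conv)
  have less3: "i = 0 \<or> i = 1 \<or> i = 2" if "i < 1 + 2" for i :: nat
    using that by auto
  obtain \<phi> where \<phi>: "Modules.additive \<phi>" "\<And>x. x \<in> chain_relations 1 \<Longrightarrow> \<phi> x = 0"
    and \<phi>_chain: "\<And>m y. m \<in> carrier A \<Longrightarrow> \<phi> (chain_of 1 m y) = frag_eval (g m) y"
  proof (rule chain_functional [of 1 g])
    fix m m' l assume "m \<in> carrier A" "m' \<in> carrier A" "l \<in> pure_tensors A (1 + 2)"
    then show "g (m \<oplus>\<^bsub>A\<^esub> m') l = g m l + g m' l"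
      using cases3 [of l] by (auto simp: g_def l_distr r_distr f_add_left)
  next
    fix m l a b and i :: nat
    assume "m \<in> carrier A" "l \<in> pure_tensors A (1 + 2)" "i < 1 + 2" "a \<in> carrier A" "b \<in> carrier A"
    then show "g m (l[i := a \<oplus>\<^bsub>A\<^esub> b]) = g m (l[i := a]) + g m (l[i := b])"
      using less3 [of i] using cases3 [of l] by (auto simp: g_def l_distr r_distr f_add_left f_add_right)
  next
    fix m l c and i j :: nat
    assume *: "m \<in> carrier A" "l \<in> pure_tensors A (1 + 2)" "i < 1 + 2" "j < 1 + 2"
    have "g m (l[i := c \<odot> l ! i]) = f (c \<odot> (l ! 2 \<otimes> m \<otimes> l ! 0)) (l ! 1)" if "i < 1 + 2" for i
      using less3 [OF that] *(1,2)
      using cases3 [of l] by (auto simp: g_def smult_mult mult_smult f_smult)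
    then show "g m (l[i := c \<odot> l ! i]) = g m (l[j := c \<odot> l ! j])"
      using * by simp
  next
    fix m l a assume "m \<in> carrier A" "l \<in> pure_tensors A (1 + 2)" "a \<in> carrier A"
    then show "g (m \<otimes> a) l = g m (l[0 := a \<otimes> l ! 0])" "g (a \<otimes> m) l = g m (l[1 + 1 := l ! (1 + 1) \<otimes> a])"
      using cases3 [of l] by (auto simp: g_def m_assoc numeral_2_eq_2)
  qed blast
  have \<phi>_std: "\<phi> (std_chain x y) = f x y" if "x \<in> carrier A" "y \<in> carrier A" for x y
    unfolding std_chain_def \<phi>_chain [OF that(1)] frag_eval_of g_def using that by simp
  let ?z = "\<Sum>i\<in>I. std_chain (u i) (v i)"
  have uv: "u i \<in> carrier A" "v i \<in> carrier A" if "i \<in> I" for i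
    using u v that by auto
  have "chain_boundary 1 ?z \<in> chain_relations 0"
  proof -
    let ?c = "\<lambda>i. u i \<otimes> v i \<ominus> v i \<otimes> u i"
    have one: "frag_of [\<one>, \<one>] \<in> tensors (0 + 2)"
      by (simp add: pure_tensors_def)
    have 1: "(\<Sum>i\<in>I. chain_of 0 (?c i) (frag_of [\<one>, \<one>])) - chain_of 0 (\<Oplus>\<^bsub>A\<^esub>i\<in>I. ?c i) (frag_of [\<one>, \<one>])
        \<in> chain_relations 0"
      by (rule chain_of_sum_left [OF I _ one]) (use uv in auto)
    have 2: "chain_of 0 (\<Oplus>\<^bsub>A\<^esub>i\<in>I. ?c i) (frag_of [\<one>, \<one>]) \<in> chain_relations 0"
      unfolding cycle by (rule chain_zero_left [OF one])
    have 3: "(\<Sum>i\<in>I. chain_boundary 1 (std_chain (u i) (v i))) -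
        (\<Sum>i\<in>I. chain_of 0 (?c i) (frag_of [\<one>, \<one>])) \<in> chain_relations 0"
      by (rule add_subgroup_sum_cong [OF add_subgroup_chain chain_boundary_std_chain]) (use uv in auto)
    note cong = add_subgroup_cong_iff [OF add_subgroup_chain]
    show ?thesis
      unfolding additive.sum [OF additive_chain_boundary]
      by (rule iffD2 [OF cong [OF 3] iffD2 [OF cong [OF 1] 2]])
  qed
  moreover have "?z \<in> {c. Poly_Mapping.keys c \<subseteq> chain_basis 1}"
    by (intro add_subgroup_sum [OF add_subgroup_keys] CollectI keys_std_chain uv)
  ultimately have "\<exists>w. Poly_Mapping.keys w \<subseteq> chain_basis 2 \<and> ?z - chain_boundary 2 w \<in> chain_relations 1"
    by (intro iffD1 [OF trivial_hochschild_homology_iff triv, rule_format] conjI) simp_all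
  then obtain w where w: "Poly_Mapping.keys w \<subseteq> chain_basis 2"
    and zw: "?z - chain_boundary 2 w \<in> chain_relations 1"
    by (elim exE conjE)
  \<comment> \<open>On m \<otimes> (a \<otimes> b \<otimes> c \<otimes> d) this is the cocycle
    identity for dma, b and c.\<close>
  have bar: "frag_eval (g m) (bar_map 2 y) = 0" if m: "m \<in> carrier A" and y: "y \<in> tensors (2 + 2)" for m y
  proof (rule tensors_eqI [OF y additive_compose [OF additive_frag_eval additive_bar_map], of "\<lambda>y. 0"])
    fix l assume "l \<in> pure_tensors A (2 + 2)"
    then obtain a b c d where l: "l = [a, b, c, d]" "a \<in> carrier A" "b \<in> carrier A" "c \<in> carrier A" "d \<in> carrier A"
      by (auto simp: pure_tensors_def numeral_eq_Suc length_Suc_conv)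
    have "frag_eval (g m) (bar_map 2 (frag_of l)) =
        f (d \<otimes> m \<otimes> (a \<otimes> b)) c - f (d \<otimes> m \<otimes> a) (b \<otimes> c) + f (c \<otimes> d \<otimes> m \<otimes> a) b"
      by (simp add: l(1) bar_map_def contract_def frag_eval_simps numeral_2_eq_2 g_def)
    then show "frag_eval (g m) (bar_map 2 (frag_of l)) = 0"
      using f_cocycle [of "d \<otimes> m \<otimes> a" b c] l m by (simp add: m_assoc algebra_simps)
  qed (simp add: Modules.additive_def)
  have "w \<in> {w. \<phi> (chain_boundary 2 w) \<in> {0}}"
  proof (rule chain_induct [OF w add_subgroup_vimage
        [OF additive_compose [OF \<phi>(1) additive_chain_boundary] add_subgroup_singleton_zero]])
    fix m y assume my: "m \<in> carrier A" "y \<in> tensors (2 + 2)"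
    then show "chain_of 2 m y \<in> {w. \<phi> (chain_boundary 2 w) \<in> {0}}"
      using chain_boundary_chain_of [of 1 m y] bar [OF my] \<phi>_chain [OF my(1)] by (simp add: numeral_2_eq_2)
  qed
  then have "\<phi> ?z = 0"
    using \<phi>(2) [OF zw] by (simp add: additive.diff [OF \<phi>(1)])
  then show ?thesis
    using uv by (simp add: additive.sum [OF \<phi>(1)] \<phi>_std)
qed

text \<open>The relations between the classes modulo boundaries of the chains \<open>x \<otimes> (1 \<otimes> y \<otimes> 1)\<close>.\<close>

definition hochschild_congruence :: "('a \<times> 'a \<Rightarrow>\<^sub>0 int) set \<Rightarrow> bool" where
  "hochschild_congruence H \<longleftrightarrow> add_subgroup H \<and>
    (\<forall>x\<in>carrier A. \<forall>x'\<in>carrier A. \<forall>y\<in>carrier A. frag_of (x \<oplus>\<^bsub>A\<^esub> x', y) - frag_of (x, y) - frag_of (x', y) \<in> H) \<and>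
    (\<forall>x\<in>carrier A. \<forall>y\<in>carrier A. \<forall>y'\<in>carrier A. frag_of (x, y \<oplus>\<^bsub>A\<^esub> y') - frag_of (x, y) - frag_of (x, y') \<in> H) \<and>
    (\<forall>c. \<forall>x\<in>carrier A. \<forall>y\<in>carrier A. frag_of (c \<odot> x, y) - frag_of (x, c \<odot> y) \<in> H) \<and>
    (\<forall>x\<in>carrier A. \<forall>y\<in>carrier A. \<forall>z\<in>carrier A.
       frag_of (x \<otimes> y, z) - frag_of (x, y \<otimes> z) + frag_of (z \<otimes> x, y) \<in> H)"

text \<open>H stands for the formal sums of pairs whose chains are boundaries; only its closure
  properties are passed on. The cycle condition is handed over through additive functionals h into
  k, for which the coordinates with respect to the paths will be taken.\<close>

lemma trivial_hochschild_homologyI: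
  assumes *: "\<And>H z. \<lbrakk>hochschild_congruence H; Poly_Mapping.keys z \<subseteq> carrier A \<times> carrier A;
      \<And>h :: 'a \<Rightarrow> 'k. (\<And>x y. \<lbrakk>x \<in> carrier A; y \<in> carrier A\<rbrakk> \<Longrightarrow> h (x \<oplus>\<^bsub>A\<^esub> y) = h x + h y) \<Longrightarrow>
        frag_eval (\<lambda>(x, y). h (x \<otimes> y \<ominus> y \<otimes> x)) z = 0\<rbrakk> \<Longrightarrow> z \<in> H"
  shows "trivial_group (hochschild_homology A 1)"
  unfolding trivial_hochschild_homology_iff
proof (intro allI impI; elim conjE)
  fix z0 assume z0: "Poly_Mapping.keys z0 \<subseteq> chain_basis 1" "chain_boundary 1 z0 \<in> chain_relations 0"
  define \<tau> where "\<tau> = frag_extend (\<lambda>(x, y). std_chain x y)"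
  have \<tau>: "Modules.additive \<tau>" "\<And>x y. \<tau> (frag_of (x, y)) = std_chain x y"
    by (simp_all add: \<tau>_def additive_frag_extend)
  let ?K = "{z. \<exists>z'. Poly_Mapping.keys z' \<subseteq> carrier A \<times> carrier A \<and> z - \<tau> z' \<in> chain_relations 1}"
  have "z0 \<in> ?K"
  proof (rule chain_induct_pure [OF z0(1) add_subgroupI])
    show "0 \<in> ?K"
      using add_subgroup_zero [OF add_subgroup_chain] additive.zero [OF \<tau>(1)]
      by (auto intro!: exI [of _ 0])
  next
    fix x y assume "x \<in> ?K" "y \<in> ?K"
    then obtain x' y' where
      "Poly_Mapping.keys x' \<subseteq> carrier A \<times> carrier A" "x - \<tau> x' \<in> chain_relations 1"
      "Poly_Mapping.keys y' \<subseteq> carrier A \<times> carrier A" "y - \<tau> y' \<in> chain_relations 1"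
      by blast
    then show "x - y \<in> ?K"
      using add_subgroup_diff_diff [OF add_subgroup_chain, of x "\<tau> x'" 1 y "\<tau> y'"]
      by (intro CollectI exI [of _ "x' - y'"]) (auto simp: additive.diff [OF \<tau>(1)] keys_diff_subset)
  next
    have "x - \<tau> 0 \<in> chain_relations 1" if "x \<in> chain_relations 1" for x
      using that by (simp add: additive.zero [OF \<tau>(1)])
    then show "chain_relations 1 \<subseteq> ?K"
      by (intro subsetI CollectI exI [of _ 0]) simp
  next
    fix m l assume m: "m \<in> carrier A" and "l \<in> pure_tensors A (1 + 2)"
    then obtain a b c where l: "l = [a, b, c]" "a \<in> carrier A" "b \<in> carrier A" "c \<in> carrier A"
      by (auto simp: pure_tensors_def numeral_eq_Suc length_Suc_conv)
    then show "chain_of 1 m (frag_of l) \<in> ?K"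
      using chain_pure_std [OF m l(2-)] m
      by (intro CollectI exI [of _ "frag_of (c \<otimes> m \<otimes> a, b)"]) (simp add: \<tau>(2))
  qed
  then obtain z where z: "Poly_Mapping.keys z \<subseteq> carrier A \<times> carrier A" "z0 - \<tau> z \<in> chain_relations 1"
    by blast
  define H where "H = {z. \<exists>w. Poly_Mapping.keys w \<subseteq> chain_basis 2 \<and> \<tau> z - chain_boundary 2 w \<in> chain_relations 1}"
  have H_incl: "z \<in> H" if "\<tau> z \<in> chain_relations 1" for z
    using that unfolding H_def by (intro CollectI exI [of _ 0]) (simp add: additive.zero [OF additive_chain_boundary])
  have t: "frag_of [a, b, c] \<in> tensors (1 + 2)"
    if "a \<in> carrier A" "b \<in> carrier A" "c \<in> carrier A" for a b c
    using that by (simp add: pure_tensors_def)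
  have "hochschild_congruence H"
    unfolding hochschild_congruence_def
  proof (intro conjI ballI allI add_subgroupI)
    show "0 \<in> H"
      by (rule H_incl) (simp add: additive.zero [OF \<tau>(1)] add_subgroup_zero add_subgroup_chain)
  next
    fix x y assume "x \<in> H" "y \<in> H"
    then obtain v w where "Poly_Mapping.keys v \<subseteq> chain_basis 2" "\<tau> x - chain_boundary 2 v \<in> chain_relations 1"
      "Poly_Mapping.keys w \<subseteq> chain_basis 2" "\<tau> y - chain_boundary 2 w \<in> chain_relations 1"
      unfolding H_def by blast
    then show "x - y \<in> H"
      using add_subgroup_diff_diff [OF add_subgroup_chain, of "\<tau> x" "chain_boundary 2 v" 1 "\<tau> y" "chain_boundary 2 w"]
      unfolding H_def
      by (intro CollectI exI [of _ "v - w"])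
        (auto simp: additive.diff [OF \<tau>(1)] additive.diff [OF additive_chain_boundary] keys_diff_subset)
  next
    fix x x' y assume xy: "x \<in> carrier A" "x' \<in> carrier A" "y \<in> carrier A"
    then show "frag_of (x \<oplus>\<^bsub>A\<^esub> x', y) - frag_of (x, y) - frag_of (x', y) \<in> H"
      by (intro H_incl) (unfold additive.diff [OF \<tau>(1)] \<tau>(2) std_chain_def, intro chain_add_left t, auto)
  next
    fix x y y' assume xy: "x \<in> carrier A" "y \<in> carrier A" "y' \<in> carrier A"
    have "frag_of [\<one>, y \<oplus>\<^bsub>A\<^esub> y', \<one>] - (frag_of [\<one>, y, \<one>] + frag_of [\<one>, y', \<one>]) \<in> tensor_power_relations A (1 + 2)"
      using tensor_add [of "[\<one>, \<one>, \<one>]" 3 1 y y'] xy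
      by (simp add: pure_tensors_def algebra_simps del: One_nat_def) (simp add: algebra_simps)
    then have "chain_of 1 x (frag_of [\<one>, y \<oplus>\<^bsub>A\<^esub> y', \<one>]) = chain_of 1 x (frag_of [\<one>, y, \<one>] + frag_of [\<one>, y', \<one>])"
      by (rule tensor_class_cong)
    then have "\<tau> (frag_of (x, y \<oplus>\<^bsub>A\<^esub> y')) - \<tau> (frag_of (x, y)) - \<tau> (frag_of (x, y')) \<in> chain_relations 1"
      using chain_add_right [OF xy(1) t t, of \<one> y \<one> \<one> y' \<one>] xy by (simp add: \<tau>(2) std_chain_def)
    then show "frag_of (x, y \<oplus>\<^bsub>A\<^esub> y') - frag_of (x, y) - frag_of (x, y') \<in> H"
      by (intro H_incl) (simp add: additive.diff [OF \<tau>(1)])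
  next
    fix c x y assume xy: "x \<in> carrier A" "y \<in> carrier A"
    \<comment> \<open>The scalar is moved from y to the outer factor 1, which then acts on
      x.\<close>
    have "frag_of [c \<odot> \<one>, y, \<one>] - frag_of [\<one>, c \<odot> y, \<one>] \<in> tensor_power_relations A (1 + 2)"
      using tensor_smult [of "[\<one>, y, \<one>]" "1 + 2" 0 1 c] xy by (simp add: pure_tensors_def)
    then have "chain_of 1 x (frag_of [c \<odot> \<one>, y, \<one>]) = chain_of 1 x (frag_of [\<one>, c \<odot> y, \<one>])"
      by (rule tensor_class_cong)
    moreover have "chain_of 1 (x \<otimes> (c \<odot> \<one>)) (frag_of [\<one>, y, \<one>]) - chain_of 1 x (frag_of [c \<odot> \<one>, y, \<one>])
        \<in> chain_relations 1"
      using chain_lmult [of x "c \<odot> \<one>" "frag_of [\<one>, y, \<one>]" 1] xy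
      by (simp add: lmult_def pure_tensors_def smult_closed)
    moreover have "x \<otimes> (c \<odot> \<one>) = c \<odot> x"
      using xy by (simp add: mult_smult)
    ultimately show "frag_of (c \<odot> x, y) - frag_of (x, c \<odot> y) \<in> H"
      by (intro H_incl) (simp add: additive.diff [OF \<tau>(1)] \<tau>(2) std_chain_def)
  next
    fix x y z assume xyz: "x \<in> carrier A" "y \<in> carrier A" "z \<in> carrier A"
    let ?w = "chain_of 2 x (frag_of [\<one>, y, z, \<one>])"
    have "Poly_Mapping.keys ?w \<subseteq> chain_basis 2"
      by (rule keys_chain_of) (use xyz in \<open>auto simp: pure_tensors_def\<close>)
    moreover have "\<tau> (frag_of (x \<otimes> y, z) - frag_of (x, y \<otimes> z) + frag_of (z \<otimes> x, y)) - chain_boundary 2 ?w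
        \<in> chain_relations 1"
      using chain_boundary_std_chain2 [OF xyz]
      by (subst add_subgroup_commute [OF add_subgroup_chain])
         (simp add: additive.diff [OF \<tau>(1)] additive.add [OF \<tau>(1)] \<tau>(2))
    ultimately show "frag_of (x \<otimes> y, z) - frag_of (x, y \<otimes> z) + frag_of (z \<otimes> x, y) \<in> H"
      unfolding H_def by blast
  qed
  then have "z \<in> H"
  proof (rule * [OF _ z(1)])
    fix h :: "'a \<Rightarrow> 'k" assume h: "\<And>x y. \<lbrakk>x \<in> carrier A; y \<in> carrier A\<rbrakk> \<Longrightarrow> h (x \<oplus>\<^bsub>A\<^esub> y) = h x + h y"
    have h_diff: "h (x \<ominus> y) = h x - h y" if "x \<in> carrier A" "y \<in> carrier A" for x y
      using h [of "x \<ominus> y" y] that by (simp add: minus_eq a_assoc l_neg)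
    \<comment> \<open>All factors are multiplied in cyclic order, so that x \<otimes> (1 \<otimes>
      1) is sent to h x.\<close>
    define g where "g = (\<lambda>m l. h (l ! 1 \<otimes> m \<otimes> l ! 0))"
    have cases2: "\<exists>a b. l = [a, b] \<and> a \<in> carrier A \<and> b \<in> carrier A" if "l \<in> pure_tensors A (0 + 2)" for l
      using that by (auto simp: pure_tensors_def numeral_eq_Suc length_Suc_conv)
    have less2: "i = 0 \<or> i = 1" if "i < 0 + 2" for i :: nat
      using that by auto
    obtain \<phi> where \<phi>: "Modules.additive \<phi>" "\<And>x. x \<in> chain_relations 0 \<Longrightarrow> \<phi> x = 0"
      and \<phi>_chain: "\<And>m y. m \<in> carrier A \<Longrightarrow> \<phi> (chain_of 0 m y) = frag_eval (g m) y"
    proof (rule chain_functional [of 0 g])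
      fix m m' l assume "m \<in> carrier A" "m' \<in> carrier A" "l \<in> pure_tensors A (0 + 2)"
      then show "g (m \<oplus>\<^bsub>A\<^esub> m') l = g m l + g m' l"
        using cases2 [of l] by (auto simp: g_def l_distr r_distr h)
    next
      fix m l a b and i :: nat
      assume "m \<in> carrier A" "l \<in> pure_tensors A (0 + 2)" "i < 0 + 2" "a \<in> carrier A" "b \<in> carrier A"
      then show "g m (l[i := a \<oplus>\<^bsub>A\<^esub> b]) = g m (l[i := a]) + g m (l[i := b])"
        using less2 [of i] using cases2 [of l] by (auto simp: g_def l_distr r_distr h)
    next
      fix m l c and i j :: nat
      assume "m \<in> carrier A" "l \<in> pure_tensors A (0 + 2)" "i < 0 + 2" "j < 0 + 2"
      then show "g m (l[i := c \<odot> l ! i]) = g m (l[j := c \<odot> l ! j])"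
        using less2 [of i] less2 [of j] using cases2 [of l] by (auto simp: g_def smult_mult mult_smult)
    next
      fix m l a assume "m \<in> carrier A" "l \<in> pure_tensors A (0 + 2)" "a \<in> carrier A"
      then show "g (m \<otimes> a) l = g m (l[0 := a \<otimes> l ! 0])" "g (a \<otimes> m) l = g m (l[0 + 1 := l ! (0 + 1) \<otimes> a])"
        using cases2 [of l] by (auto simp: g_def m_assoc)
    qed blast
    have \<phi>_boundary: "\<phi> (chain_boundary 1 (std_chain x y)) = h (x \<otimes> y \<ominus> y \<otimes> x)"
      if "x \<in> carrier A" "y \<in> carrier A" for x y
      using \<phi>(2) [OF chain_boundary_std_chain [OF that]] that
      by (simp add: additive.diff [OF \<phi>(1)] \<phi>_chain g_def)
    have "chain_boundary 1 (z0 - \<tau> z) \<in> chain_relations 0"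
      using chain_boundary_relations [of "z0 - \<tau> z" 0] z(2) by simp
    then have "chain_boundary 1 (\<tau> z) \<in> chain_relations 0"
      using z0(2) add_subgroup_cong_iff [OF add_subgroup_chain]
      by (simp add: additive.diff [OF additive_chain_boundary])
    then have "\<phi> (chain_boundary 1 (\<tau> z)) = 0"
      by (rule \<phi>(2))
    moreover have "\<phi> (chain_boundary 1 (\<tau> z)) = frag_eval (\<lambda>(x, y). h (x \<otimes> y \<ominus> y \<otimes> x)) z"
      using z(1)
      by (induction rule: frag_induction)
        (auto simp: additive.zero [OF \<tau>(1)] additive.zero [OF \<phi>(1)] additive.zero [OF additive_chain_boundary]
          additive.diff [OF \<tau>(1)] additive.diff [OF \<phi>(1)] additive.diff [OF additive_chain_boundary]
          \<tau>(2) frag_eval_simps \<phi>_boundary [simplified])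
    ultimately show "frag_eval (\<lambda>(x, y). h (x \<otimes> y \<ominus> y \<otimes> x)) z = 0"
      by simp
  qed
  then obtain w where "Poly_Mapping.keys w \<subseteq> chain_basis 2" "\<tau> z - chain_boundary 2 w \<in> chain_relations 1"
    unfolding H_def by blast
  then show "\<exists>w. Poly_Mapping.keys w \<subseteq> chain_basis 2 \<and> z0 - chain_boundary 2 w \<in> chain_relations 1"
    using add_subgroup_trans [OF add_subgroup_chain z(2)] by blast
qed

end

section \<open>The monomial algebra\<close>

text \<open>The rule asks for basis elements in the support of f, with every coefficient, which
  makes it usable under a condition on supports.\<close>

lemma poly_mapping_single_induct [case_names zero add single]:
  fixes f :: "'a \<Rightarrow>\<^sub>0 'b::comm_monoid_add"
  assumes "P 0" "\<And>f g. \<lbrakk>P f; P g\<rbrakk> \<Longrightarrow> P (f + g)" "\<And>a c. a \<in> Poly_Mapping.keys f \<Longrightarrow> P (Poly_Mapping.single a c)"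
  shows "P f"
proof -
  have "P (\<Sum>a\<in>S. Poly_Mapping.single a (Poly_Mapping.lookup f a))" if "S \<subseteq> Poly_Mapping.keys f" for S
    using finite_subset [OF that finite_keys] that
    by (induction S rule: finite_induct) (auto intro: assms)
  moreover have "f = (\<Sum>a\<in>Poly_Mapping.keys f. Poly_Mapping.single a (Poly_Mapping.lookup f a))"
    by (rule poly_mapping_eqI)
      (simp add: lookup_sum lookup_single when_def in_keys_iff sum.delta)
  ultimately show ?thesis
    by (metis order_refl)
qed

lemma lookup_map_times: "Poly_Mapping.lookup (Poly_Mapping.map ((*) c) f) x = c * Poly_Mapping.lookup f x"
  for c :: "'k::mult_zero"
  by (auto simp: map.rep_eq when_def)

lemma map_times_zero: "Poly_Mapping.map ((*) c) 0 = 0"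
  for c :: "'k::mult_zero"
  by (rule poly_mapping_eqI) (simp add: lookup_map_times)

lemma keys_map_times: "Poly_Mapping.keys f \<subseteq> S \<Longrightarrow> Poly_Mapping.keys (Poly_Mapping.map ((*) c) f) \<subseteq> S"
  for c :: "'k::mult_zero"
  by (force simp: in_keys_iff lookup_map_times)

locale bilinear_coeffs =
  fixes F :: "'a \<Rightarrow> 'b \<Rightarrow> 'k::ring \<Rightarrow> 'k \<Rightarrow> 'c::ab_group_add"
  assumes add_left: "F \<alpha> \<beta> (c + c') d = F \<alpha> \<beta> c d + F \<alpha> \<beta> c' d"
    and add_right: "F \<alpha> \<beta> c (d + d') = F \<alpha> \<beta> c d + F \<alpha> \<beta> c d'"
begin

lemma zero_left: "F \<alpha> \<beta> 0 d = 0"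
  using add_left [of \<alpha> \<beta> 0 0 d] by simp

lemma zero_right: "F \<alpha> \<beta> c 0 = 0"
  using add_right [of \<alpha> \<beta> c 0 0] by simp

lemma sum_add_left: "bilinear_sum F (f + f') g = bilinear_sum F f g + bilinear_sum F f' g"
proof -
  let ?S = "Poly_Mapping.keys f \<union> Poly_Mapping.keys f'" and ?T = "Poly_Mapping.keys g"
  show ?thesis
    using bilinear_sum_superset [where F = F and S = ?S and T = ?T and g = g, OF _ _ _ _ zero_left zero_right]
      keys_add [of f f']
    by (simp add: lookup_add add_left sum.distrib)
qed

lemma sum_add_right: "bilinear_sum F f (g + g') = bilinear_sum F f g + bilinear_sum F f g'"
proof -
  let ?S = "Poly_Mapping.keys f" and ?T = "Poly_Mapping.keys g \<union> Poly_Mapping.keys g'"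
  show ?thesis
    using bilinear_sum_superset [where F = F and S = ?S and T = ?T and f = f, OF _ _ _ _ zero_left zero_right]
      keys_add [of g g']
    by (simp add: lookup_add add_right sum.distrib)
qed

lemma sum_zero_left [simp]: "bilinear_sum F 0 g = 0"
  by (simp add: bilinear_sum_def)

lemma sum_zero_right [simp]: "bilinear_sum F f 0 = 0"
  by (simp add: bilinear_sum_def)

lemma sum_single: "bilinear_sum F (Poly_Mapping.single \<alpha> c) (Poly_Mapping.single \<beta> d) = F \<alpha> \<beta> c d"
  using bilinear_sum_superset [where F = F and S = "{\<alpha>}" and T = "{\<beta>}" and f = "Poly_Mapping.single \<alpha> c"
      and g = "Poly_Mapping.single \<beta> d", OF _ _ _ _ zero_left zero_right]
  by simp

lemma sum_in_subgroup:
  assumes "add_subgroup H" "\<And>\<alpha> \<beta> c d. \<lbrakk>\<alpha> \<in> Poly_Mapping.keys f; \<beta> \<in> Poly_Mapping.keys g\<rbrakk> \<Longrightarrow> F \<alpha> \<beta> c d \<in> H"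
  shows "bilinear_sum F f g \<in> H"
  unfolding bilinear_sum_def by (intro add_subgroup_sum assms)

end

definition path_product :: "('v, 'e) pre_digraph \<Rightarrow> (('v, 'e) qpath \<Rightarrow>\<^sub>0 'k::field) \<Rightarrow>
    (('v, 'e) qpath \<Rightarrow>\<^sub>0 'k) \<Rightarrow> (('v, 'e) qpath \<Rightarrow>\<^sub>0 'k)" where
  "path_product Q = bilinear_sum (\<lambda>\<alpha> \<beta> c d.
     if qtarget Q \<beta> = qsource \<alpha> then Poly_Mapping.single (qconcat \<alpha> \<beta>) (c * d) else 0)"

interpretation path_product: bilinear_coeffs
  "\<lambda>\<alpha> \<beta> c d. if qtarget Q \<beta> = qsource \<alpha> then Poly_Mapping.single (qconcat \<alpha> \<beta>) (c * d :: 'k::field) else 0"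
  rewrites "bilinear_sum (\<lambda>\<alpha> \<beta> c d. if qtarget Q \<beta> = qsource \<alpha>
      then Poly_Mapping.single (qconcat \<alpha> \<beta>) (c * d :: 'k::field) else 0) = path_product Q"
  by unfold_locales (simp_all add: algebra_simps single_add path_product_def)

text \<open>By additivity in each argument this reduces to basis elements, where both sides test the
  same two compatibilities of ends.\<close>

lemma path_product_assoc: "path_product Q (path_product Q f g) h = path_product Q f (path_product Q g h)"
proof (induction f rule: poly_mapping_single_induct)
  case (single \<alpha> a)
  show ?case
  proof (induction g rule: poly_mapping_single_induct)
    case (single \<beta> b)
    show ?case
    proof (induction h rule: poly_mapping_single_induct)
      case (single \<gamma> c)
      show ?case
        by (auto simp: path_product.sum_single qconcat_def qsource_def qtarget_def mult.assoc)
    qed (simp_all add: path_product.sum_add_left path_product.sum_add_right)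
  qed (simp_all add: path_product.sum_add_left path_product.sum_add_right)
qed (simp_all add: path_product.sum_add_left path_product.sum_add_right)

locale monomial_quiver = fin_digraph Q for Q :: "('v, 'e) pre_digraph" +
  fixes Z :: "('v, 'e) qpath set"
    and A :: "('k::field, (('v, 'e) qpath \<Rightarrow>\<^sub>0 'k) set) module" (structure)
  assumes min_rel: "minimal_relations Q Z"
    and A_eq: "A = monomial_algebra Q Z"
begin

section \<open>Paths and their subpaths as lists of arrows\<close>

lemma qpaths_iff: "(u, as) \<in> qpaths Q \<longleftrightarrow> awalk u as (qtarget Q (u, as))"
proof -
  have "v = qtarget Q (u, as)" if "awalk u as v" for v
    using that awalk_ends [OF that] by (cases as rule: rev_cases) (auto simp: qtarget_def awalk_simps)
  then show ?thesis
    by (auto simp: qpaths_def)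
qed

lemma qpaths_source: "\<alpha> \<in> qpaths Q \<Longrightarrow> qsource \<alpha> \<in> verts Q"
  by (auto simp: qpaths_def qsource_def awalk_def)

lemma qpaths_target: "\<alpha> \<in> qpaths Q \<Longrightarrow> qtarget Q \<alpha> \<in> verts Q"
  by (cases \<alpha>) (auto simp: qpaths_iff dest: awalk_last_in_verts)

lemma qtarget_qconcat: "qtarget Q \<beta> = qsource \<alpha> \<Longrightarrow> qtarget Q (qconcat \<alpha> \<beta>) = qtarget Q \<alpha>"
  by (auto simp: qtarget_def qconcat_def qsource_def)

lemma qsource_qconcat [simp]: "qsource (qconcat \<alpha> \<beta>) = qsource \<beta>"
  by (simp add: qconcat_def qsource_def)

lemma qpaths_qconcat:
  assumes "\<alpha> \<in> qpaths Q" "\<beta> \<in> qpaths Q" "qtarget Q \<beta> = qsource \<alpha>"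
  shows "qconcat \<alpha> \<beta> \<in> qpaths Q"
proof -
  have "awalk (fst \<beta>) (snd \<beta>) (fst \<alpha>)" "awalk (fst \<alpha>) (snd \<alpha>) (qtarget Q \<alpha>)"
    using assms qpaths_iff [of "fst \<alpha>" "snd \<alpha>"] qpaths_iff [of "fst \<beta>" "snd \<beta>"]
    by (auto simp: qsource_def)
  then have "awalk (fst \<beta>) (snd \<beta> @ snd \<alpha>) (qtarget Q \<alpha>)"
    by (rule awalk_appendI)
  then show ?thesis
    by (auto simp: qpaths_def qconcat_def qsource_def)
qed

lemma qpaths_split:
  assumes "(u, p @ q) \<in> qpaths Q"
  obtains "(u, p) \<in> qpaths Q" "(qtarget Q (u, p), q) \<in> qpaths Q"
    "qtarget Q (qtarget Q (u, p), q) = qtarget Q (u, p @ q)"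
proof -
  obtain v where "awalk u (p @ q) v"
    using assms by (auto simp: qpaths_def)
  then obtain w where w: "awalk u p w" "awalk w q v"
    by (auto simp: awalk_append_iff)
  then have p: "(u, p) \<in> qpaths Q"
    by (auto simp: qpaths_def)
  have "w = qtarget Q (u, p)"
    using w(1) by (cases p rule: rev_cases) (auto simp: qtarget_def awalk_simps dest: awalk_ends)
  with w have q: "(qtarget Q (u, p), q) \<in> qpaths Q"
    by (auto simp: qpaths_def)
  have "qtarget Q (qtarget Q (u, p), q) = qtarget Q (u, p @ q)"
    by (auto simp: qtarget_def)
  with p q that show thesis
    by blast
qed

lemma qpaths_ne_source: "\<lbrakk>(u, as) \<in> qpaths Q; as \<noteq> []\<rbrakk> \<Longrightarrow> u = tail Q (hd as)"
  by (cases as) (auto simp: qpaths_def awalk_simps)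

text \<open>Relations have positive length and are therefore located by their arrows alone; sublists
  replace subpaths from here on.\<close>

definition zero_list :: "'e list \<Rightarrow> bool" where
  "zero_list w \<longleftrightarrow> (\<exists>\<zeta>\<in>Z. sublist (snd \<zeta>) w)"

lemma zero_list_sublist: "\<lbrakk>zero_list v; sublist v w\<rbrakk> \<Longrightarrow> zero_list w"
  unfolding zero_list_def using sublist_order.order_trans by blast

lemma Z_qpaths: "\<zeta> \<in> Z \<Longrightarrow> \<zeta> \<in> qpaths Q"
  and Z_length: "\<zeta> \<in> Z \<Longrightarrow> length (snd \<zeta>) \<ge> 2"
  and Z_minimal: "\<lbrakk>\<zeta> \<in> Z; \<eta> \<in> Z; subpath Q \<eta> \<zeta>\<rbrakk> \<Longrightarrow> \<eta> = \<zeta>"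
  using min_rel by (auto simp: minimal_relations_def qlength_def)

lemma occurs_atI:
  assumes "(u, p @ r @ q) \<in> qpaths Q"
  defines "v \<equiv> qtarget Q (u, p)"
  defines "w \<equiv> qtarget Q (v, r)"
  shows "occurs_at Q (w, q) (v, r) (u, p) (u, p @ r @ q)"
proof -
  obtain "(u, p) \<in> qpaths Q" "(v, r @ q) \<in> qpaths Q"
    using qpaths_split [OF assms(1)] unfolding v_def by blast
  moreover obtain "(v, r) \<in> qpaths Q" "(w, q) \<in> qpaths Q"
    using qpaths_split [OF \<open>(v, r @ q) \<in> qpaths Q\<close>] unfolding w_def by blast
  ultimately show ?thesis
    by (simp add: occurs_at_def qsource_def v_def w_def qconcat_def)
qed

text \<open>The first arrow determines the source of a nontrivial path, so an occurrence of its list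
  of arrows is an occurrence of the path.\<close>

lemma subpath_iff:
  assumes "\<zeta> \<in> qpaths Q" "snd \<zeta> \<noteq> []" "\<alpha> \<in> qpaths Q"
  shows "subpath Q \<zeta> \<alpha> \<longleftrightarrow> sublist (snd \<zeta>) (snd \<alpha>)"
proof
  assume "subpath Q \<zeta> \<alpha>"
  then show "sublist (snd \<zeta>) (snd \<alpha>)"
    by (fastforce simp: subpath_def occurs_at_def qconcat_def)
next
  assume "sublist (snd \<zeta>) (snd \<alpha>)"
  then obtain p q where \<alpha>: "\<alpha> = (fst \<alpha>, p @ snd \<zeta> @ q)"
    by (cases \<alpha>) (auto simp: sublist_def)
  let ?v = "qtarget Q (fst \<alpha>, p)"
  have occ: "occurs_at Q (qtarget Q (?v, snd \<zeta>), q) (?v, snd \<zeta>) (fst \<alpha>, p) \<alpha>"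
    using occurs_atI [of "fst \<alpha>" p "snd \<zeta>" q] \<alpha> assms(3) by simp
  then have "?v = tail Q (hd (snd \<zeta>))"
    using assms(2) by (intro qpaths_ne_source) (auto simp: occurs_at_def)
  also have "\<dots> = fst \<zeta>"
    using qpaths_ne_source [of "fst \<zeta>" "snd \<zeta>"] assms by simp
  finally show "subpath Q \<zeta> \<alpha>"
    using occ by (auto simp: subpath_def)
qed

lemma zero_path_iff: "\<alpha> \<in> qpaths Q \<Longrightarrow> zero_path Q Z \<alpha> \<longleftrightarrow> zero_list (snd \<alpha>)"
proof -
  assume "\<alpha> \<in> qpaths Q"
  moreover have "snd \<zeta> \<noteq> []" if "\<zeta> \<in> Z" for \<zeta>
    using Z_length [OF that] by auto
  ultimately show ?thesis
    by (simp add: zero_path_def zero_list_def subpath_iff Z_qpaths)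
qed

lemma zero_list_Nil [simp]: "\<not> zero_list []"
  using Z_length by (fastforce simp: zero_list_def)

section \<open>The path algebra\<close>

abbreviation P :: "('k, ('v, 'e) qpath \<Rightarrow>\<^sub>0 'k) module" where
  "P \<equiv> path_algebra Q"

lemma P_simps:
  "carrier P = {f. Poly_Mapping.keys f \<subseteq> qpaths Q}"
  "f \<otimes>\<^bsub>P\<^esub> g = path_product Q f g"
  "\<one>\<^bsub>P\<^esub> = (\<Sum>v\<in>verts Q. Poly_Mapping.single (v, []) 1)"
  "\<zero>\<^bsub>P\<^esub> = 0"
  "f \<oplus>\<^bsub>P\<^esub> g = f + g"
  "c \<odot>\<^bsub>P\<^esub> f = Poly_Mapping.map ((*) c) f"
  by (simp_all add: path_algebra_def path_product_def bilinear_sum_def)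

lemma single_product:
  "path_product Q (Poly_Mapping.single \<alpha> c) (Poly_Mapping.single \<beta> d) =
   (if qtarget Q \<beta> = qsource \<alpha> then Poly_Mapping.single (qconcat \<alpha> \<beta>) (c * d) else 0)"
  by (rule path_product.sum_single)

lemma additive_product_left: "Modules.additive (\<lambda>f. path_product Q f g)"
  by (simp add: Modules.additive_def path_product.sum_add_left)

lemma additive_product_right: "Modules.additive (path_product Q f)"
  by (simp add: Modules.additive_def path_product.sum_add_right)

lemma one_product_single:
  assumes "\<alpha> \<in> qpaths Q"
  shows "path_product Q (\<Sum>v\<in>verts Q. Poly_Mapping.single (v, []) 1) (Poly_Mapping.single \<alpha> c) =
      Poly_Mapping.single \<alpha> c"
    and "path_product Q (Poly_Mapping.single \<alpha> c) (\<Sum>v\<in>verts Q. Poly_Mapping.single (v, []) 1) =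
      Poly_Mapping.single \<alpha> c"
  unfolding additive.sum [OF additive_product_left] additive.sum [OF additive_product_right] single_product
  using qpaths_source [OF assms] qpaths_target [OF assms]
  by (simp_all add: qsource_def qtarget_def qconcat_def)

lemma one_product:
  fixes f :: "('v, 'e) qpath \<Rightarrow>\<^sub>0 'k"
  assumes "Poly_Mapping.keys f \<subseteq> qpaths Q"
  shows "path_product Q (\<Sum>v\<in>verts Q. Poly_Mapping.single (v, []) 1) f = f"
    and "path_product Q f (\<Sum>v\<in>verts Q. Poly_Mapping.single (v, []) 1) = f"
proof -
  let ?one = "\<Sum>v\<in>verts Q. Poly_Mapping.single (v, []) (1 :: 'k)"
  have "path_product Q ?one f = f \<and> path_product Q f ?one = f"
  proof (induction f rule: poly_mapping_single_induct)
    case (single \<alpha> c)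
    then show ?case
      using assms one_product_single [of \<alpha> c] by blast
  qed (simp_all add: path_product.sum_add_left path_product.sum_add_right)
  then show "path_product Q ?one f = f" "path_product Q f ?one = f"
    by auto
qed

lemma keys_path_product:
  assumes "Poly_Mapping.keys f \<subseteq> S" "Poly_Mapping.keys g \<subseteq> T"
    and "\<And>\<alpha> \<beta>. \<lbrakk>\<alpha> \<in> S; \<beta> \<in> T; qtarget Q \<beta> = qsource \<alpha>\<rbrakk> \<Longrightarrow> qconcat \<alpha> \<beta> \<in> U"
  shows "Poly_Mapping.keys (path_product Q f g) \<subseteq> U"
proof -
  have "path_product Q f g \<in> {h. Poly_Mapping.keys h \<subseteq> U}"
    using assms(1,2) by (intro path_product.sum_in_subgroup [OF add_subgroup_keys]) (auto intro!: assms(3))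
  then show ?thesis
    by simp
qed

lemma keys_path_product_qpaths:
  "\<lbrakk>Poly_Mapping.keys f \<subseteq> qpaths Q; Poly_Mapping.keys g \<subseteq> qpaths Q\<rbrakk> \<Longrightarrow>
    Poly_Mapping.keys (path_product Q f g) \<subseteq> qpaths Q"
  by (rule keys_path_product) (auto intro: qpaths_qconcat)

lemma ring_P: "ring P"
proof (rule ringI)
  show "abelian_group P"
  proof (rule abelian_groupI)
    fix x assume "x \<in> carrier P"
    then show "\<exists>y\<in>carrier P. y \<oplus>\<^bsub>P\<^esub> x = \<zero>\<^bsub>P\<^esub>"
      by (intro bexI [of _ "- x"]) (auto simp: P_simps)
  qed (auto simp: P_simps keys_add_subset algebra_simps)
  show "monoid P"
  proof (rule monoidI)
    show "\<one>\<^bsub>P\<^esub> \<in> carrier P"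
      unfolding P_simps
      by (rule add_subgroup_sum [OF add_subgroup_keys]) (auto simp: qpaths_def awalk_Nil_iff)
  qed (simp_all add: P_simps path_product_assoc one_product keys_path_product_qpaths)
qed (simp_all add: P_simps path_product.sum_add_left path_product.sum_add_right)

definition zero_ideal :: "(('v, 'e) qpath \<Rightarrow>\<^sub>0 'k) set" where
  "zero_ideal = {f. Poly_Mapping.keys f \<subseteq> {\<alpha> \<in> qpaths Q. zero_path Q Z \<alpha>}}"

lemma add_subgroup_zero_ideal: "add_subgroup zero_ideal"
  unfolding zero_ideal_def by (rule add_subgroup_keys)

lemma zero_path_qconcat:
  assumes "\<alpha> \<in> qpaths Q" "\<beta> \<in> qpaths Q" "qtarget Q \<beta> = qsource \<alpha>" "zero_path Q Z \<alpha> \<or> zero_path Q Z \<beta>"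
  shows "zero_path Q Z (qconcat \<alpha> \<beta>)"
proof -
  have "sublist (snd \<alpha>) (snd (qconcat \<alpha> \<beta>))" "sublist (snd \<beta>) (snd (qconcat \<alpha> \<beta>))"
    by (simp_all add: qconcat_def)
  then show ?thesis
    using assms zero_list_sublist by (auto simp: zero_path_iff qpaths_qconcat)
qed

lemma minus_P: "f \<in> carrier P \<Longrightarrow> inv\<^bsub>add_monoid P\<^esub> f = - f"
proof -
  interpret ring P by (rule ring_P)
  show "f \<in> carrier P \<Longrightarrow> inv\<^bsub>add_monoid P\<^esub> f = - f"
    by (rule group.inv_equality [OF add.is_group]) (auto simp: P_simps)
qed

lemma ideal_zero_ideal: "ideal zero_ideal P"
proof (rule idealI [OF ring_P])
  interpret ring P by (rule ring_P)
  show "subgroup zero_ideal (add_monoid P)"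
  proof (rule group.subgroupI [OF add.is_group])
    show sub: "zero_ideal \<subseteq> carrier (add_monoid P)"
      by (auto simp: zero_ideal_def P_simps)
    show "zero_ideal \<noteq> {}"
      using add_subgroup_zero [OF add_subgroup_zero_ideal] by blast
    show "inv\<^bsub>add_monoid P\<^esub> a \<in> zero_ideal" if "a \<in> zero_ideal" for a
      using that sub minus_P [of a] add_subgroup_minus [OF add_subgroup_zero_ideal, of a] by auto
    show "a \<otimes>\<^bsub>add_monoid P\<^esub> b \<in> zero_ideal" if "a \<in> zero_ideal" "b \<in> zero_ideal" for a b
      using add_subgroup_add [OF add_subgroup_zero_ideal that] by (simp add: P_simps)
  qed
  let ?Y = "{\<alpha> \<in> qpaths Q. zero_path Q Z \<alpha>}"
  show "x \<otimes>\<^bsub>P\<^esub> a \<in> zero_ideal" if "a \<in> zero_ideal" "x \<in> carrier P" for a x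
    using that unfolding zero_ideal_def P_simps mem_Collect_eq
    by (intro keys_path_product [where T = ?Y and S = "qpaths Q"]) (auto intro!: zero_path_qconcat qpaths_qconcat)
  show "a \<otimes>\<^bsub>P\<^esub> x \<in> zero_ideal" if "a \<in> zero_ideal" "x \<in> carrier P" for a x
    using that unfolding zero_ideal_def P_simps mem_Collect_eq
    by (intro keys_path_product [where S = ?Y and T = "qpaths Q"]) (auto intro!: zero_path_qconcat qpaths_qconcat)
qed

text \<open>A path through \<zeta> is a product \<gamma>\<zeta>\<delta>, so the ideal is spanned by
  the zero paths. This makes the nonzero paths a basis of the quotient.\<close>

lemma Idl_relations: "Idl\<^bsub>P\<^esub> ((\<lambda>\<zeta>. Poly_Mapping.single \<zeta> 1) ` Z) = zero_ideal" (is "Idl\<^bsub>P\<^esub> ?S = _")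
proof
  interpret ring P by (rule ring_P)
  have S: "?S \<subseteq> carrier P"
    using Z_qpaths by (auto simp: P_simps)
  have "zero_path Q Z \<zeta>" if "\<zeta> \<in> Z" for \<zeta>
    using that by (auto simp: zero_path_iff Z_qpaths zero_list_def)
  then show "Idl\<^bsub>P\<^esub> ?S \<subseteq> zero_ideal"
    by (intro genideal_minimal ideal_zero_ideal) (auto simp: zero_ideal_def Z_qpaths)
  interpret I: ideal "Idl\<^bsub>P\<^esub> ?S" P
    by (rule genideal_ideal [OF S])
  show "zero_ideal \<subseteq> Idl\<^bsub>P\<^esub> ?S"
  proof
    fix f assume f: "f \<in> zero_ideal"
    show "f \<in> Idl\<^bsub>P\<^esub> ?S"
    proof (induction f rule: poly_mapping_single_induct)
      case zero
      then show ?case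
        using I.zero_closed by (simp add: P_simps)
    next
      case (add f g)
      then show ?case
        using I.a_closed by (simp add: P_simps)
    next
      case (single \<alpha> c)
      then obtain \<zeta> \<gamma> \<delta> where \<zeta>: "\<zeta> \<in> Z" and occ: "occurs_at Q \<gamma> \<zeta> \<delta> \<alpha>"
        using f by (auto simp: zero_ideal_def zero_path_def subpath_def)
      have "Poly_Mapping.single \<zeta> 1 \<in> Idl\<^bsub>P\<^esub> ?S"
        using genideal_self [OF S] \<zeta> by blast
      moreover have "Poly_Mapping.single \<gamma> c \<in> carrier P" "Poly_Mapping.single \<delta> 1 \<in> carrier P"
        using occ by (auto simp: occurs_at_def P_simps)
      ultimately have "Poly_Mapping.single \<gamma> c \<otimes>\<^bsub>P\<^esub> (Poly_Mapping.single \<zeta> 1 \<otimes>\<^bsub>P\<^esub> Poly_Mapping.single \<delta> 1) \<in> Idl\<^bsub>P\<^esub> ?S"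
        by (intro I.I_l_closed I.I_r_closed)
      moreover have "Poly_Mapping.single \<gamma> c \<otimes>\<^bsub>P\<^esub> (Poly_Mapping.single \<zeta> 1 \<otimes>\<^bsub>P\<^esub> Poly_Mapping.single \<delta> 1) =
          Poly_Mapping.single \<alpha> c"
        using occ by (auto simp: P_simps occurs_at_def single_product qtarget_qconcat)
      ultimately show ?case
        by simp
    qed
  qed
qed

section \<open>The quotient algebra and its basis elements\<close>

abbreviation cls :: "(('v, 'e) qpath \<Rightarrow>\<^sub>0 'k) \<Rightarrow> (('v, 'e) qpath \<Rightarrow>\<^sub>0 'k) set" where
  "cls \<equiv> add_coset zero_ideal"

lemma a_r_coset_P: "zero_ideal +>\<^bsub>P\<^esub> f = cls f"
  by (auto simp: a_r_coset_def' add_coset_def P_simps)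

lemma A_fields:
  "carrier A = carrier (P Quot zero_ideal)" "monoid.mult A = monoid.mult (P Quot zero_ideal)"
  "one A = one (P Quot zero_ideal)" "ring.zero A = ring.zero (P Quot zero_ideal)"
  "add A = add (P Quot zero_ideal)"
  "c \<odot> X = (\<Union>x\<in>X. zero_ideal +>\<^bsub>P\<^esub> (c \<odot>\<^bsub>P\<^esub> x))"
  by (simp_all add: A_eq monomial_algebra_def quotient_algebra_def Idl_relations ring.defs module.defs)

text \<open>A is the quotient ring extended by a scalar multiplication, and the ring axioms mention
  only fields common to both records.\<close>

lemma ring_A: "ring A"
proof -
  have "ring (P Quot zero_ideal)"
    by (rule ideal.quotient_is_ring [OF ideal_zero_ideal])
  moreover have "ring A \<longleftrightarrow> ring (P Quot zero_ideal)"
    unfolding ring_def ring_axioms_def abelian_group_def abelian_group_axioms_def abelian_monoid_def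
      comm_group_def group_def group_axioms_def comm_monoid_def comm_monoid_axioms_def monoid_def Units_def A_fields
    by (simp add: A_fields)
  ultimately show ?thesis
    by simp
qed

lemma carrier_A: "carrier A = cls ` {f. Poly_Mapping.keys f \<subseteq> qpaths Q}"
  by (auto simp: A_fields FactRing_def A_RCOSETS_def' a_r_coset_P [unfolded a_r_coset_def'] a_r_coset_P P_simps)

lemma class_closed: "Poly_Mapping.keys f \<subseteq> qpaths Q \<Longrightarrow> cls f \<in> carrier A"
  by (auto simp: carrier_A)

lemma class_mult:
  "\<lbrakk>Poly_Mapping.keys f \<subseteq> qpaths Q; Poly_Mapping.keys g \<subseteq> qpaths Q\<rbrakk> \<Longrightarrow>
    cls f \<otimes> cls g = cls (path_product Q f g)"
  using ideal.rcoset_mult_add [OF ideal_zero_ideal, of f g]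
  by (simp add: A_fields FactRing_def a_r_coset_P P_simps)

lemma class_add:
  "\<lbrakk>Poly_Mapping.keys f \<subseteq> qpaths Q; Poly_Mapping.keys g \<subseteq> qpaths Q\<rbrakk> \<Longrightarrow>
    cls f \<oplus>\<^bsub>A\<^esub> cls g = cls (f + g)"
proof -
  interpret ideal zero_ideal P by (rule ideal_zero_ideal)
  assume "Poly_Mapping.keys f \<subseteq> qpaths Q" "Poly_Mapping.keys g \<subseteq> qpaths Q"
  then show "cls f \<oplus>\<^bsub>A\<^esub> cls g = cls (f + g)"
    using a_rcos_sum [of f g] by (simp add: A_fields FactRing_def a_r_coset_P P_simps)
qed

lemma zero_A: "\<zero> = cls 0"
  by (simp add: A_fields FactRing_def add_coset_zero)

text \<open>The scalar multiplication is defined as a union over all representatives, all of which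
  yield the same coset.\<close>

lemma class_smult:
  assumes "Poly_Mapping.keys f \<subseteq> qpaths Q"
  shows "c \<odot> cls f = cls (Poly_Mapping.map ((*) c) f)"
proof -
  have lin: "Poly_Mapping.map ((*) c) f - Poly_Mapping.map ((*) c) g = Poly_Mapping.map ((*) c) (f - g)"
    for f g :: "('v, 'e) qpath \<Rightarrow>\<^sub>0 'k"
    by (rule poly_mapping_eqI) (simp add: lookup_map_times lookup_minus algebra_simps)
  have "cls (Poly_Mapping.map ((*) c) g) = cls (Poly_Mapping.map ((*) c) f)" if "g \<in> cls f" for g
    using that unfolding add_coset_eq_iff [OF add_subgroup_zero_ideal] mem_add_coset_iff lin
    by (simp add: zero_ideal_def keys_map_times)
  then show ?thesis
    using add_coset_self [OF add_subgroup_zero_ideal, of f]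
    unfolding A_fields(6) a_r_coset_P P_simps by blast
qed

text \<open>The coefficient is part of the notation because pairs of algebra elements become formal
  symbols, and the symbol of a scalar multiple is not a multiple of the symbol.\<close>

definition basis_elem :: "'k \<Rightarrow> ('v, 'e) qpath \<Rightarrow> (('v, 'e) qpath \<Rightarrow>\<^sub>0 'k) set" where
  "basis_elem c \<alpha> = cls (Poly_Mapping.single \<alpha> c)"

lemma basis_elem_closed: "\<alpha> \<in> qpaths Q \<Longrightarrow> basis_elem c \<alpha> \<in> carrier A"
  unfolding basis_elem_def by (rule class_closed) simp

lemma basis_elem_mult:
  "\<lbrakk>\<alpha> \<in> qpaths Q; \<beta> \<in> qpaths Q\<rbrakk> \<Longrightarrow> basis_elem c \<alpha> \<otimes> basis_elem d \<beta> =
    (if qtarget Q \<beta> = qsource \<alpha> then basis_elem (c * d) (qconcat \<alpha> \<beta>) else \<zero>)"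
  by (simp add: basis_elem_def class_mult single_product zero_A)

lemma basis_elem_add:
  "\<alpha> \<in> qpaths Q \<Longrightarrow> basis_elem c \<alpha> \<oplus>\<^bsub>A\<^esub> basis_elem d \<alpha> = basis_elem (c + d) \<alpha>"
  by (simp add: basis_elem_def class_add single_add)

lemma basis_elem_0: "basis_elem 0 \<alpha> = \<zero>"
  by (simp add: basis_elem_def zero_A)

lemma basis_elem_zero_path: "\<lbrakk>\<alpha> \<in> qpaths Q; zero_path Q Z \<alpha>\<rbrakk> \<Longrightarrow> basis_elem c \<alpha> = \<zero>"
  unfolding basis_elem_def zero_A
  by (rule iffD2 [OF add_coset_eq_iff [OF add_subgroup_zero_ideal]]) (simp add: zero_ideal_def)

lemma basis_elem_smult: "\<alpha> \<in> qpaths Q \<Longrightarrow> c \<odot> basis_elem d \<alpha> = basis_elem (c * d) \<alpha>"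
  by (simp add: basis_elem_def class_smult)

lemma A_induct [consumes 1, case_names zero add basis]:
  assumes "x \<in> carrier A" "R \<zero>"
    and "\<And>x y. \<lbrakk>x \<in> carrier A; y \<in> carrier A; R x; R y\<rbrakk> \<Longrightarrow> R (x \<oplus>\<^bsub>A\<^esub> y)"
    and "\<And>c \<alpha>. \<alpha> \<in> qpaths Q \<Longrightarrow> R (basis_elem c \<alpha>)"
  shows "R x"
proof -
  obtain f where f: "x = cls f" "Poly_Mapping.keys f \<subseteq> qpaths Q"
    using assms(1) by (auto simp: carrier_A)
  have "Poly_Mapping.keys f \<subseteq> qpaths Q \<and> R (cls f)"
  proof (induction f rule: poly_mapping_single_induct)
    case zero
    then show ?case
      using assms(2) by (simp add: zero_A)
  next
    case (add f g)
    then show ?case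
      using assms(3) [of "cls f" "cls g"] by (simp add: class_add class_closed keys_add_subset)
  next
    case (single \<alpha> c)
    then show ?case
      using assms(4) [of \<alpha> c] f(2) by (auto simp: basis_elem_def)
  qed
  then show ?thesis
    using f by simp
qed

lemma smult_closed_A: "x \<in> carrier A \<Longrightarrow> c \<odot> x \<in> carrier A"
  by (auto simp: carrier_A class_smult keys_map_times)

lemma smult_add_A: "\<lbrakk>x \<in> carrier A; y \<in> carrier A\<rbrakk> \<Longrightarrow> c \<odot> (x \<oplus>\<^bsub>A\<^esub> y) = c \<odot> x \<oplus>\<^bsub>A\<^esub> c \<odot> y"
proof -
  have "Poly_Mapping.map ((*) c) (f + g) = Poly_Mapping.map ((*) c) f + Poly_Mapping.map ((*) c) g"
    for f g :: "('v, 'e) qpath \<Rightarrow>\<^sub>0 'k"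
    by (rule poly_mapping_eqI) (simp add: lookup_map_times lookup_add algebra_simps)
  then show "\<lbrakk>x \<in> carrier A; y \<in> carrier A\<rbrakk> \<Longrightarrow> ?thesis"
    by (auto simp: carrier_A class_smult class_add keys_add_subset keys_map_times)
qed

sublocale ring A
  by (rule ring_A)

lemma smult_zero_A: "c \<odot> \<zero> = \<zero>"
  by (simp add: zero_A class_smult map_times_zero)

sublocale field_algebra A
proof
  fix c x assume "x \<in> carrier A"
  then show "c \<odot> x \<in> carrier A"
    by (rule smult_closed_A)
next
  fix c x y assume xy: "x \<in> carrier A" "y \<in> carrier A"
  have "(c \<odot> x) \<otimes> y = c \<odot> (x \<otimes> y) \<and> x \<otimes> (c \<odot> y) = c \<odot> (x \<otimes> y)"
    using xy(1)
  proof (induction x rule: A_induct)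
    case (basis d \<alpha>)
    show ?case
      using xy(2)
    proof (induction y rule: A_induct)
      case (basis e \<beta>)
      then show ?case
        using \<open>\<alpha> \<in> qpaths Q\<close>
        by (auto simp: basis_elem_smult basis_elem_mult qpaths_qconcat smult_zero_A algebra_simps)
    qed (use \<open>\<alpha> \<in> qpaths Q\<close> in \<open>simp_all add: smult_zero_A r_distr smult_add_A smult_closed_A basis_elem_closed\<close>)
  qed (use xy in \<open>simp_all add: smult_zero_A l_distr smult_add_A smult_closed_A\<close>)
  then show "(c \<odot> x) \<otimes> y = c \<odot> (x \<otimes> y)" "x \<otimes> (c \<odot> y) = c \<odot> (x \<otimes> y)"
    by auto
qed

section \<open>Coordinates and bilinear forms on the quotient\<close>

definition representative :: "(('v, 'e) qpath \<Rightarrow>\<^sub>0 'k) set \<Rightarrow> (('v, 'e) qpath \<Rightarrow>\<^sub>0 'k)" where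
  "representative X = (SOME f. f \<in> X)"

lemma representative_class: "representative (cls f) - f \<in> zero_ideal"
proof -
  have "representative (cls f) \<in> cls f"
    unfolding representative_def by (rule someI) (rule add_coset_self [OF add_subgroup_zero_ideal])
  then show ?thesis
    by (simp add: mem_add_coset_iff)
qed

definition coordinate :: "('v, 'e) qpath \<Rightarrow> (('v, 'e) qpath \<Rightarrow>\<^sub>0 'k) set \<Rightarrow> 'k" where
  "coordinate \<alpha> X = Poly_Mapping.lookup (representative X) \<alpha>"

text \<open>Elements of the ideal have no nonzero path in their support, so the choice of the
  representative does not affect the coefficient at \<alpha>.\<close>

lemma coordinate_class:
  assumes "\<not> zero_path Q Z \<alpha>"
  shows "coordinate \<alpha> (cls f) = Poly_Mapping.lookup f \<alpha>"
proof -
  have "Poly_Mapping.lookup (representative (cls f) - f) \<alpha> = 0"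
    using representative_class [of f] assms by (auto simp: zero_ideal_def in_keys_iff)
  then show ?thesis
    by (simp add: coordinate_def lookup_minus)
qed

lemma coordinate_add:
  assumes "\<not> zero_path Q Z \<alpha>" "x \<in> carrier A" "y \<in> carrier A"
  shows "coordinate \<alpha> (x \<oplus>\<^bsub>A\<^esub> y) = coordinate \<alpha> x + coordinate \<alpha> y"
  using assms(2,3) by (auto simp: carrier_A class_add coordinate_class [OF assms(1)] lookup_add)

lemma coordinate_basis_elem:
  "\<not> zero_path Q Z \<alpha> \<Longrightarrow> coordinate \<alpha> (basis_elem c \<beta>) = (if \<alpha> = \<beta> then c else 0)"
  by (simp add: basis_elem_def coordinate_class lookup_single when_def)

definition bilinear_extension ::
    "(('v, 'e) qpath \<Rightarrow> ('v, 'e) qpath \<Rightarrow> 'k) \<Rightarrow> (('v, 'e) qpath \<Rightarrow>\<^sub>0 'k) set \<Rightarrow> (('v, 'e) qpath \<Rightarrow>\<^sub>0 'k) set \<Rightarrow> 'k" where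
  "bilinear_extension f X Y = bilinear_sum (\<lambda>\<alpha> \<beta> c d. c * d * f \<alpha> \<beta>) (representative X) (representative Y)"

text \<open>The form is evaluated on chosen representatives; as f vanishes on zero paths, changing a
  representative by an element of the ideal has no effect.\<close>

lemma bilinear_extension:
  assumes f: "\<And>\<alpha> \<beta>. \<lbrakk>\<alpha> \<in> qpaths Q; \<beta> \<in> qpaths Q; zero_path Q Z \<alpha> \<or> zero_path Q Z \<beta>\<rbrakk> \<Longrightarrow> f \<alpha> \<beta> = 0"
  shows bilinear_extension_add_left: "\<lbrakk>x \<in> carrier A; x' \<in> carrier A; y \<in> carrier A\<rbrakk> \<Longrightarrow>
      bilinear_extension f (x \<oplus>\<^bsub>A\<^esub> x') y = bilinear_extension f x y + bilinear_extension f x' y"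
    and bilinear_extension_add_right: "\<lbrakk>x \<in> carrier A; y \<in> carrier A; y' \<in> carrier A\<rbrakk> \<Longrightarrow>
      bilinear_extension f x (y \<oplus>\<^bsub>A\<^esub> y') = bilinear_extension f x y + bilinear_extension f x y'"
    and bilinear_extension_basis: "\<lbrakk>\<alpha> \<in> qpaths Q; \<beta> \<in> qpaths Q\<rbrakk> \<Longrightarrow>
      bilinear_extension f (basis_elem c \<alpha>) (basis_elem d \<beta>) = c * d * f \<alpha> \<beta>"
proof -
  let ?F = "\<lambda>\<alpha> \<beta> c d. c * d * f \<alpha> \<beta>"
  interpret F: bilinear_coeffs ?F
    by unfold_locales (simp_all add: algebra_simps)
  have F_diff: "bilinear_sum ?F (x - y) z = bilinear_sum ?F x z - bilinear_sum ?F y z"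
    "bilinear_sum ?F z (x - y) = bilinear_sum ?F z x - bilinear_sum ?F z y" for x y z
    using F.sum_add_left [of "x - y" y z] F.sum_add_right [of z "x - y" y] by (auto simp: algebra_simps)
  have F0: "bilinear_sum ?F x z = 0" "bilinear_sum ?F z x = 0"
    if "x \<in> zero_ideal" "Poly_Mapping.keys z \<subseteq> qpaths Q" for x z
    using that f unfolding bilinear_sum_def zero_ideal_def
    by (auto intro!: sum.neutral) blast+
  have rep: "representative (cls x) - x \<in> zero_ideal" "Poly_Mapping.keys (representative (cls x)) \<subseteq> qpaths Q"
    if "Poly_Mapping.keys x \<subseteq> qpaths Q" for x
  proof -
    show "representative (cls x) - x \<in> zero_ideal"
      by (rule representative_class)
    then have "Poly_Mapping.keys (representative (cls x) - x) \<subseteq> qpaths Q"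
      by (auto simp: zero_ideal_def)
    then show "Poly_Mapping.keys (representative (cls x)) \<subseteq> qpaths Q"
      using keys_add_subset [of "representative (cls x) - x" "qpaths Q" x] that by simp
  qed
  have cls: "bilinear_extension f (cls x) (cls y) = bilinear_sum ?F x y"
    if "Poly_Mapping.keys x \<subseteq> qpaths Q" "Poly_Mapping.keys y \<subseteq> qpaths Q" for x y
    using F0(1) [OF rep(1) [OF that(1)] rep(2) [OF that(2)]] F0(2) [OF rep(1) [OF that(2)] that(1)]
    by (simp add: F_diff bilinear_extension_def)
  show "\<lbrakk>x \<in> carrier A; x' \<in> carrier A; y \<in> carrier A\<rbrakk> \<Longrightarrow>
      bilinear_extension f (x \<oplus>\<^bsub>A\<^esub> x') y = bilinear_extension f x y + bilinear_extension f x' y"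
    by (auto simp: carrier_A class_add cls keys_add_subset F.sum_add_left)
  show "\<lbrakk>x \<in> carrier A; y \<in> carrier A; y' \<in> carrier A\<rbrakk> \<Longrightarrow>
      bilinear_extension f x (y \<oplus>\<^bsub>A\<^esub> y') = bilinear_extension f x y + bilinear_extension f x y'"
    by (auto simp: carrier_A class_add cls keys_add_subset F.sum_add_right)
  show "\<lbrakk>\<alpha> \<in> qpaths Q; \<beta> \<in> qpaths Q\<rbrakk> \<Longrightarrow>
      bilinear_extension f (basis_elem c \<alpha>) (basis_elem d \<beta>) = c * d * f \<alpha> \<beta>"
    by (simp add: basis_elem_def cls F.sum_single)
qed

end

section \<open>Rotations and circuits\<close>

definition rotations :: "'a list \<Rightarrow> 'a list set" where
  "rotations w = range (\<lambda>i. rotate i w)"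

definition period :: "'a list \<Rightarrow> nat" where
  "period w = (LEAST l. l > 0 \<and> rotate l w = w)"

definition multiplicity :: "'a list \<Rightarrow> nat" where
  "multiplicity w = length w div period w"

lemma rotate_inject:
  fixes v w :: "'a list"
  shows "rotate i v = rotate i w \<longleftrightarrow> v = w"
proof -
  have "inj (rotate i :: 'a list \<Rightarrow> 'a list)"
    unfolding rotate_def by (rule inj_fn [OF inj_rotate1])
  then show ?thesis
    by (simp add: inj_eq)
qed

lemma rotate_in_rotations [simp]: "rotate i w \<in> rotations w"
  by (simp add: rotations_def)

lemma rotations_self [simp]: "w \<in> rotations w"
  using rotate_in_rotations [of 0 w] by simp

lemma rotations_trans: "\<lbrakk>u \<in> rotations v; v \<in> rotations w\<rbrakk> \<Longrightarrow> u \<in> rotations w"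
  by (auto simp: rotations_def rotate_rotate)

lemma rotations_sym: "v \<in> rotations w \<Longrightarrow> w \<in> rotations v"
proof -
  assume "v \<in> rotations w"
  then obtain i where i: "v = rotate i w"
    by (auto simp: rotations_def)
  \<comment> \<open>Together with the rotation by i this makes i full turns.\<close>
  have "rotate (i * (length w - 1)) v = rotate (i * length w) w"
    by (cases w) (auto simp: i rotate_rotate algebra_simps)
  also have "\<dots> = w"
    by (rule rotate_id) simp
  finally show ?thesis
    using rotate_in_rotations by metis
qed

lemma rotations_eq: "v \<in> rotations w \<Longrightarrow> rotations v = rotations w"
  using rotations_trans rotations_sym by blast

lemma length_rotations: "v \<in> rotations w \<Longrightarrow> length v = length w"
  by (auto simp: rotations_def)

lemma rotations_conv_lessThan: "w \<noteq> [] \<Longrightarrow> rotations w = (\<lambda>i. rotate i w) ` {..<length w}"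
  unfolding rotations_def using rotate_conv_mod [of _ w]
  by (auto intro!: image_eqI [of _ _ "i mod length w" for i])

lemma finite_rotations: "finite (rotations w)"
  by (cases "w = []") (simp_all add: rotations_conv_lessThan, simp add: rotations_def)

lemma period:
  assumes "w \<noteq> []"
  shows period_pos: "period w > 0" and rotate_period: "rotate (period w) w = w"
proof -
  have "length w > 0 \<and> rotate (length w) w = w"
    using assms by simp
  from LeastI [of "\<lambda>l. l > 0 \<and> rotate l w = w", OF this]
  show "period w > 0" "rotate (period w) w = w"
    by (auto simp: period_def)
qed

lemma period_le: "\<lbrakk>l > 0; rotate l w = w\<rbrakk> \<Longrightarrow> period w \<le> l"
  unfolding period_def by (rule Least_le) simp

lemma rotate_mult_period: "w \<noteq> [] \<Longrightarrow> rotate (period w * k) w = w"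
  by (induction k) (simp_all add: rotate_rotate [symmetric] rotate_period)

lemma rotate_mod_period: "w \<noteq> [] \<Longrightarrow> rotate i w = rotate (i mod period w) w"
  using rotate_rotate [of "i mod period w" "period w * (i div period w)" w]
  by (simp add: rotate_mult_period)

lemma rotate_eq_iff:
  assumes "w \<noteq> []"
  shows "rotate i w = rotate j w \<longleftrightarrow> i mod period w = j mod period w"
proof
  \<comment> \<open>Cancelling the rotation by a would leave a positive index below the period that
    fixes w.\<close>
  have *: False if "a < b" "b < period w" "rotate a w = rotate b w" for a b
  proof -
    have "rotate a (rotate (b - a) w) = rotate a w"
      using that by (simp add: rotate_rotate)
    then have "rotate (b - a) w = w"
      by (simp only: rotate_inject)
    then show False
      using period_le [of "b - a" w] that by simp
  qed
  assume "rotate i w = rotate j w"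
  then have "rotate (i mod period w) w = rotate (j mod period w) w"
    using rotate_mod_period [OF assms] by metis
  then show "i mod period w = j mod period w"
    using * [of "i mod period w" "j mod period w"] * [of "j mod period w" "i mod period w"] period_pos [OF assms]
    by (cases "i mod period w" "j mod period w" rule: linorder_cases) auto
next
  assume "i mod period w = j mod period w"
  then show "rotate i w = rotate j w"
    using rotate_mod_period [OF assms] by metis
qed

lemma period_dvd_length: "w \<noteq> [] \<Longrightarrow> period w dvd length w"
  using rotate_eq_iff [of w "length w" 0] by (simp add: mod_eq_0_iff_dvd)

lemma period_rotations: "v \<in> rotations w \<Longrightarrow> period v = period w"
proof -
  assume "v \<in> rotations w"
  then obtain i where i: "v = rotate i w"
    by (auto simp: rotations_def)
  have "rotate l v = v \<longleftrightarrow> rotate l w = w" for l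
    unfolding i by (metis add.commute rotate_inject rotate_rotate)
  then show ?thesis
    by (simp add: period_def)
qed

lemma multiplicity_rotations: "v \<in> rotations w \<Longrightarrow> multiplicity v = multiplicity w"
  by (simp add: multiplicity_def period_rotations length_rotations)

text \<open>The indices that lead from w to v form a residue class modulo the period, and the period
  divides the length.\<close>

lemma card_rotate_eq:
  assumes "w \<noteq> []" "v \<in> rotations w"
  shows "card {i. i < length w \<and> rotate i w = v} = multiplicity w"
proof -
  let ?l = "period w"
  obtain s where s: "v = rotate s w"
    using assms by (auto simp: rotations_def)
  define r where "r = s mod ?l"
  have l: "?l > 0" and r: "r < ?l"
    using period_pos [OF assms(1)] by (auto simp: r_def)
  obtain m where m: "length w = ?l * m"
    using period_dvd_length [OF assms(1)] by blast
  then have mult: "multiplicity w = m"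
    using l by (simp add: multiplicity_def)
  have "{i. i < length w \<and> rotate i w = v} = (\<lambda>j. ?l * j + r) ` {..<m}"
  proof (intro equalityI subsetI)
    fix i assume i: "i \<in> {i. i < length w \<and> rotate i w = v}"
    then have "i mod ?l = r"
      by (auto simp: s rotate_eq_iff [OF assms(1)] r_def)
    moreover have "i div ?l < m"
      using i m by (auto intro: less_mult_imp_div_less simp: mult.commute)
    ultimately show "i \<in> (\<lambda>j. ?l * j + r) ` {..<m}"
      by (intro image_eqI [of _ _ "i div ?l"]) auto
  next
    fix i assume "i \<in> (\<lambda>j. ?l * j + r) ` {..<m}"
    then obtain j where j: "j < m" "i = ?l * j + r"
      by auto
    have "?l * j + r < ?l * (j + 1)"
      using r by simp
    also have "\<dots> \<le> ?l * m"
      using j by (intro mult_le_mono) auto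
    finally show "i \<in> {i. i < length w \<and> rotate i w = v}"
      using j r by (auto simp: m s rotate_eq_iff [OF assms(1)] r_def)
  qed
  moreover have "inj_on (\<lambda>j. ?l * j + r) {..<m}"
    using l by (auto simp: inj_on_def)
  ultimately show ?thesis
    by (simp add: card_image mult)
qed

lemma sum_const_card:
  fixes x :: "'b::comm_monoid_add"
  assumes "finite S" "card S = m"
  shows "(\<Sum>i\<in>S. x) = (\<Sum>j<m. x)"
proof -
  obtain h where "bij_betw h S {0..<card S}"
    using ex_bij_betw_finite_nat [OF assms(1)] by blast
  then have "bij_betw h S {..<m}"
    using assms(2) by (simp add: atLeast0LessThan)
  from sum.reindex_bij_betw [OF this, of "\<lambda>_. x"] show ?thesis
    by simp
qed

text \<open>Every distinct word is hit as often as the multiplicity says. The multiple is written as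
  a repeated sum so that the identity serves formal sums of pairs as well as elements of k.\<close>

lemma sum_rotate:
  fixes g :: "'a list \<Rightarrow> 'b::comm_monoid_add"
  assumes "w \<noteq> []"
  shows "(\<Sum>i<length w. g (rotate i w)) = (\<Sum>v\<in>rotations w. \<Sum>j<multiplicity w. g v)"
proof -
  have "(\<Sum>i<length w. g (rotate i w)) =
      (\<Sum>v\<in>rotations w. \<Sum>i\<in>{i \<in> {..<length w}. rotate i w = v}. g (rotate i w))"
    by (rule sum.group [symmetric]) (auto simp: finite_rotations)
  also have "\<dots> = (\<Sum>v\<in>rotations w. \<Sum>j<multiplicity w. g v)"
  proof (rule sum.cong [OF refl])
    fix v assume v: "v \<in> rotations w"
    have "(\<Sum>i\<in>{i \<in> {..<length w}. rotate i w = v}. g (rotate i w)) = (\<Sum>i\<in>{i \<in> {..<length w}. rotate i w = v}. g v)"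
      by (rule sum.cong) auto
    also have "\<dots> = (\<Sum>j<multiplicity w. g v)"
      by (rule sum_const_card) (use card_rotate_eq [OF assms v] in \<open>auto simp: lessThan_def\<close>)
    finally show "(\<Sum>i\<in>{i \<in> {..<length w}. rotate i w = v}. g (rotate i w)) = (\<Sum>j<multiplicity w. g v)" .
  qed
  finally show ?thesis .
qed

text \<open>The shift by one matches \<open>pair_closed\<close> and \<open>cochain\<close>, where
  the first word is already rotated once.\<close>

lemma sum_rotate_Suc:
  fixes g :: "'a list \<Rightarrow> 'b::comm_monoid_add"
  assumes "w \<noteq> []"
  shows "(\<Sum>i<length w. g (rotate (Suc i) w)) = (\<Sum>v\<in>rotations w. \<Sum>j<multiplicity w. g v)"
proof -
  have w: "rotate1 w \<in> rotations w"
    using rotate_in_rotations [of 1 w] by simp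
  have "(\<Sum>i<length w. g (rotate (Suc i) w)) = (\<Sum>i<length (rotate1 w). g (rotate i (rotate1 w)))"
    by (simp add: rotate1_rotate_swap)
  then show ?thesis
    using assms sum_rotate [of "rotate1 w" g]
    by (simp add: rotations_eq [OF w] multiplicity_rotations [OF w])
qed

text \<open>On words this is the passage from a\<beta> to \<beta>a, where a is the arrow traversed
  last.\<close>

definition rotate_back :: "'a list \<Rightarrow> 'a list" where
  "rotate_back w = last w # butlast w"

lemma rotate1_rotate_back: "w \<noteq> [] \<Longrightarrow> rotate1 (rotate_back w) = w"
  by (simp add: rotate_back_def)

lemma rotate_back_rotate1: "w \<noteq> [] \<Longrightarrow> rotate_back (rotate1 w) = w"
  by (cases w) (auto simp: rotate_back_def)

lemma rotate_back_eq_iff: "w \<noteq> [] \<Longrightarrow> v \<noteq> [] \<Longrightarrow> rotate_back w = v \<longleftrightarrow> w = rotate1 v"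
  using rotate1_rotate_back rotate_back_rotate1 by metis

lemma rotate_back_power_ne: "w \<noteq> [] \<Longrightarrow> (rotate_back ^^ i) w \<noteq> []"
  by (induction i) (auto simp: rotate_back_def)

lemma rotate_back_power_rotate: "w \<noteq> [] \<Longrightarrow> (rotate_back ^^ i) (rotate i w) = w"
proof (induction i)
  case (Suc i)
  have "(rotate_back ^^ Suc i) (rotate (Suc i) w) = (rotate_back ^^ i) (rotate_back (rotate1 (rotate i w)))"
    by (simp add: funpow_swap1)
  then show ?case
    using Suc by (simp add: rotate_back_rotate1)
qed simp

lemma rotate_back_rotations: "v \<in> rotations w \<Longrightarrow> w \<noteq> [] \<Longrightarrow> (rotate_back ^^ i) v \<in> rotations w"
proof (induction i)
  case (Suc i)
  let ?v = "(rotate_back ^^ i) v"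
  have "v \<noteq> []"
    using Suc length_rotations [of v w] by auto
  then have v: "?v \<in> rotations w" "?v \<noteq> []"
    using Suc rotate_back_power_ne [of v i] by auto
  have "rotate 1 (rotate_back ?v) = ?v"
    using v(2) by (simp add: rotate1_rotate_back)
  then have "?v \<in> rotations (rotate_back ?v)"
    using rotate_in_rotations by metis
  then show ?case
    using v(1) rotations_sym rotations_trans by (auto intro: rotations_trans rotations_sym)
qed simp

lemma sublist_butlast: "w = p @ z @ q \<Longrightarrow> q \<noteq> [] \<Longrightarrow> sublist z (butlast w)"
  by (auto simp: butlast_append)

context monomial_quiver
begin

section \<open>Closed walks and their rotations\<close>

definition walk :: "'e list \<Rightarrow> bool" where
  "walk w \<longleftrightarrow> w \<noteq> [] \<and> (tail Q (hd w), w) \<in> qpaths Q"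

definition list_path :: "'e list \<Rightarrow> ('v, 'e) qpath" where
  "list_path w = (tail Q (hd w), w)"

definition closed_walk :: "'e list \<Rightarrow> bool" where
  "closed_walk w \<longleftrightarrow> walk w \<and> head Q (last w) = tail Q (hd w)"

lemma snd_list_path [simp]: "snd (list_path w) = w"
  by (simp add: list_path_def)

lemma list_path_inject [simp]: "list_path v = list_path w \<longleftrightarrow> v = w"
  by (auto simp: list_path_def)

lemma walk_ne: "walk w \<Longrightarrow> w \<noteq> []" and closed_walk_ne: "closed_walk w \<Longrightarrow> w \<noteq> []"
  by (auto simp: walk_def closed_walk_def)

lemma walk_list_path: "walk w \<Longrightarrow> list_path w \<in> qpaths Q"
  by (simp add: walk_def list_path_def)

lemma qsource_list_path: "qsource (list_path w) = tail Q (hd w)"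
  by (simp add: list_path_def qsource_def)

lemma qtarget_list_path: "w \<noteq> [] \<Longrightarrow> qtarget Q (list_path w) = head Q (last w)"
  by (simp add: list_path_def qtarget_def)

lemma qpath_eq_list_path: "\<lbrakk>\<alpha> \<in> qpaths Q; snd \<alpha> \<noteq> []\<rbrakk> \<Longrightarrow> \<alpha> = list_path (snd \<alpha>)"
  using qpaths_ne_source [of "fst \<alpha>" "snd \<alpha>"] by (cases \<alpha>) (simp add: list_path_def)

lemma walk_snd: "\<lbrakk>\<alpha> \<in> qpaths Q; snd \<alpha> \<noteq> []\<rbrakk> \<Longrightarrow> walk (snd \<alpha>)"
  using qpath_eq_list_path [of \<alpha>] by (simp add: walk_def list_path_def)

lemma walk_append:
  assumes "p \<noteq> []" "q \<noteq> []"
  shows "walk (p @ q) \<longleftrightarrow> walk p \<and> walk q \<and> head Q (last p) = tail Q (hd q)"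
proof
  assume *: "walk (p @ q)"
  then obtain "(tail Q (hd p), p) \<in> qpaths Q" "(qtarget Q (tail Q (hd p), p), q) \<in> qpaths Q"
    using qpaths_split [of "tail Q (hd p)" p q] assms by (auto simp: walk_def)
  moreover from this have "qtarget Q (tail Q (hd p), p) = tail Q (hd q)"
    using qpaths_ne_source assms by blast
  ultimately show "walk p \<and> walk q \<and> head Q (last p) = tail Q (hd q)"
    using assms by (auto simp: walk_def qtarget_def)
next
  assume *: "walk p \<and> walk q \<and> head Q (last p) = tail Q (hd q)"
  then have "qconcat (list_path q) (list_path p) \<in> qpaths Q"
    using assms by (intro qpaths_qconcat walk_list_path) (auto simp: qtarget_list_path qsource_list_path)
  then show "walk (p @ q)"
    using assms by (simp add: walk_def qconcat_def qsource_list_path)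
qed

lemma closed_walk_rotate1: "closed_walk w \<Longrightarrow> closed_walk (rotate1 w)"
proof -
  assume w: "closed_walk w"
  then obtain a as where as: "w = a # as"
    using closed_walk_ne by (cases w) auto
  show ?thesis
  proof (cases "as = []")
    case True
    then show ?thesis
      using w as by simp
  next
    case False
    then show ?thesis
      using w walk_append [of "[a]" as] walk_append [of as "[a]"] by (auto simp: as closed_walk_def)
  qed
qed

lemma closed_walk_rotations: "\<lbrakk>closed_walk w; v \<in> rotations w\<rbrakk> \<Longrightarrow> closed_walk v"
proof -
  have "closed_walk w \<Longrightarrow> closed_walk (rotate i w)" for i
    by (induction i) (auto intro: closed_walk_rotate1)
  then show "\<lbrakk>closed_walk w; v \<in> rotations w\<rbrakk> \<Longrightarrow> closed_walk v"
    by (auto simp: rotations_def)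
qed

text \<open>The words a\<beta> that vanish although \<beta> does not: every relation in such a word
  ends with its last arrow.\<close>

definition end_walk :: "'e list \<Rightarrow> bool" where
  "end_walk w \<longleftrightarrow> zero_list w \<and> \<not> zero_list (butlast w)"

text \<open>Take the first zero word met in rotating forward. Its \<open>butlast\<close> is
  contained in the preceding word, which is nonzero. The minimality of t is recorded because
  coefficients will be propagated along the nonzero words in between.\<close>

lemma end_walk_exists:
  assumes w: "w \<noteq> []" "\<not> zero_list (butlast w)" and v: "v \<in> rotations w" "zero_list v"
  obtains t where "end_walk (rotate t w)" "\<And>s. s < t \<Longrightarrow> \<not> zero_list (rotate s w)"
proof -
  define t where "t = (LEAST t. zero_list (rotate t w))"
  have "\<exists>t. zero_list (rotate t w)"
    using v by (auto simp: rotations_def)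
  then have t: "zero_list (rotate t w)"
    unfolding t_def by (rule LeastI_ex)
  have less: "\<not> zero_list (rotate s w)" if "s < t" for s
    using that unfolding t_def by (rule not_less_Least)
  have "\<not> zero_list (butlast (rotate t w))"
  proof (cases t)
    case 0
    then show ?thesis
      using w by simp
  next
    case (Suc s)
    let ?v = "rotate s w"
    have "butlast (rotate t w) = tl ?v"
      using w by (simp add: Suc rotate1_hd_tl)
    moreover have "sublist (tl ?v) ?v"
      by simp
    ultimately show ?thesis
      using less [of s] zero_list_sublist [of "tl ?v" ?v] by (auto simp: Suc)
  qed
  then show thesis
    using that t less by (auto simp: end_walk_def)
qed

section \<open>Circuits as rotation classes of closed walks\<close>

lemma qcycle_cases:
  assumes "\<gamma> \<in> qcycles Q"
  obtains v where "v \<in> verts Q" "\<gamma> = (v, [])" | w where "closed_walk w" "\<gamma> = list_path w"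
proof (cases "snd \<gamma> = []")
  case True
  then show ?thesis
    using that(1) [of "fst \<gamma>"] assms qpaths_source [of \<gamma>] by (cases \<gamma>) (auto simp: qcycles_def qsource_def)
next
  case False
  have \<gamma>: "\<gamma> \<in> qpaths Q" "qsource \<gamma> = qtarget Q \<gamma>"
    using assms by (auto simp: qcycles_def)
  have eq: "\<gamma> = list_path (snd \<gamma>)"
    by (rule qpath_eq_list_path [OF \<gamma>(1) False])
  have "closed_walk (snd \<gamma>)"
    using walk_snd [OF \<gamma>(1) False] \<gamma>(2) False eq qsource_list_path qtarget_list_path
    unfolding closed_walk_def by metis
  with eq show ?thesis
    using that(2) by blast
qed

lemma list_path_qcycles: "closed_walk w \<Longrightarrow> list_path w \<in> qcycles Q"
  using qtarget_list_path [of w] qsource_list_path [of w]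
  by (auto simp: closed_walk_def qcycles_def walk_list_path walk_ne)

lemma qrotate_list_path: "closed_walk w \<Longrightarrow> qrotate Q (list_path w) = list_path (rotate1 w)"
proof -
  assume w: "closed_walk w"
  then obtain a as where as: "w = a # as"
    using closed_walk_ne by (cases w) auto
  show ?thesis
    using w walk_append [of "[a]" as] by (cases "as = []") (auto simp: as closed_walk_def list_path_def)
qed

lemma qrotate_power_list_path: "closed_walk w \<Longrightarrow> (qrotate Q ^^ i) (list_path w) = list_path (rotate i w)"
  by (induction i) (auto simp: qrotate_list_path closed_walk_rotations)

text \<open>The generated relation also contains the inverse rotation, but on a finite word that is
  a further rotation forward, so the class is the set of rotations.\<close>

lemma circuit_list_path:
  assumes "closed_walk w"
  shows "rotation_equiv Q `` {list_path w} = list_path ` rotations w"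
proof (intro equalityI subsetI)
  let ?r = "{(\<gamma>, qrotate Q \<gamma>) | \<gamma>. \<gamma> \<in> qcycles Q}"
  fix \<gamma> assume "\<gamma> \<in> rotation_equiv Q `` {list_path w}"
  then have "(list_path w, \<gamma>) \<in> (?r \<union> ?r\<inverse>)\<^sup>*"
    by (auto simp: rotation_equiv_def Let_def)
  then show "\<gamma> \<in> list_path ` rotations w"
  proof (induction rule: rtrancl_induct)
    case base
    then show ?case
      by simp
  next
    case (step \<gamma> \<delta>)
    then obtain v where v: "v \<in> rotations w" "\<gamma> = list_path v"
      by auto
    have cv: "closed_walk v"
      by (rule closed_walk_rotations [OF assms v(1)])
    from step(2) consider "\<delta> = qrotate Q \<gamma>" | "\<delta> \<in> qcycles Q" "\<gamma> = qrotate Q \<delta>"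
      by auto
    then show ?case
    proof cases
      case 1
      then have "\<delta> = list_path (rotate 1 v)"
        by (simp add: v qrotate_list_path [OF cv])
      then show ?thesis
        using rotations_trans [OF rotate_in_rotations v(1)] by blast
    next
      case 2
      show ?thesis
        using 2(1)
      proof (cases rule: qcycle_cases)
        \<comment> \<open>A vertex is fixed by rotation, so it is not carried to a nontrivial
          cycle.\<close>
        case (1 u)
        then show ?thesis
          using 2(2) v cv closed_walk_ne by (auto simp: list_path_def)
      next
        case (2 u)
        then have "v = rotate 1 u"
          using \<open>\<gamma> = qrotate Q \<delta>\<close> v by (simp add: qrotate_list_path)
        then have "u \<in> rotations v"
          using rotations_sym [OF rotate_in_rotations] by metis
        then show ?thesis
          using 2 v(1) rotations_trans by blast
      qed
    qed
  qed
next
  let ?r = "{(\<gamma>, qrotate Q \<gamma>) | \<gamma>. \<gamma> \<in> qcycles Q}"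
  fix \<gamma> assume "\<gamma> \<in> list_path ` rotations w"
  then obtain i where i: "\<gamma> = list_path (rotate i w)"
    by (auto simp: rotations_def)
  have cyc: "list_path (rotate i w) \<in> qcycles Q" for i
    by (intro list_path_qcycles closed_walk_rotations [OF assms]) simp
  have "(list_path w, list_path (rotate i w)) \<in> (?r \<union> ?r\<inverse>)\<^sup>*"
  proof (induction i)
    case (Suc i)
    have "(list_path (rotate i w), list_path (rotate (Suc i) w)) \<in> ?r"
      using cyc [of i] closed_walk_rotations [OF assms, of "rotate i w"]
      by (intro CollectI exI [of _ "list_path (rotate i w)"]) (simp add: qrotate_list_path)
    with Suc show ?case
      by (meson UnI1 rtrancl.rtrancl_into_rtrancl)
  qed simp
  then show "\<gamma> \<in> rotation_equiv Q `` {list_path w}"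
    using cyc [of i] cyc [of 0] by (auto simp: rotation_equiv_def Let_def i)
qed

lemma circuit_trivial: "v \<in> verts Q \<Longrightarrow> (v, []) \<in> rotation_equiv Q `` {(v, [])}"
  by (auto simp: rotation_equiv_def Let_def qcycles_def qpaths_def awalk_Nil_iff qsource_def qtarget_def)

lemma circuits_cases:
  assumes "C \<in> circuits Q"
  obtains v where "v \<in> verts Q" "(v, []) \<in> C" "C = rotation_equiv Q `` {(v, [])}"
    | w where "closed_walk w" "C = list_path ` rotations w"
proof -
  obtain \<gamma> where \<gamma>: "\<gamma> \<in> qcycles Q" "C = rotation_equiv Q `` {\<gamma>}"
    using assms by (auto simp: circuits_def quotient_def)
  show thesis
    using \<gamma>(1)
  proof (cases rule: qcycle_cases)
    case (1 v)
    then show ?thesis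
      using that(1) [of v] circuit_trivial \<gamma>(2) by auto
  next
    case (2 w)
    then show ?thesis
      using that(2) [of w] circuit_list_path \<gamma>(2) by auto
  qed
qed

lemma list_path_circuits: "closed_walk w \<Longrightarrow> list_path ` rotations w \<in> circuits Q"
  using circuit_list_path [of w] list_path_qcycles [of w] by (auto simp: circuits_def quotient_def)

lemma not_trivial_circuit: "closed_walk w \<Longrightarrow> \<not> trivial_circuit Q (list_path ` rotations w)"
  using closed_walk_rotations [of w] closed_walk_ne by (fastforce simp: trivial_circuit_def list_path_def)

lemma trivial_circuit_vertices:
  assumes "\<gamma> \<in> rotation_equiv Q `` {(v, [])}"
  shows "snd \<gamma> = []"
proof -
  let ?r = "{(\<gamma>, qrotate Q \<gamma>) | \<gamma>. \<gamma> \<in> qcycles Q}"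
  have "((v, []), \<gamma>) \<in> (?r \<union> ?r\<inverse>)\<^sup>*"
    using assms by (auto simp: rotation_equiv_def Let_def)
  then show ?thesis
  proof (induction rule: rtrancl_induct)
    case (step \<gamma> \<delta>)
    then show ?case
      by (cases \<gamma>; cases \<delta>; cases "snd \<delta>") auto
  qed simp
qed

text \<open>The cycle chosen in the definition is some rotation of w, and length and period are the
  same for all rotations.\<close>

lemma circuit_multiplicity_list_path:
  assumes "closed_walk w"
  shows "circuit_multiplicity Q (list_path ` rotations w) = multiplicity w"
proof -
  let ?\<gamma> = "SOME \<gamma>. \<gamma> \<in> list_path ` rotations w"
  have "?\<gamma> \<in> list_path ` rotations w"
    by (rule someI [of _ "list_path w"]) simp
  then obtain v where v: "v \<in> rotations w" "?\<gamma> = list_path v"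
    by auto
  have "cycle_period Q (list_path v) = period v"
    using closed_walk_rotations [OF assms v(1)]
    by (simp add: cycle_period_def period_def qrotate_power_list_path)
  then have "circuit_multiplicity Q (list_path ` rotations w) = multiplicity v"
    unfolding circuit_multiplicity_def v(2) Let_def by (simp add: qlength_def multiplicity_def)
  then show ?thesis
    by (simp add: multiplicity_rotations [OF v(1)])
qed

section \<open>The conditions on pairs in terms of words\<close>

lemma zero_path_list_path: "walk w \<Longrightarrow> zero_path Q Z (list_path w) \<longleftrightarrow> zero_list w"
  by (simp add: zero_path_iff walk_list_path)

lemma zero_cycle_iff:
  assumes "closed_walk w"
  shows "(\<exists>\<gamma>\<in>list_path ` rotations w. zero_path Q Z \<gamma>) \<longleftrightarrow> (\<exists>v\<in>rotations w. zero_list v)"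
  using closed_walk_rotations [OF assms] by (auto simp: closed_walk_def zero_path_list_path)

lemma nonzero_paths_iff: "\<alpha> \<in> nonzero_paths Q Z \<longleftrightarrow> \<alpha> \<in> qpaths Q \<and> \<not> zero_list (snd \<alpha>)"
  by (auto simp: nonzero_paths_def zero_path_iff)

text \<open>A pair (a, \<beta>) amounts to a word with last arrow a and remaining part \<beta>, so
  only the vanishing of \<beta> is at stake.\<close>

lemma odot_arrows_iff:
  assumes "closed_walk w"
  shows "odot_circuit Q (qarrows Q) (nonzero_paths Q Z) (list_path ` rotations w) \<noteq> {} \<longleftrightarrow>
    (\<exists>v\<in>rotations w. \<not> zero_list (butlast v))"
proof
  assume "odot_circuit Q (qarrows Q) (nonzero_paths Q Z) (list_path ` rotations w) \<noteq> {}"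
  then obtain a \<beta> v where "\<beta> \<in> nonzero_paths Q Z" "v \<in> rotations w" "qconcat (tail Q a, [a]) \<beta> = list_path v"
    by (auto simp: odot_circuit_def odot_def qarrows_def)
  then show "\<exists>v\<in>rotations w. \<not> zero_list (butlast v)"
    by (intro bexI [of _ v]) (auto simp: nonzero_paths_iff qconcat_def list_path_def)
next
  assume "\<exists>v\<in>rotations w. \<not> zero_list (butlast v)"
  then obtain v where v: "v \<in> rotations w" "\<not> zero_list (butlast v)"
    by blast
  have cv: "closed_walk v"
    by (rule closed_walk_rotations [OF assms v(1)])
  define a where "a = last v"
  have eq: "v = butlast v @ [a]"
    using closed_walk_ne [OF cv] by (simp add: a_def)
  have path: "(tail Q (hd v), butlast v @ [a]) \<in> qpaths Q"
    using cv eq by (simp add: closed_walk_def walk_def)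
  then obtain *: "(tail Q (hd v), butlast v) \<in> qpaths Q"
    "(qtarget Q (tail Q (hd v), butlast v), [a]) \<in> qpaths Q"
    by (rule qpaths_split)
  then have t: "qtarget Q (tail Q (hd v), butlast v) = tail Q a"
    using qpaths_ne_source by fastforce
  have "a \<in> arcs Q"
    using *(2) t by (auto simp: qpaths_def awalk_Cons_iff)
  moreover have "head Q a = tail Q (hd v)"
    using cv by (simp add: closed_walk_def a_def)
  ultimately have "((tail Q a, [a]), (tail Q (hd v), butlast v)) \<in>
      odot_circuit Q (qarrows Q) (nonzero_paths Q Z) (list_path ` rotations w)"
    using * t v eq by (auto simp: odot_circuit_def odot_def qarrows_def nonzero_paths_iff qsource_def
        qtarget_def [of _ "(_, [a])"] qconcat_def list_path_def intro!: image_eqI [of _ _ v])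
  then show "odot_circuit Q (qarrows Q) (nonzero_paths Q Z) (list_path ` rotations w) \<noteq> {}"
    by blast
qed

definition sole_relation :: "('v, 'e) qpath \<Rightarrow> ('v, 'e) qpath \<Rightarrow> 'e list set \<Rightarrow> bool" where
  "sole_relation \<xi> \<beta> W \<longleftrightarrow>
     (\<xi>, \<beta>) \<in> odot_circuit Q Z (nonzero_paths Q Z) (list_path ` W) \<and> no_other_zero_relation Q Z \<xi> \<beta>"

text \<open>A relation inside \<open>butlast v\<close> would have the last arrow of v in its left
  cofactor \<gamma>, so it could not be the evident occurrence of \<xi>.\<close>

lemma sole_relationE:
  assumes "closed_walk w" "sole_relation \<xi> \<beta> (rotations w)"
  obtains v where "v \<in> rotations w" "end_walk v" "qconcat \<xi> \<beta> = list_path v"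
proof -
  have \<xi>\<beta>: "\<xi> \<in> Z" "\<beta> \<in> qpaths Q" "qconcat \<xi> \<beta> \<in> list_path ` rotations w"
    and other: "no_other_zero_relation Q Z \<xi> \<beta>"
    using assms(2) by (auto simp: sole_relation_def odot_circuit_def odot_def nonzero_paths_iff)
  then obtain v where v: "v \<in> rotations w" "qconcat \<xi> \<beta> = list_path v"
    by auto
  have eq: "v = snd \<beta> @ snd \<xi>"
    using v(2) by (auto simp: qconcat_def list_path_def)
  have cv: "closed_walk v"
    by (rule closed_walk_rotations [OF assms(1) v(1)])
  have "zero_list v"
    using \<xi>\<beta>(1) by (auto simp: zero_list_def eq)
  moreover have False if zero: "zero_list (butlast v)"
  proof -
    obtain \<zeta> where "\<zeta> \<in> Z" "sublist (snd \<zeta>) (butlast v)"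
      using zero unfolding zero_list_def by blast
    then obtain p q where \<zeta>: "\<zeta> \<in> Z" "butlast v = p @ snd \<zeta> @ q"
      by (auto simp: sublist_def)
    then have v': "v = p @ snd \<zeta> @ (q @ [last v])"
      using closed_walk_ne [OF cv] by (metis append.assoc append_butlast_last_id)
    let ?u = "tail Q (hd v)"
    have path: "(?u, p @ snd \<zeta> @ (q @ [last v])) \<in> qpaths Q"
      using cv v' by (simp add: closed_walk_def walk_def)
    let ?x = "qtarget Q (?u, p)"
    have occ: "occurs_at Q (qtarget Q (?x, snd \<zeta>), q @ [last v]) (?x, snd \<zeta>) (?u, p) (list_path v)"
      using occurs_atI [OF path] v' by (simp add: list_path_def)
    have "snd \<zeta> \<noteq> []"
      using Z_length [OF \<zeta>(1)] by auto
    then have "(?x, snd \<zeta>) = \<zeta>"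
      using occ qpath_eq_list_path [of "(?x, snd \<zeta>)"] qpath_eq_list_path [OF Z_qpaths [OF \<zeta>(1)]]
      by (auto simp: occurs_at_def)
    then have "(qtarget Q (?x, snd \<zeta>), q @ [last v]) = (qtarget Q \<xi>, [])"
      using other occ \<zeta>(1) unfolding no_other_zero_relation_def v(2) by metis
    then show False
      by simp
  qed
  ultimately show thesis
    using that v by (auto simp: end_walk_def)
qed

text \<open>Every relation in v is a suffix of the list. Two suffixes are comparable, hence equal by
  the minimality of Z; so the relation \<xi> at the end is the only one.\<close>

lemma end_walk_sole_relation:
  assumes "closed_walk w" "v \<in> rotations w" "end_walk v"
  obtains \<xi> \<beta> where "sole_relation \<xi> \<beta> (rotations w)" "qconcat \<xi> \<beta> = list_path v" "v = snd \<beta> @ snd \<xi>"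
proof -
  have cv: "closed_walk v"
    by (rule closed_walk_rotations [OF assms(1,2)])
  have suffix_only: "q = []" if "v = p @ snd \<zeta> @ q" "\<zeta> \<in> Z" for p q \<zeta>
  proof (rule ccontr)
    assume "q \<noteq> []"
    then have "sublist (snd \<zeta>) (butlast v)"
      by (rule sublist_butlast [OF that(1)])
    then show False
      using assms(3) that(2) by (auto simp: end_walk_def zero_list_def)
  qed
  obtain \<xi> where "\<xi> \<in> Z" "sublist (snd \<xi>) v"
    using assms(3) unfolding end_walk_def zero_list_def by blast
  then obtain p q where "\<xi> \<in> Z" "v = p @ snd \<xi> @ q"
    by (auto simp: sublist_def)
  then have \<xi>: "\<xi> \<in> Z" and v: "v = p @ snd \<xi>"
    using suffix_only by auto
  have ne: "snd \<xi> \<noteq> []"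
    using Z_length [OF \<xi>] by auto
  define \<beta> where "\<beta> = (tail Q (hd v), p)"
  have path: "(tail Q (hd v), p @ snd \<xi>) \<in> qpaths Q"
    using cv v by (simp add: closed_walk_def walk_def)
  then obtain *: "\<beta> \<in> qpaths Q" "(qtarget Q \<beta>, snd \<xi>) \<in> qpaths Q"
    unfolding \<beta>_def by (rule qpaths_split)
  then have t: "qtarget Q \<beta> = qsource \<xi>"
    using qpath_eq_list_path [OF Z_qpaths [OF \<xi>] ne] qpath_eq_list_path [OF *(2)] ne
    by (simp add: qsource_def list_path_def) (metis fst_conv)
  have t': "qtarget Q \<xi> = qsource \<beta>"
    using cv v ne by (simp add: closed_walk_def qtarget_def \<beta>_def qsource_def)
  have eq: "qconcat \<xi> \<beta> = list_path v"
    by (simp add: qconcat_def qsource_def \<beta>_def v list_path_def)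
  have "sublist p (butlast v)"
    using ne by (simp add: v butlast_append)
  then have "\<not> zero_list p"
    using assms(3) zero_list_sublist by (auto simp: end_walk_def)
  then have "\<beta> \<in> nonzero_paths Q Z"
    using * by (simp add: nonzero_paths_iff) (simp add: \<beta>_def)
  then have odot: "(\<xi>, \<beta>) \<in> odot_circuit Q Z (nonzero_paths Q Z) (list_path ` rotations w)"
    using \<xi> t t' assms(2) by (simp add: odot_circuit_def odot_def eq)
  have "no_other_zero_relation Q Z \<xi> \<beta>"
    unfolding no_other_zero_relation_def
  proof (intro ballI allI impI)
    fix \<zeta> \<gamma> \<delta> assume \<zeta>: "\<zeta> \<in> Z" and occ: "occurs_at Q \<gamma> \<zeta> \<delta> (qconcat \<xi> \<beta>)"
    then have "list_path v = qconcat \<gamma> (qconcat \<zeta> \<delta>)"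
      by (simp add: occurs_at_def eq)
    then have v': "v = snd \<delta> @ snd \<zeta> @ snd \<gamma>" and src: "fst \<delta> = tail Q (hd v)"
      by (auto simp: list_path_def qconcat_def qsource_def)
    then have \<gamma>: "snd \<gamma> = []"
      using suffix_only \<zeta> by blast
    then have eq': "snd \<delta> @ snd \<zeta> = p @ snd \<xi>"
      using v v' by simp
    have "sublist (snd \<zeta>) (snd \<xi>) \<or> sublist (snd \<xi>) (snd \<zeta>)"
      using eq' unfolding append_eq_append_conv2 by (metis sublist_append_leftI)
    then have "\<zeta> = \<xi>"
      using Z_minimal [OF \<xi> \<zeta>] Z_minimal [OF \<zeta> \<xi>] subpath_iff Z_qpaths [OF \<xi>] Z_qpaths [OF \<zeta>] ne
        Z_length [OF \<zeta>] by fastforce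
    moreover have "\<delta> = \<beta>"
      using eq' src \<open>\<zeta> = \<xi>\<close> by (cases \<delta>) (simp add: \<beta>_def)
    moreover have "\<gamma> = (qtarget Q \<xi>, [])"
      using occ \<gamma> \<open>\<zeta> = \<xi>\<close> by (cases \<gamma>) (auto simp: occurs_at_def qsource_def)
    ultimately show "\<gamma> = (qtarget Q \<xi>, []) \<and> \<zeta> = \<xi> \<and> \<delta> = \<beta>"
      by blast
  qed
  then show thesis
    using that odot eq by (auto simp: sole_relation_def \<beta>_def v)
qed

text \<open>The evident occurrence of \<xi>' is an occurrence in \<xi>\<beta>, where no relation
  other than the evident \<xi> occurs.\<close>

lemma sole_relation_unique:
  assumes "sole_relation \<xi> \<beta> W" "sole_relation \<xi>' \<beta>' W" "qconcat \<xi> \<beta> = qconcat \<xi>' \<beta>'"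
  shows "\<xi> = \<xi>' \<and> \<beta> = \<beta>'"
proof -
  have \<xi>': "\<xi>' \<in> Z" "\<beta>' \<in> qpaths Q" "qtarget Q \<beta>' = qsource \<xi>'"
    using assms(2) by (auto simp: sole_relation_def odot_circuit_def odot_def nonzero_paths_iff)
  have "(qtarget Q \<xi>', []) \<in> qpaths Q"
    using qpaths_target [OF Z_qpaths [OF \<xi>'(1)]] by (auto simp: qpaths_def awalk_Nil_iff)
  then have "occurs_at Q (qtarget Q \<xi>', []) \<xi>' \<beta>' (qconcat \<xi> \<beta>)"
    using \<xi>' Z_qpaths [OF \<xi>'(1)] unfolding assms(3)
    by (auto simp: occurs_at_def qsource_def qconcat_def)
  then show ?thesis
    using assms(1) \<xi>'(1) unfolding sole_relation_def no_other_zero_relation_def by blast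
qed

text \<open>Composition (\<xi>, \<beta>) \<mapsto> \<xi>\<beta> is a bijection from these pairs onto
  the end words of the circuit.\<close>

lemma ex1_sole_relation_iff:
  assumes "closed_walk w"
  shows "(\<exists>!(\<xi>, \<beta>). (\<xi>, \<beta>) \<in> odot_circuit Q Z (nonzero_paths Q Z) (list_path ` rotations w) \<and>
      no_other_zero_relation Q Z \<xi> \<beta>) \<longleftrightarrow> (\<exists>!v. v \<in> rotations w \<and> end_walk v)"
proof -
  let ?S = "\<lambda>x. sole_relation (fst x) (snd x) (rotations w)" and ?E = "\<lambda>v. v \<in> rotations w \<and> end_walk v"
  have 1: "\<exists>v. ?E v \<and> qconcat (fst x) (snd x) = list_path v" if "?S x" for x
    using sole_relationE [OF assms that] by metis
  have 2: "\<exists>x. ?S x \<and> qconcat (fst x) (snd x) = list_path v" if "?E v" for v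
    using end_walk_sole_relation [OF assms, of v] that by (metis fst_conv snd_conv)
  have 3: "x = y" if "?S x" "?S y" "qconcat (fst x) (snd x) = qconcat (fst y) (snd y)" for x y
    using sole_relation_unique [OF that] by (simp add: prod_eq_iff)
  have "(\<exists>!x. ?S x) \<longleftrightarrow> (\<exists>!v. ?E v)"
  proof
    assume "\<exists>!x. ?S x"
    then show "\<exists>!v. ?E v"
      using 1 2 by (metis list_path_inject)
  next
    assume "\<exists>!v. ?E v"
    then show "\<exists>!x. ?S x"
      using 1 2 3 by metis
  qed
  then show ?thesis
    by (simp add: sole_relation_def case_prod_unfold)
qed

end

section \<open>Reduction to cyclic words\<close>

lemma butlast_rotate1: "w \<noteq> [] \<Longrightarrow> butlast (rotate1 w) = tl w"
  by (cases w) auto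

text \<open>\<open>butlast (rotate (Suc i) w)\<close> is the cyclic word w cut open by deleting
  entry i; a factor that avoids this entry survives. The next lemma is the same for the other
  factor.\<close>

lemma sublist_butlast_rotate_suffix:
  assumes "i < length u"
  shows "sublist v (butlast (rotate (Suc i) (u @ v)))"
proof -
  have "rotate i (u @ v) = drop i u @ v @ take i u" "drop i u \<noteq> []"
    using assms by (simp_all add: rotate_drop_take)
  then have "butlast (rotate (Suc i) (u @ v)) = tl (drop i u) @ v @ take i u"
    by (simp add: butlast_rotate1)
  then show ?thesis
    by (simp del: append_assoc add: sublist_appendI)
qed

lemma sublist_butlast_rotate_prefix:
  assumes "length u \<le> i" "i < length u + length v"
  shows "sublist u (butlast (rotate (Suc i) (u @ v)))"
proof -
  have "rotate i (u @ v) = drop (i - length u) v @ u @ take (i - length u) v" "drop (i - length u) v \<noteq> []"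
    using assms by (auto simp add: rotate_drop_take)
  then have "butlast (rotate (Suc i) (u @ v)) = tl (drop (i - length u) v) @ u @ take (i - length u) v"
    by (simp add: butlast_rotate1)
  then show ?thesis
    by (simp del: append_assoc add: sublist_appendI)
qed

lemma (in ring) finsum_telescope:
  assumes "\<And>i. a i \<in> carrier R"
  shows "(\<Oplus>i\<in>{..r}. a (Suc i) \<ominus> a i) = a (Suc r) \<ominus> a 0"
proof (induction r)
  case (Suc r)
  have "(\<Oplus>i\<in>{..Suc r}. a (Suc i) \<ominus> a i) =
      (a (Suc (Suc r)) \<ominus> a (Suc r)) \<oplus> (\<Oplus>i\<in>{..r}. a (Suc i) \<ominus> a i)"
    using assms by (simp add: atMost_Suc)
  also have "\<dots> = (a (Suc (Suc r)) \<ominus> a (Suc r)) \<oplus> (a (Suc r) \<ominus> a 0)"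
    by (simp add: Suc)
  also have "\<dots> = a (Suc (Suc r)) \<ominus> a 0"
    using assms [of 0] assms [of "Suc r"] assms [of "Suc (Suc r)"]
    by (simp add: minus_eq a_assoc r_neg1)
  finally show ?case .
qed (use assms in simp)

context monomial_quiver
begin

lemma qconcat_closed_walk:
  assumes "\<alpha> \<in> qpaths Q" "\<beta> \<in> qpaths Q" "qtarget Q \<beta> = qsource \<alpha>" "qtarget Q \<alpha> = qsource \<beta>"
    and "snd \<beta> \<noteq> []"
  shows "closed_walk (snd \<beta> @ snd \<alpha>)"
proof -
  let ?\<gamma> = "qconcat \<alpha> \<beta>" and ?v = "snd \<beta> @ snd \<alpha>"
  have \<gamma>: "?\<gamma> \<in> qpaths Q" and snd: "snd ?\<gamma> = ?v"
    by (rule qpaths_qconcat [OF assms(1-3)]) (simp add: qconcat_def)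
  have ne: "snd ?\<gamma> \<noteq> []"
    using assms(5) snd by simp
  have "walk (snd ?\<gamma>)" "?\<gamma> = list_path (snd ?\<gamma>)"
    by (rule walk_snd [OF \<gamma> ne], rule qpath_eq_list_path [OF \<gamma> ne])
  moreover have "qtarget Q ?\<gamma> = qsource ?\<gamma>"
    by (simp add: qtarget_qconcat assms)
  ultimately show ?thesis
    unfolding closed_walk_def snd using qsource_list_path [of ?v] qtarget_list_path [of ?v] assms(5)
    by auto
qed

section \<open>Words as an arrow together with its complement\<close>

definition arrow :: "'e \<Rightarrow> ('v, 'e) qpath" where
  "arrow a = (tail Q a, [a])"

text \<open>The path \<beta> for which the word is a\<beta>. Its source is supplied as the terminal
  vertex of a, because the list is empty when the word is a loop.\<close>

definition coarrow :: "'e list \<Rightarrow> ('v, 'e) qpath" where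
  "coarrow w = (head Q (last w), butlast w)"

lemma arrow_path: "a \<in> arcs Q \<Longrightarrow> arrow a \<in> qpaths Q"
  by (auto simp: arrow_def qpaths_def awalk_Cons_iff awalk_Nil_iff)

lemma arrow_ends [simp]: "qsource (arrow a) = tail Q a" "qtarget Q (arrow a) = head Q a"
  by (simp_all add: arrow_def qsource_def qtarget_def)

lemma vertex_path: "v \<in> verts Q \<Longrightarrow> (v, []) \<in> qpaths Q"
  by (auto simp: qpaths_def awalk_Nil_iff)

lemma vertex_ends [simp]: "qsource (v, []) = v" "qtarget Q (v, []) = v"
  by (simp_all add: qsource_def qtarget_def)

lemma qconcat_vertex [simp]: "qconcat (v, []) \<alpha> = \<alpha>" "qconcat \<alpha> (qsource \<alpha>, []) = \<alpha>"
  by (simp_all add: qconcat_def qsource_def)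

lemma closed_walk_coarrow:
  assumes "closed_walk w"
  shows "last w \<in> arcs Q" "coarrow w \<in> qpaths Q" "qtarget Q (coarrow w) = tail Q (last w)"
    "qsource (coarrow w) = head Q (last w)"
    "qconcat (arrow (last w)) (coarrow w) = list_path w"
    "qconcat (coarrow w) (arrow (last w)) = list_path (rotate_back w)"
proof -
  have ne: "w \<noteq> []" and hd: "head Q (last w) = tail Q (hd w)"
    using assms by (auto simp: closed_walk_def walk_ne)
  have eq: "w = butlast w @ [last w]"
    using ne by simp
  have "(tail Q (hd w), butlast w @ [last w]) \<in> qpaths Q"
    using assms ne by (simp add: closed_walk_def walk_def)
  then obtain *: "(tail Q (hd w), butlast w) \<in> qpaths Q"
    "(qtarget Q (tail Q (hd w), butlast w), [last w]) \<in> qpaths Q"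
    by (rule qpaths_split)
  show "coarrow w \<in> qpaths Q"
    using * by (simp add: coarrow_def hd)
  show "last w \<in> arcs Q"
    using *(2) by (auto simp: qpaths_def awalk_Cons_iff)
  show "qtarget Q (coarrow w) = tail Q (last w)"
    using qpaths_ne_source [OF *(2)] by (simp add: coarrow_def hd)
  show "qsource (coarrow w) = head Q (last w)"
    by (simp add: coarrow_def qsource_def)
  show "qconcat (arrow (last w)) (coarrow w) = list_path w"
    using ne by (simp add: qconcat_def arrow_def coarrow_def list_path_def qsource_def hd)
  show "qconcat (coarrow w) (arrow (last w)) = list_path (rotate_back w)"
    by (simp add: qconcat_def arrow_def coarrow_def list_path_def qsource_def rotate_back_def)
qed

lemma closed_walk_rotate_back: "closed_walk w \<Longrightarrow> closed_walk (rotate_back w)"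
  using rotate_back_rotations [of w w 1] closed_walk_rotations closed_walk_ne by simp

text \<open>
  The words that are not closed arise from pairs \<open>(\<alpha>, \<beta>)\<close> for which only one of \<open>\<alpha>\<beta>\<close>, \<open>\<beta>\<alpha>\<close> is
  defined. They cannot occur in a cycle, since such a word is its own commutator.
\<close>

definition word_term :: "'k \<Rightarrow> 'e list \<Rightarrow>
    ((('v, 'e) qpath \<Rightarrow>\<^sub>0 'k) set \<times> (('v, 'e) qpath \<Rightarrow>\<^sub>0 'k) set \<Rightarrow>\<^sub>0 int)" where
  "word_term c w =
     (if closed_walk w then frag_of (basis_elem c (coarrow w), basis_elem 1 (arrow (last w)))
      else frag_of (basis_elem c (list_path w), basis_elem 1 (tail Q (hd w), [])))"

section \<open>Coordinates of the commutators of words\<close>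

definition commutator_coordinate :: "('v, 'e) qpath \<Rightarrow>
    ((('v, 'e) qpath \<Rightarrow>\<^sub>0 'k) set \<times> (('v, 'e) qpath \<Rightarrow>\<^sub>0 'k) set \<Rightarrow>\<^sub>0 int) \<Rightarrow> 'k" where
  "commutator_coordinate \<alpha> = frag_eval (\<lambda>(x, y). coordinate \<alpha> (x \<otimes> y \<ominus> y \<otimes> x))"

lemma additive_commutator_coordinate: "Modules.additive (commutator_coordinate \<alpha>)"
  by (simp add: commutator_coordinate_def additive_frag_eval)

lemma coordinate_diff:
  assumes "\<not> zero_path Q Z \<alpha>" "x \<in> carrier A" "y \<in> carrier A"
  shows "coordinate \<alpha> (x \<ominus> y) = coordinate \<alpha> x - coordinate \<alpha> y"
  using coordinate_add [OF assms(1), of "x \<ominus> y" y] assms by (simp add: minus_eq a_assoc l_neg)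

lemma commutator_coordinate_of:
  assumes "\<not> zero_path Q Z \<alpha>" "x \<in> carrier A" "y \<in> carrier A"
  shows "commutator_coordinate \<alpha> (frag_of (x, y)) = coordinate \<alpha> (x \<otimes> y) - coordinate \<alpha> (y \<otimes> x)"
  using assms by (simp add: commutator_coordinate_def coordinate_diff)

text \<open>This allows us to assume that congruent elements have the same commutator.\<close>

lemma hochschild_congruence_commutators:
  assumes H: "hochschild_congruence H"
  shows "hochschild_congruence (H \<inter> {z. \<forall>\<alpha>. \<not> zero_path Q Z \<alpha> \<longrightarrow> commutator_coordinate \<alpha> z = 0})"
    (is "hochschild_congruence (H \<inter> ?K)")
proof -
  note additive = additive.zero [OF additive_commutator_coordinate] additive.add [OF additive_commutator_coordinate]
    additive.diff [OF additive_commutator_coordinate]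
  have "add_subgroup (H \<inter> ?K)"
    using H by (intro add_subgroupI)
      (auto simp: hochschild_congruence_def add_subgroup_zero add_subgroup_diff additive)
  then show ?thesis
    using H unfolding hochschild_congruence_def
    by (auto simp: additive commutator_coordinate_of coordinate_add l_distr r_distr smult_closed
        smult_mult mult_smult m_assoc)
qed

text \<open>The pair (\<beta>, a) has the commutator \<beta>a - a\<beta>, the difference between the
  backward rotation of the word and the word.\<close>

lemma commutator_coordinate_closed:
  assumes \<alpha>: "\<not> zero_path Q Z \<alpha>" and w: "closed_walk w"
  shows "commutator_coordinate \<alpha> (word_term c w) =
     (if \<alpha> = list_path (rotate_back w) then c else 0) - (if \<alpha> = list_path w then c else 0)"
proof -
  note co = closed_walk_coarrow [OF w]
  have a: "arrow (last w) \<in> qpaths Q"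
    by (rule arrow_path [OF co(1)])
  show ?thesis
    using w a co coordinate_basis_elem [OF \<alpha>]
    by (simp add: word_term_def commutator_coordinate_of [OF \<alpha>] basis_elem_closed basis_elem_mult)
qed

text \<open>For the source e of an open path \<nu> one has \<nu>e = \<nu>, whereas e\<nu> = 0 as
  \<nu> does not end at e.\<close>

lemma commutator_coordinate_open:
  assumes \<alpha>: "\<not> zero_path Q Z \<alpha>" and w: "walk w" "\<not> closed_walk w"
  shows "commutator_coordinate \<alpha> (word_term c w) = (if \<alpha> = list_path w then c else 0)"
proof -
  let ?s = "(tail Q (hd w), [])"
  have path: "list_path w \<in> qpaths Q" and s: "?s \<in> qpaths Q"
    using walk_list_path [OF w(1)] qpaths_source [of "list_path w"]
    by (auto simp: qsource_list_path intro: vertex_path)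
  have "qtarget Q (list_path w) \<noteq> tail Q (hd w)"
    using w by (simp add: closed_walk_def qtarget_list_path walk_ne)
  moreover have "coordinate \<alpha> \<zero> = 0"
    using coordinate_basis_elem [OF \<alpha>, of 0 \<alpha>] by (simp add: basis_elem_0)
  moreover have "qconcat (list_path w) ?s = list_path w"
    using qconcat_vertex(2) [of "list_path w"] by (simp only: qsource_list_path)
  ultimately show ?thesis
    using w path s coordinate_basis_elem [OF \<alpha>]
    by (simp add: word_term_def commutator_coordinate_of [OF \<alpha>] basis_elem_closed basis_elem_mult qsource_list_path)
qed

end

section \<open>Calculation modulo the boundary relations\<close>

locale monomial_congruence = monomial_quiver Q Z A for Q :: "('v, 'e) pre_digraph"
    and Z :: "('v, 'e) qpath set"
    and A :: "('k::field, (('v, 'e) qpath \<Rightarrow>\<^sub>0 'k) set) module" (structure) +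
  fixes H
  assumes H: "hochschild_congruence H"
begin

lemma cong_subgroup: "add_subgroup H"
  using H by (simp add: hochschild_congruence_def)

lemma cong_add_left:
  "\<lbrakk>x \<in> carrier A; x' \<in> carrier A; y \<in> carrier A\<rbrakk> \<Longrightarrow> frag_of (x \<oplus>\<^bsub>A\<^esub> x', y) - frag_of (x, y) - frag_of (x', y) \<in> H"
  and cong_add_right:
  "\<lbrakk>x \<in> carrier A; y \<in> carrier A; y' \<in> carrier A\<rbrakk> \<Longrightarrow> frag_of (x, y \<oplus>\<^bsub>A\<^esub> y') - frag_of (x, y) - frag_of (x, y') \<in> H"
  and cong_smult: "\<lbrakk>x \<in> carrier A; y \<in> carrier A\<rbrakk> \<Longrightarrow> frag_of (c \<odot> x, y) - frag_of (x, c \<odot> y) \<in> H"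
  and cong_cocycle: "\<lbrakk>x \<in> carrier A; y \<in> carrier A; z \<in> carrier A\<rbrakk> \<Longrightarrow>
    frag_of (x \<otimes> y, z) - frag_of (x, y \<otimes> z) + frag_of (z \<otimes> x, y) \<in> H"
  using H by (simp_all add: hochschild_congruence_def)

lemma cong_zero_left: "y \<in> carrier A \<Longrightarrow> frag_of (\<zero>, y) \<in> H"
  using add_subgroup_minus [OF cong_subgroup cong_add_left [of \<zero> \<zero> y]] by simp

lemma cong_zero_right: "x \<in> carrier A \<Longrightarrow> frag_of (x, \<zero>) \<in> H"
  using add_subgroup_minus [OF cong_subgroup cong_add_right [of x \<zero> \<zero>]] by simp

text \<open>The symbols for c, d and c + d are unrelated in the free group; bilinearity modulo H
  ties them together.\<close>

lemma word_term_add: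
  assumes "walk w"
  shows "word_term (c + d) w - word_term c w - word_term d w \<in> H"
proof (cases "closed_walk w")
  case True
  note co = closed_walk_coarrow [OF True]
  have "basis_elem c (coarrow w) \<oplus>\<^bsub>A\<^esub> basis_elem d (coarrow w) = basis_elem (c + d) (coarrow w)"
    by (rule basis_elem_add [OF co(2)])
  then show ?thesis
    using True cong_add_left [OF basis_elem_closed basis_elem_closed basis_elem_closed, OF co(2,2) arrow_path [OF co(1)], of c d 1]
    by (simp add: word_term_def)
next
  case False
  have path: "list_path w \<in> qpaths Q" and s: "(tail Q (hd w), []) \<in> qpaths Q"
    using walk_list_path [OF assms] qpaths_source [of "list_path w"]
    by (auto simp: qsource_list_path intro: vertex_path)
  have "basis_elem c (list_path w) \<oplus>\<^bsub>A\<^esub> basis_elem d (list_path w) = basis_elem (c + d) (list_path w)"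
    by (rule basis_elem_add [OF path])
  then show ?thesis
    using False cong_add_left [OF basis_elem_closed basis_elem_closed basis_elem_closed, OF path path s, of c d 1]
    by (simp add: word_term_def)
qed

lemma word_term_0: "walk w \<Longrightarrow> word_term 0 w \<in> H"
  using add_subgroup_minus [OF cong_subgroup word_term_add [of w 0 0]] by simp

lemma word_term_diff: "walk w \<Longrightarrow> word_term (c - d) w - (word_term c w - word_term d w) \<in> H"
  using add_subgroup_minus [OF cong_subgroup word_term_add [of w "c - d" d]] by (simp add: algebra_simps)

lemma word_term_closed_zero:
  assumes "closed_walk w" "zero_list (butlast w)"
  shows "word_term c w \<in> H"
proof -
  note co = closed_walk_coarrow [OF assms(1)]
  have "zero_path Q Z (coarrow w)"
    using assms co(2) by (simp add: zero_path_iff) (simp add: coarrow_def)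
  then show ?thesis
    using assms basis_elem_zero_path [OF co(2)] cong_zero_left [OF basis_elem_closed, OF arrow_path [OF co(1)]]
    by (simp add: word_term_def)
qed

lemma word_term_open_zero:
  assumes "walk w" "\<not> closed_walk w" "zero_list w"
  shows "word_term c w \<in> H"
proof -
  have path: "list_path w \<in> qpaths Q" and s: "(tail Q (hd w), []) \<in> qpaths Q"
    using walk_list_path [OF assms(1)] qpaths_source [of "list_path w"]
    by (auto simp: qsource_list_path intro: vertex_path)
  have "zero_path Q Z (list_path w)"
    using assms by (simp add: zero_path_list_path)
  then show ?thesis
    using assms basis_elem_zero_path [OF path] cong_zero_left [OF basis_elem_closed, OF s]
    by (simp add: word_term_def)
qed

lemma pair_scalar:
  assumes "\<alpha> \<in> qpaths Q" "\<beta> \<in> qpaths Q"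
  shows "frag_of (basis_elem c \<alpha>, basis_elem d \<beta>) - frag_of (basis_elem (c * d) \<alpha>, basis_elem 1 \<beta>) \<in> H"
proof -
  have "frag_of (d \<odot> basis_elem c \<alpha>, basis_elem 1 \<beta>) - frag_of (basis_elem c \<alpha>, d \<odot> basis_elem 1 \<beta>) \<in> H"
    using assms by (intro cong_smult basis_elem_closed)
  then show ?thesis
    using assms add_subgroup_commute [OF cong_subgroup] by (simp add: basis_elem_smult mult.commute)
qed

lemma pair_cocycle:
  assumes "\<alpha> \<in> qpaths Q" "\<beta> \<in> qpaths Q" "\<gamma> \<in> qpaths Q"
  shows "frag_of (basis_elem c \<alpha> \<otimes> basis_elem 1 \<beta>, basis_elem 1 \<gamma>) -
      frag_of (basis_elem c \<alpha>, basis_elem 1 \<beta> \<otimes> basis_elem 1 \<gamma>) +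
      frag_of (basis_elem 1 \<gamma> \<otimes> basis_elem c \<alpha>, basis_elem 1 \<beta>) \<in> H"
  by (rule cong_cocycle) (use assms in \<open>auto intro: basis_elem_closed\<close>)

text \<open>Write \<beta> = \<beta>'b with b the arrow traversed first. The cocycle relation for
  \<alpha>, \<beta>', b splits off the word cut at b and leaves the pair (b\<alpha>, \<beta>'),
  which is the same situation one rotation further.\<close>

lemma pair_closed:
  assumes "\<alpha> \<in> qpaths Q" "\<beta> \<in> qpaths Q" "qtarget Q \<beta> = qsource \<alpha>" "qtarget Q \<alpha> = qsource \<beta>"
  shows "frag_of (basis_elem c \<alpha>, basis_elem 1 \<beta>) -
      (\<Sum>i<length (snd \<beta>). word_term c (rotate (Suc i) (snd \<beta> @ snd \<alpha>))) \<in> H"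
  using assms
proof (induction "snd \<beta>" arbitrary: \<alpha> \<beta>)
  case Nil
  then have \<beta>: "\<beta> = (qsource \<alpha>, [])"
    by (cases \<beta>) (simp add: qtarget_def)
  \<comment> \<open>With the idempotent e in both places the cocycle relation consists of the pair
    (\<alpha>, e) with signs +, -, +, so the pair itself lies in H.\<close>
  then show ?case
    using pair_cocycle [OF Nil(2,3,3), of c] Nil by (simp add: basis_elem_mult)
next
  case (Cons b bs)
  let ?\<beta> = "(head Q b, bs)"
  have \<beta>: "\<beta> = (tail Q b, [b] @ bs)"
    using Cons.hyps(2) qpath_eq_list_path [OF Cons.prems(2)] by (simp add: list_path_def) (metis list.discI list.sel(1))
  obtain paths: "(tail Q b, [b]) \<in> qpaths Q" "?\<beta> \<in> qpaths Q" and t: "qtarget Q ?\<beta> = qtarget Q \<beta>"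
    using qpaths_split [of "tail Q b" "[b]" bs] Cons.prems(2) by (auto simp: \<beta> qtarget_def)
  then have b: "b \<in> arcs Q" "arrow b \<in> qpaths Q"
    by (auto simp: arrow_def qpaths_def awalk_Cons_iff)
  have \<beta>_eq: "qconcat ?\<beta> (arrow b) = \<beta>"
    by (simp add: qconcat_def arrow_def qsource_def \<beta>)
  have comp: "qtarget Q (arrow b) = qsource ?\<beta>" "qtarget Q ?\<beta> = qsource \<alpha>" "qtarget Q \<alpha> = qsource (arrow b)"
  proof -
    have "qsource \<beta> = tail Q b" "qsource ?\<beta> = head Q b"
      by (simp_all add: \<beta> qsource_def)
    then show "qtarget Q (arrow b) = qsource ?\<beta>" "qtarget Q ?\<beta> = qsource \<alpha>" "qtarget Q \<alpha> = qsource (arrow b)"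
      using Cons.prems(3,4) t by simp_all
  qed
  let ?v = "snd \<beta> @ snd \<alpha>"
  have v_walk: "closed_walk ?v"
    by (rule qconcat_closed_walk [OF Cons.prems]) (simp add: \<beta>)
  then have r_walk: "closed_walk (rotate1 ?v)"
    by (rule closed_walk_rotate1)
  have r: "rotate1 ?v = bs @ snd \<alpha> @ [b]"
    by (simp add: \<beta>)
  have "frag_of (basis_elem c \<alpha> \<otimes> basis_elem 1 ?\<beta>, basis_elem 1 (arrow b)) = word_term c (rotate1 ?v)"
    using r_walk comp Cons.prems paths
    by (simp add: word_term_def basis_elem_mult) (simp add: r coarrow_def qconcat_def qsource_def butlast_append)
  moreover have "basis_elem 1 ?\<beta> \<otimes> basis_elem 1 (arrow b) = basis_elem 1 \<beta>"
    using comp paths b by (simp add: basis_elem_mult \<beta>_eq)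
  moreover have "basis_elem 1 (arrow b) \<otimes> basis_elem c \<alpha> = basis_elem c (qconcat (arrow b) \<alpha>)"
    using comp b Cons.prems by (simp add: basis_elem_mult)
  ultimately have 1: "word_term c (rotate1 ?v) - frag_of (basis_elem c \<alpha>, basis_elem 1 \<beta>) +
      frag_of (basis_elem c (qconcat (arrow b) \<alpha>), basis_elem 1 ?\<beta>) \<in> H"
    using pair_cocycle [OF Cons.prems(1) paths(2) b(2), of c] by simp
  have "frag_of (basis_elem c (qconcat (arrow b) \<alpha>), basis_elem 1 ?\<beta>) -
      (\<Sum>i<length bs. word_term c (rotate (Suc i) (bs @ snd (qconcat (arrow b) \<alpha>)))) \<in> H"
    using Cons.hyps(1) [of ?\<beta> "qconcat (arrow b) \<alpha>"] comp b paths Cons.prems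
    by (simp add: qpaths_qconcat qtarget_qconcat)
  moreover have "bs @ snd (qconcat (arrow b) \<alpha>) = rotate1 ?v"
    by (simp add: r qconcat_def arrow_def)
  ultimately have 2: "frag_of (basis_elem c (qconcat (arrow b) \<alpha>), basis_elem 1 ?\<beta>) -
      (\<Sum>i<length bs. word_term c (rotate (Suc i) (rotate1 ?v))) \<in> H"
    by simp
  have "(\<Sum>i<length (snd \<beta>). word_term c (rotate (Suc i) ?v)) =
      word_term c (rotate1 ?v) + (\<Sum>i<length bs. word_term c (rotate (Suc i) (rotate1 ?v)))"
    by (simp add: \<beta> sum.lessThan_Suc_shift rotate1_rotate_swap del: sum.lessThan_Suc)
  then show ?case
    using add_subgroup_diff [OF cong_subgroup 2 1] by (simp add: algebra_simps)
qed

text \<open>A normal form in which each word carries one coefficient in k. The function c is total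
  and vanishes outside K, so that sums can be brought to a common index set and c can be compared at
  arbitrary words.\<close>

definition word_span where
  "word_span = {z. \<exists>c K. finite K \<and> K \<subseteq> Collect walk \<and> (\<forall>w. w \<notin> K \<longrightarrow> c w = 0) \<and>
     z - (\<Sum>w\<in>K. word_term (c w) w) \<in> H}"

lemma word_sum_superset:
  assumes "finite K'" "K \<subseteq> K'" "K' \<subseteq> Collect walk" "\<And>w. w \<notin> K \<Longrightarrow> c w = 0"
  shows "(\<Sum>w\<in>K'. word_term (c w) w) - (\<Sum>w\<in>K. word_term (c w) w) \<in> H"
proof -
  have "(\<Sum>w\<in>K'. word_term (c w) w) - (\<Sum>w\<in>K. word_term (c w) w) = (\<Sum>w\<in>K' - K. word_term (c w) w)"
    by (rule sum_diff [symmetric, OF assms(1,2)])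
  also have "\<dots> \<in> H"
    using assms by (intro add_subgroup_sum [OF cong_subgroup]) (auto intro: word_term_0)
  finally show ?thesis .
qed

lemma add_subgroup_word_span: "add_subgroup word_span"
proof (rule add_subgroupI)
  show "0 \<in> word_span"
    unfolding word_span_def using add_subgroup_zero [OF cong_subgroup]
    by (intro CollectI exI [of _ "\<lambda>_. 0"] exI [of _ "{}"]) simp
next
  fix x y assume "x \<in> word_span" "y \<in> word_span"
  then obtain c K d L where K: "finite K" "K \<subseteq> Collect walk" "\<And>w. w \<notin> K \<Longrightarrow> c w = 0"
      "x - (\<Sum>w\<in>K. word_term (c w) w) \<in> H"
    and L: "finite L" "L \<subseteq> Collect walk" "\<And>w. w \<notin> L \<Longrightarrow> d w = 0"
      "y - (\<Sum>w\<in>L. word_term (d w) w) \<in> H"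
    unfolding word_span_def by blast
  let ?M = "K \<union> L"
  have 1: "(\<Sum>w\<in>?M. word_term (c w) w) - (\<Sum>w\<in>K. word_term (c w) w) \<in> H"
    by (rule word_sum_superset) (use K L in auto)
  have 2: "(\<Sum>w\<in>?M. word_term (d w) w) - (\<Sum>w\<in>L. word_term (d w) w) \<in> H"
    by (rule word_sum_superset) (use K L in auto)
  have 3: "(\<Sum>w\<in>?M. word_term (c w - d w) w) - (\<Sum>w\<in>?M. word_term (c w) w - word_term (d w) w) \<in> H"
    by (rule add_subgroup_sum_cong [OF cong_subgroup word_term_diff]) (use K L in auto)
  have "x - y - (\<Sum>w\<in>?M. word_term (c w - d w) w) \<in> H"
    using add_subgroup_diff [OF cong_subgroup add_subgroup_diff [OF cong_subgroup K(4) L(4)]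
        add_subgroup_add [OF cong_subgroup add_subgroup_diff [OF cong_subgroup 1 2] 3]]
    by (simp add: sum_subtractf algebra_simps)
  then show "x - y \<in> word_span"
    unfolding word_span_def using K L
    by (intro CollectI exI [of _ "\<lambda>w. c w - d w"] exI [of _ ?M]) auto
qed

lemma word_span_H: "z \<in> H \<Longrightarrow> z \<in> word_span"
  unfolding word_span_def by (intro CollectI exI [of _ "\<lambda>_. 0"] exI [of _ "{}"]) simp

lemma word_span_cong: "z - z' \<in> H \<Longrightarrow> z' \<in> word_span \<Longrightarrow> z \<in> word_span"
  using add_subgroup_add [OF add_subgroup_word_span word_span_H, of "z - z'" z'] by simp

lemma word_term_span: "walk w \<Longrightarrow> word_term c w \<in> word_span"
  unfolding word_span_def
  by (intro CollectI exI [of _ "\<lambda>v. if v = w then c else 0"] exI [of _ "{w}"])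
     (simp add: add_subgroup_zero [OF cong_subgroup])

lemma open_path_span:
  assumes "\<nu> \<in> qpaths Q" "qsource \<nu> \<noteq> qtarget Q \<nu>"
  shows "frag_of (basis_elem c \<nu>, basis_elem 1 (qsource \<nu>, [])) \<in> word_span"
    and "frag_of (basis_elem c \<nu>, basis_elem 1 (qtarget Q \<nu>, [])) \<in> word_span"
proof -
  have ne: "snd \<nu> \<noteq> []"
    using assms(2) by (auto simp: qsource_def qtarget_def)
  have \<nu>: "\<nu> = list_path (snd \<nu>)" and w: "walk (snd \<nu>)"
    by (auto intro: qpath_eq_list_path [OF assms(1) ne] walk_snd [OF assms(1) ne])
  have src: "qsource \<nu> = tail Q (hd (snd \<nu>))"
    using \<nu> qsource_list_path by metis
  have nc: "\<not> closed_walk (snd \<nu>)"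
    using assms(2) ne src by (auto simp: closed_walk_def qtarget_def)
  have "frag_of (basis_elem c \<nu>, basis_elem 1 (qsource \<nu>, [])) = word_term c (snd \<nu>)"
    using nc \<nu> src by (simp add: word_term_def)
  then show 1: "frag_of (basis_elem c \<nu>, basis_elem 1 (qsource \<nu>, [])) \<in> word_span"
    using word_term_span [OF w] by simp
  have s: "(qsource \<nu>, []) \<in> qpaths Q" and t: "(qtarget Q \<nu>, []) \<in> qpaths Q"
    using qpaths_source [OF assms(1)] qpaths_target [OF assms(1)] by (auto intro: vertex_path)
  \<comment> \<open>The product of the distinct vertices s and t vanishes, so the cocycle relation
    makes (\<nu>, t) congruent to -(\<nu>, s).\<close>
  have "frag_of (basis_elem c \<nu>, basis_elem 1 (qtarget Q \<nu>, [])) - frag_of (basis_elem c \<nu>, \<zero>) +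
      frag_of (basis_elem c \<nu>, basis_elem 1 (qsource \<nu>, [])) \<in> H"
    using pair_cocycle [OF assms(1) s t, of c] assms s t by (simp add: basis_elem_mult)
  then have "frag_of (basis_elem c \<nu>, basis_elem 1 (qtarget Q \<nu>, [])) -
      (- frag_of (basis_elem c \<nu>, basis_elem 1 (qsource \<nu>, []))) \<in> H"
    using add_subgroup_add [OF cong_subgroup _ cong_zero_right [OF basis_elem_closed [OF assms(1)], of c]]
    by fastforce
  then show "frag_of (basis_elem c \<nu>, basis_elem 1 (qtarget Q \<nu>, [])) \<in> word_span"
    using word_span_cong add_subgroup_minus [OF add_subgroup_word_span 1] by blast
qed

text \<open>If just one of \<alpha>\<beta> and \<beta>\<alpha> is defined, the cocycle relation with
  an end vertex of \<beta> moves the pair to that product and a vertex; if neither is, all other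
  terms of the relation vanish.\<close>

lemma pair_span:
  assumes \<alpha>: "\<alpha> \<in> qpaths Q" and \<beta>: "\<beta> \<in> qpaths Q"
  shows "frag_of (basis_elem c \<alpha>, basis_elem 1 \<beta>) \<in> word_span"
proof -
  have s: "(qsource \<beta>, []) \<in> qpaths Q" and t: "(qtarget Q \<beta>, []) \<in> qpaths Q"
    using qpaths_source [OF \<beta>] qpaths_target [OF \<beta>] by (auto intro: vertex_path)
  note zero = cong_zero_left [OF basis_elem_closed [OF s], of 1] cong_zero_left [OF basis_elem_closed [OF \<beta>], of 1]
  consider "qtarget Q \<beta> = qsource \<alpha>" "qtarget Q \<alpha> = qsource \<beta>"
    | "qtarget Q \<beta> = qsource \<alpha>" "qtarget Q \<alpha> \<noteq> qsource \<beta>"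
    | "qtarget Q \<beta> \<noteq> qsource \<alpha>" "qtarget Q \<alpha> = qsource \<beta>"
    | "qtarget Q \<beta> \<noteq> qsource \<alpha>" "qtarget Q \<alpha> \<noteq> qsource \<beta>"
    by blast
  then show ?thesis
  proof cases
    case 1
    have "walk (rotate (Suc i) (snd \<beta> @ snd \<alpha>))" if "i < length (snd \<beta>)" for i
    proof -
      have "closed_walk (snd \<beta> @ snd \<alpha>)"
        by (rule qconcat_closed_walk [OF \<alpha> \<beta> 1]) (use that in auto)
      then have "closed_walk (rotate (Suc i) (snd \<beta> @ snd \<alpha>))"
        using closed_walk_rotations rotate_in_rotations by blast
      then show ?thesis
        by (simp add: closed_walk_def)
    qed
    then have "(\<Sum>i<length (snd \<beta>). word_term c (rotate (Suc i) (snd \<beta> @ snd \<alpha>))) \<in> word_span"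
      by (intro add_subgroup_sum [OF add_subgroup_word_span] word_term_span) simp
    with pair_closed [OF \<alpha> \<beta> 1] show ?thesis
      by (rule word_span_cong)
  next
    case 2
    let ?\<nu> = "qconcat \<alpha> \<beta>"
    have \<nu>: "?\<nu> \<in> qpaths Q" "qsource ?\<nu> \<noteq> qtarget Q ?\<nu>"
      using 2 \<alpha> \<beta> by (auto simp: qpaths_qconcat qtarget_qconcat)
    have "frag_of (basis_elem c ?\<nu>, basis_elem 1 (qsource \<beta>, [])) - frag_of (basis_elem c \<alpha>, basis_elem 1 \<beta>) +
        frag_of (\<zero>, basis_elem 1 \<beta>) \<in> H"
      using pair_cocycle [OF \<alpha> \<beta> s, of c] 2 \<alpha> \<beta> s by (simp add: basis_elem_mult)
    from add_subgroup_diff [OF cong_subgroup zero(2) this]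
    have "frag_of (basis_elem c \<alpha>, basis_elem 1 \<beta>) - frag_of (basis_elem c ?\<nu>, basis_elem 1 (qsource ?\<nu>, [])) \<in> H"
      by (simp add: algebra_simps)
    then show ?thesis
      by (rule word_span_cong) (rule open_path_span(1) [OF \<nu>])
  next
    case 3
    let ?\<nu> = "qconcat \<beta> \<alpha>"
    have \<nu>: "?\<nu> \<in> qpaths Q" "qsource ?\<nu> \<noteq> qtarget Q ?\<nu>" and t\<nu>: "qtarget Q ?\<nu> = qtarget Q \<beta>"
      using 3 \<alpha> \<beta> by (auto simp: qpaths_qconcat qtarget_qconcat)
    have "frag_of (\<zero>, basis_elem 1 \<beta>) - frag_of (basis_elem c \<alpha>, basis_elem 1 \<beta>) +
        frag_of (basis_elem c ?\<nu>, basis_elem 1 (qtarget Q \<beta>, [])) \<in> H"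
      using pair_cocycle [OF \<alpha> t \<beta>, of c] 3 \<alpha> \<beta> t by (simp add: basis_elem_mult)
    from add_subgroup_diff [OF cong_subgroup zero(2) this]
    have "frag_of (basis_elem c \<alpha>, basis_elem 1 \<beta>) - frag_of (basis_elem c ?\<nu>, basis_elem 1 (qtarget Q ?\<nu>, [])) \<in> H"
      by (simp add: algebra_simps t\<nu>)
    then show ?thesis
      by (rule word_span_cong) (rule open_path_span(2) [OF \<nu>])
  next
    case 4
    have "frag_of (\<zero>, basis_elem 1 (qsource \<beta>, [])) - frag_of (basis_elem c \<alpha>, basis_elem 1 \<beta>) +
        frag_of (\<zero>, basis_elem 1 \<beta>) \<in> H"
      using pair_cocycle [OF \<alpha> \<beta> s, of c] 4 \<alpha> \<beta> s by (simp add: basis_elem_mult)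
    from add_subgroup_diff [OF cong_subgroup add_subgroup_add [OF cong_subgroup zero] this]
    have "frag_of (basis_elem c \<alpha>, basis_elem 1 \<beta>) \<in> H"
      by simp
    then show ?thesis
      by (rule word_span_H)
  qed
qed

lemma tensor_span:
  assumes "x \<in> carrier A" "y \<in> carrier A"
  shows "frag_of (x, y) \<in> word_span"
  using assms(1)
proof (induction x rule: A_induct)
  case zero
  then show ?case
    using assms(2) by (intro word_span_H cong_zero_left)
next
  case (add x x')
  then show ?case
    using word_span_cong [of _ "frag_of (x, y) + frag_of (x', y)"] cong_add_left [of x x' y] assms(2)
      add_subgroup_add [OF add_subgroup_word_span] by (simp add: diff_diff_eq)
next
  case (basis c \<alpha>)
  show ?case
    using assms(2)
  proof (induction y rule: A_induct)
    case zero
    then show ?case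
      using basis by (intro word_span_H cong_zero_right basis_elem_closed)
  next
    case (add y y')
    then show ?case
      using word_span_cong [of _ "frag_of (basis_elem c \<alpha>, y) + frag_of (basis_elem c \<alpha>, y')"]
        cong_add_right [OF basis_elem_closed [OF basis], of y y' c]
        add_subgroup_add [OF add_subgroup_word_span] by (simp add: diff_diff_eq)
  next
    case (basis d \<beta>)
    then show ?case
      using word_span_cong [OF pair_scalar pair_span] \<open>\<alpha> \<in> qpaths Q\<close> by blast
  qed
qed

text \<open>Turn the circuit until a relation \<zeta> comes first. The pair of its complement with
  \<zeta> is zero in A and by \<open>pair_closed\<close> equals the sum of the words cut at an arrow
  of \<zeta>. Words cut elsewhere still contain \<zeta> in \<open>butlast\<close> and vanish, so the
  sum extends to all rotations.\<close>

lemma rotation_sum: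
  assumes w: "closed_walk w" and v: "v \<in> rotations w" "zero_list v"
  shows "(\<Sum>u\<in>rotations w. \<Sum>j<multiplicity w. word_term d u) \<in> H"
proof -
  obtain \<zeta> where "\<zeta> \<in> Z" "sublist (snd \<zeta>) v"
    using v(2) unfolding zero_list_def by blast
  then obtain p q where \<zeta>: "\<zeta> \<in> Z" and v_eq: "v = p @ snd \<zeta> @ q"
    by (auto simp: sublist_def)
  define u where "u = snd \<zeta> @ (q @ p)"
  have "rotate (length p) v = u"
    using rotate_append [of p "snd \<zeta> @ q"] by (simp add: v_eq u_def)
  then have u: "u \<in> rotations w"
    using rotations_trans [OF rotate_in_rotations v(1)] by metis
  have cu: "closed_walk u"
    by (rule closed_walk_rotations [OF w u])
  have ne: "snd \<zeta> \<noteq> []"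
    using Z_length [OF \<zeta>] by auto
  have \<zeta>_eq: "\<zeta> = (tail Q (hd u), snd \<zeta>)"
    using qpath_eq_list_path [OF Z_qpaths [OF \<zeta>] ne] ne by (simp add: u_def list_path_def)
  define \<alpha> where "\<alpha> = (qtarget Q \<zeta>, q @ p)"
  have "(tail Q (hd u), snd \<zeta> @ (q @ p)) \<in> qpaths Q"
    using cu by (simp add: closed_walk_def walk_def u_def)
  then obtain \<alpha>: "\<alpha> \<in> qpaths Q" and t: "qtarget Q \<alpha> = qtarget Q (tail Q (hd u), snd \<zeta> @ (q @ p))"
    using qpaths_split [of "tail Q (hd u)" "snd \<zeta>" "q @ p"] \<zeta>_eq unfolding \<alpha>_def by metis
  have "qtarget Q (tail Q (hd u), snd \<zeta> @ (q @ p)) = qsource \<zeta>"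
    using cu \<zeta>_eq ne by (simp add: closed_walk_def qtarget_def u_def qsource_def) (metis fst_conv)
  then have comp: "qtarget Q \<zeta> = qsource \<alpha>" "qtarget Q \<alpha> = qsource \<zeta>"
    using t by (simp_all add: \<alpha>_def qsource_def)
  have "zero_path Q Z \<zeta>"
    using \<zeta> by (auto simp: zero_path_iff Z_qpaths zero_list_def)
  then have "frag_of (basis_elem d \<alpha>, basis_elem 1 \<zeta>) \<in> H"
    using basis_elem_zero_path [OF Z_qpaths [OF \<zeta>]] cong_zero_right [OF basis_elem_closed [OF \<alpha>]] by simp
  from add_subgroup_diff [OF cong_subgroup this pair_closed [OF \<alpha> Z_qpaths [OF \<zeta>] comp, of d]]
  have 1: "(\<Sum>i<length (snd \<zeta>). word_term d (rotate (Suc i) u)) \<in> H"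
    by (simp add: u_def \<alpha>_def)
  have 2: "word_term d (rotate (Suc i) u) \<in> H" if "length (snd \<zeta>) \<le> i" "i < length u" for i
  proof (rule word_term_closed_zero)
    show "closed_walk (rotate (Suc i) u)"
      using closed_walk_rotations [OF cu] rotate_in_rotations by blast
    show "zero_list (butlast (rotate (Suc i) u))"
      using sublist_butlast_rotate_prefix [of "snd \<zeta>" i "q @ p"] that \<zeta> unfolding zero_list_def u_def by force
  qed
  have "(\<Sum>i<length u. word_term d (rotate (Suc i) u)) =
      (\<Sum>i<length (snd \<zeta>). word_term d (rotate (Suc i) u)) +
      (\<Sum>i\<in>{length (snd \<zeta>)..<length u}. word_term d (rotate (Suc i) u))"
    by (subst sum.union_disjoint [symmetric]) (auto simp: u_def ivl_disj_un intro!: sum.cong)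
  also have "\<dots> \<in> H"
    by (intro add_subgroup_add [OF cong_subgroup 1] add_subgroup_sum [OF cong_subgroup] 2) auto
  finally have "(\<Sum>i<length u. word_term d (rotate (Suc i) u)) \<in> H" .
  then show ?thesis
    unfolding sum_rotate_Suc [OF closed_walk_ne [OF cu]]
    by (simp add: rotations_eq [OF u] multiplicity_rotations [OF u])
qed

lemma word_term_multiple:
  assumes "walk w"
  shows "word_term (of_nat m * d) w - (\<Sum>j<m. word_term d w) \<in> H"
proof (induction m)
  case (Suc m)
  from add_subgroup_add [OF cong_subgroup Suc word_term_add [OF assms, of "of_nat m * d" d]] show ?case
    by (simp add: algebra_simps)
qed (simp add: word_term_0 assms)

text \<open>Rotating forward through nonzero words, every word with nonzero \<open>butlast\<close>
  arrives at the only end word \<omega> and hence has its coefficient. All other words vanish, which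
  leaves a constant multiple of the sum over the distinct words.\<close>

lemma circuit_sum:
  assumes w: "closed_walk w" and zero: "\<exists>v\<in>rotations w. zero_list v"
    and ends: "\<exists>v\<in>rotations w. \<not> zero_list (butlast v) \<Longrightarrow>
      of_nat (multiplicity w) \<noteq> (0 :: 'k) \<and> (\<exists>!v. v \<in> rotations w \<and> end_walk v)"
    and c: "\<And>v. \<lbrakk>closed_walk v; \<not> zero_list v\<rbrakk> \<Longrightarrow> c (rotate1 v) = c v"
  shows "(\<Sum>v\<in>rotations w. word_term (c v) v) \<in> H"
proof (cases "\<exists>v\<in>rotations w. \<not> zero_list (butlast v)")
  case False
  then show ?thesis
    by (intro add_subgroup_sum [OF cong_subgroup] word_term_closed_zero closed_walk_rotations [OF w]) auto
next
  case True
  define m where "m = multiplicity w"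
  obtain \<omega> where m: "of_nat m \<noteq> (0 :: 'k)"
    and \<omega>: "\<omega> \<in> rotations w" "end_walk \<omega>" "\<And>v. v \<in> rotations w \<Longrightarrow> end_walk v \<Longrightarrow> v = \<omega>"
    using ends [OF True] unfolding m_def by blast
  have eq: "c v = c \<omega>" if v: "v \<in> rotations w" "\<not> zero_list (butlast v)" for v
  proof -
    obtain u where "u \<in> rotations v" "zero_list u"
      using zero rotations_eq [OF v(1)] by blast
    then obtain t where t: "end_walk (rotate t v)" "\<And>s. s < t \<Longrightarrow> \<not> zero_list (rotate s v)"
      using end_walk_exists [of v] v closed_walk_ne [OF closed_walk_rotations [OF w v(1)]] by metis
    \<comment> \<open>Only the words before step t have to be nonzero; the end word, though zero,
      still inherits the coefficient.\<close>
    have "c (rotate s v) = c v" if "s \<le> t" for s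
      using that
    proof (induction s)
      case (Suc s)
      have "closed_walk (rotate s v)"
        using closed_walk_rotations [OF w] rotations_trans [OF rotate_in_rotations v(1)] by blast
      then show ?case
        using c [of "rotate s v"] t(2) [of s] Suc by simp
    qed simp
    moreover have "rotate t v = \<omega>"
      using \<omega>(3) t(1) rotations_trans [OF rotate_in_rotations v(1)] by blast
    ultimately show ?thesis
      by (metis order_refl)
  qed
  \<comment> \<open>Division by the multiplicity turns the sum over distinct words into the sum over
    all rotations; here m has to be invertible in k.\<close>
  let ?d = "c \<omega> / of_nat m"
  have "(\<Sum>v\<in>rotations w. word_term (c v) v) - (\<Sum>v\<in>rotations w. \<Sum>j<m. word_term ?d v) \<in> H"
  proof (rule add_subgroup_sum_cong [OF cong_subgroup])
    fix v assume v: "v \<in> rotations w"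
    have cv: "closed_walk v"
      by (rule closed_walk_rotations [OF w v])
    show "word_term (c v) v - (\<Sum>j<m. word_term ?d v) \<in> H"
    proof (cases "zero_list (butlast v)")
      case True
      then show ?thesis
        by (intro add_subgroup_diff [OF cong_subgroup] add_subgroup_sum [OF cong_subgroup] word_term_closed_zero cv)
    next
      case False
      have "of_nat m * ?d = c v"
        using eq [OF v False] m by simp
      then show ?thesis
        using word_term_multiple [of v m ?d] cv by (simp add: closed_walk_def)
    qed
  qed
  moreover have "(\<Sum>v\<in>rotations w. \<Sum>j<m. word_term ?d v) \<in> H"
    using zero rotation_sum [OF w] unfolding m_def by blast
  ultimately show ?thesis
    using add_subgroup_cong_iff [OF cong_subgroup] by blast
qed

end

section \<open>Vanishing of the homology\<close>

context monomial_quiver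
begin

text \<open>The commutator of a cycle vanishes in every coordinate. Applied to the normal form, this
  kills the coefficients of nonzero open words and gives the constancy required by
  \<open>circuit_sum\<close>.\<close>

lemma trivial_homology_if:
  assumes zero: "\<And>w. closed_walk w \<Longrightarrow> \<exists>v\<in>rotations w. zero_list v"
    and ends: "\<And>w. \<lbrakk>closed_walk w; \<exists>v\<in>rotations w. \<not> zero_list (butlast v)\<rbrakk> \<Longrightarrow>
      of_nat (multiplicity w) \<noteq> (0 :: 'k) \<and> (\<exists>!v. v \<in> rotations w \<and> end_walk v)"
  shows "trivial_group (hochschild_homology A 1)"
proof (rule trivial_hochschild_homologyI)
  fix H0 z
  assume H0: "hochschild_congruence H0" and z: "Poly_Mapping.keys z \<subseteq> carrier A \<times> carrier A"
    and com: "\<And>h :: _ \<Rightarrow> 'k. (\<And>x y. \<lbrakk>x \<in> carrier A; y \<in> carrier A\<rbrakk> \<Longrightarrow> h (x \<oplus>\<^bsub>A\<^esub> y) = h x + h y) \<Longrightarrow>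
        frag_eval (\<lambda>(x, y). h (x \<otimes> y \<ominus> y \<otimes> x)) z = 0"
  \<comment> \<open>With the smaller congruence, z and its normal form have the same
    commutator.\<close>
  define H where "H = H0 \<inter> {z. \<forall>\<alpha>. \<not> zero_path Q Z \<alpha> \<longrightarrow> commutator_coordinate \<alpha> z = 0}"
  interpret monomial_congruence Q Z A H
    by unfold_locales (unfold H_def, rule hochschild_congruence_commutators [OF H0])
  have "z \<in> word_span"
    using z by (induction rule: frag_induction)
      (auto intro: tensor_span add_subgroup_zero [OF add_subgroup_word_span] add_subgroup_diff [OF add_subgroup_word_span])
  then obtain c K where K: "finite K" "K \<subseteq> Collect walk" and c0: "\<And>w. w \<notin> K \<Longrightarrow> c w = 0"
    and zH: "z - (\<Sum>w\<in>K. word_term (c w) w) \<in> H"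
    unfolding word_span_def by blast
  let ?D = "\<Sum>w\<in>K. word_term (c w) w"
  have coord: "(\<Sum>w\<in>K. commutator_coordinate \<alpha> (word_term (c w) w)) = 0" if \<alpha>: "\<not> zero_path Q Z \<alpha>" for \<alpha>
  proof -
    have "commutator_coordinate \<alpha> z = 0"
      unfolding commutator_coordinate_def by (rule com) (rule coordinate_add [OF \<alpha>])
    moreover have "commutator_coordinate \<alpha> (z - ?D) = 0"
      using IntD2 [OF zH [unfolded H_def]] \<alpha> by blast
    ultimately show ?thesis
      by (simp add: additive.diff [OF additive_commutator_coordinate] additive.sum [OF additive_commutator_coordinate])
  qed
  have delta: "(\<Sum>v\<in>K. if v = u then c v else 0) = c u" for u
    using c0 [of u] by (simp add: sum.delta [OF K(1)])
  \<comment> \<open>No closed word contributes to the coordinate at an open word, as rotations of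
    closed words are closed.\<close>
  have open_zero: "c w = 0" if w: "walk w" "\<not> closed_walk w" "\<not> zero_list w" for w
  proof -
    have \<alpha>: "\<not> zero_path Q Z (list_path w)"
      using w by (simp add: zero_path_list_path)
    have "commutator_coordinate (list_path w) (word_term (c v) v) = (if v = w then c v else 0)" if "v \<in> K" for v
    proof (cases "closed_walk v")
      case True
      have "w \<noteq> v" "w \<noteq> rotate_back v"
        using True closed_walk_rotate_back w(2) by auto
      then show ?thesis
        by (simp add: commutator_coordinate_closed [OF \<alpha> True])
    next
      case False
      then show ?thesis
        using commutator_coordinate_open [OF \<alpha> _ False] that K by auto
    qed
    then show ?thesis
      using coord [OF \<alpha>] delta [of w] by (simp cong: sum.cong)
  qed
  \<comment> \<open>Two words contribute to the coordinate at w: w itself with a minus sign, and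
    \<open>rotate1 w\<close>, whose backward rotation is w.\<close>
  have closed_const: "c (rotate1 w) = c w" if w: "closed_walk w" "\<not> zero_list w" for w
  proof -
    have \<alpha>: "\<not> zero_path Q Z (list_path w)"
      using w by (simp add: zero_path_list_path closed_walk_def)
    have "commutator_coordinate (list_path w) (word_term (c v) v) =
        (if v = rotate1 w then c v else 0) - (if v = w then c v else 0)" if "v \<in> K" for v
    proof (cases "closed_walk v")
      case True
      have "w = rotate_back v \<longleftrightarrow> v = rotate1 w"
        using rotate_back_eq_iff [of v w] closed_walk_ne [OF True] closed_walk_ne [OF w(1)] by auto
      then show ?thesis
        by (simp add: commutator_coordinate_closed [OF \<alpha> True] eq_commute)
    next
      case False
      then have "v \<noteq> w" "v \<noteq> rotate1 w"
        using w closed_walk_rotate1 by auto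
      then show ?thesis
        using commutator_coordinate_open [OF \<alpha> _ False] that K by auto
    qed
    then have "c (rotate1 w) - c w = 0"
      using coord [OF \<alpha>] delta [of w] delta [of "rotate1 w"] by (simp add: sum_subtractf cong: sum.cong)
    then show ?thesis
      by simp
  qed
  let ?Kc = "{w \<in> K. closed_walk w}" and ?Ko = "{w \<in> K. \<not> closed_walk w}"
  have "?D = (\<Sum>w\<in>?Kc. word_term (c w) w) + (\<Sum>w\<in>?Ko. word_term (c w) w)"
    using K(1) by (subst sum.union_disjoint [symmetric]) (auto intro!: sum.cong)
  moreover have "(\<Sum>w\<in>?Ko. word_term (c w) w) \<in> H"
  proof (rule add_subgroup_sum [OF cong_subgroup])
    fix w assume "w \<in> ?Ko"
    then have w: "walk w" "\<not> closed_walk w"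
      using K(2) by auto
    show "word_term (c w) w \<in> H"
      using word_term_open_zero [OF w] open_zero [OF w] word_term_0 [OF w(1)] by (cases "zero_list w") auto
  qed
  moreover have "(\<Sum>w\<in>?Kc. word_term (c w) w) \<in> H"
  proof -
    \<comment> \<open>The index set is saturated under rotation so that the sum splits into
      circuits; the added words have coefficient 0.\<close>
    let ?R = "\<Union> (rotations ` ?Kc)"
    have R: "finite ?R" "?Kc \<subseteq> ?R" "\<And>w. w \<in> ?R \<Longrightarrow> closed_walk w"
      using K(1) by (auto simp: finite_rotations intro: closed_walk_rotations)
    have "(\<Sum>w\<in>?R. word_term (c w) w) - (\<Sum>w\<in>?Kc. word_term (c w) w) = (\<Sum>w\<in>?R - ?Kc. word_term (c w) w)"
      by (rule sum_diff [symmetric, OF R(1,2)])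
    also have "\<dots> \<in> H"
    proof (rule add_subgroup_sum [OF cong_subgroup])
      fix w assume "w \<in> ?R - ?Kc"
      then have "c w = 0" "walk w"
        using R(3) [of w] c0 [of w] by (auto simp: closed_walk_def)
      then show "word_term (c w) w \<in> H"
        by (simp add: word_term_0)
    qed
    finally have 1: "(\<Sum>w\<in>?R. word_term (c w) w) - (\<Sum>w\<in>?Kc. word_term (c w) w) \<in> H" .
    have "(\<Sum>w\<in>?R. word_term (c w) w) = (\<Sum>C\<in>rotations ` ?Kc. \<Sum>w\<in>C. word_term (c w) w)"
    proof -
      have "C \<inter> D = {}" if "C \<in> rotations ` ?Kc" "D \<in> rotations ` ?Kc" "C \<noteq> D" for C D
        using that rotations_eq by blast
      then have "sum (\<lambda>w. word_term (c w) w) (\<Union> (rotations ` ?Kc)) =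
          (sum \<circ> sum) (\<lambda>w. word_term (c w) w) (rotations ` ?Kc)"
        by (intro sum.Union_disjoint) (auto simp: finite_rotations)
      then show ?thesis
        by simp
    qed
    also have "\<dots> \<in> H"
    proof (rule add_subgroup_sum [OF cong_subgroup])
      fix C assume "C \<in> rotations ` ?Kc"
      then obtain w where w: "closed_walk w" "C = rotations w"
        by auto
      show "(\<Sum>w\<in>C. word_term (c w) w) \<in> H"
        unfolding w(2)
        by (rule circuit_sum [OF w(1) zero [OF w(1)]]) (rule ends [OF w(1)], assumption, rule closed_const)
    qed
    finally show ?thesis
      using 1 add_subgroup_diff [OF cong_subgroup] by fastforce
  qed
  ultimately have "?D \<in> H"
    using add_subgroup_add [OF cong_subgroup] by simp
  then have "z \<in> H"
    using zH add_subgroup_cong_iff [OF cong_subgroup] by blast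
  then show "z \<in> H0"
    by (simp add: H_def)
qed

text \<open>
  The cocycle \<open>(\<alpha>, b\<^sub>n \<dots> b\<^sub>1) \<mapsto> \<Sum>i. W (b\<^sub>i b\<^bsub>i-1\<^esub> \<dots> b\<^sub>1 \<alpha> b\<^sub>n \<dots> b\<^bsub>i+1\<^esub>)\<close>, i.e. the derivation of \<open>A\<close>
  into its dual whose values on the arrows are given by the weight \<open>W\<close> of words.
\<close>

definition cochain :: "('e list \<Rightarrow> 'k) \<Rightarrow> ('v, 'e) qpath \<Rightarrow> ('v, 'e) qpath \<Rightarrow> 'k" where
  "cochain W \<alpha> \<beta> =
     (if qtarget Q \<beta> = qsource \<alpha> \<and> qtarget Q \<alpha> = qsource \<beta>
      then \<Sum>i<length (snd \<beta>). W (rotate (Suc i) (snd \<beta> @ snd \<alpha>)) else 0)"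

text \<open>All three values are partial sums over the rotations of the one cyclic word
  \<alpha>\<beta>\<gamma>, cut at the arrows of \<gamma>, of \<beta>, and of both.\<close>

lemma cochain_cocycle:
  assumes "qtarget Q \<beta> = qsource \<alpha>" "qtarget Q \<gamma> = qsource \<beta>" "qtarget Q \<alpha> = qsource \<gamma>"
  shows "cochain W (qconcat \<alpha> \<beta>) \<gamma> + cochain W (qconcat \<gamma> \<alpha>) \<beta> = cochain W \<alpha> (qconcat \<beta> \<gamma>)"
proof -
  let ?v = "snd \<gamma> @ snd \<beta> @ snd \<alpha>"
  have *: "snd \<beta> @ (snd \<alpha> @ snd \<gamma>) = rotate (length (snd \<gamma>)) ?v"
    using rotate_append [of "snd \<gamma>" "snd \<beta> @ snd \<alpha>"] by simp
  have 1: "cochain W (qconcat \<alpha> \<beta>) \<gamma> = (\<Sum>i<length (snd \<gamma>). W (rotate (Suc i) ?v))"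
    using assms by (simp add: cochain_def qtarget_qconcat) (simp add: qconcat_def)
  have 2: "cochain W (qconcat \<gamma> \<alpha>) \<beta> = (\<Sum>i<length (snd \<beta>). W (rotate (Suc i) (rotate (length (snd \<gamma>)) ?v)))"
    using assms by (simp add: cochain_def qtarget_qconcat) (simp add: qconcat_def flip: *)
  have 3: "cochain W \<alpha> (qconcat \<beta> \<gamma>) = (\<Sum>i<length (snd \<gamma>) + length (snd \<beta>). W (rotate (Suc i) ?v))"
    using assms by (simp add: cochain_def qtarget_qconcat) (simp add: qconcat_def)
  have split: "(\<Sum>i<m + n. g i) = (\<Sum>i<m. g i) + (\<Sum>i<n. g (m + i))" for m n and g :: "nat \<Rightarrow> 'k"
    by (induction n) (simp_all add: add.assoc)
  show ?thesis
    unfolding 1 2 3 split rotate_rotate by (simp add: add.commute [of "length (snd \<gamma>)"])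
qed

text \<open>The commutators of the arrows with their complements along \<open>r + 1\<close> consecutive rotations telescope.\<close>

lemma trivial_homology_cochain:
  fixes W :: "'e list \<Rightarrow> 'k"
  assumes triv: "trivial_group (hochschild_homology A 1)"
    and W_butlast: "\<And>w. zero_list (butlast w) \<Longrightarrow> W w = 0"
    and W_sum: "\<And>v. \<lbrakk>closed_walk v; zero_list v\<rbrakk> \<Longrightarrow> (\<Sum>i<length v. W (rotate (Suc i) v)) = 0"
    and w: "closed_walk w"
    and cycle: "basis_elem 1 (list_path ((rotate_back ^^ Suc r) w)) = basis_elem 1 (list_path w)"
  shows "(\<Sum>i\<le>r. W ((rotate_back ^^ i) w)) = 0"
proof -
  let ?f = "cochain W"
  \<comment> \<open>This makes the form descend to A. If \<alpha> is zero, every word is cut outside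
    \<alpha> and has weight 0. If \<beta> is zero, the words cut outside \<beta> have weight 0, so
    the sum may be completed to all rotations and vanishes by \<open>W_sum\<close>.\<close>
  have f_zero: "?f \<alpha> \<beta> = 0"
    if \<alpha>\<beta>: "\<alpha> \<in> qpaths Q" "\<beta> \<in> qpaths Q" and zero: "zero_path Q Z \<alpha> \<or> zero_path Q Z \<beta>" for \<alpha> \<beta>
  proof (cases "qtarget Q \<beta> = qsource \<alpha> \<and> qtarget Q \<alpha> = qsource \<beta> \<and> snd \<beta> \<noteq> []")
    case False
    then show ?thesis
      by (auto simp: cochain_def)
  next
    case True
    let ?v = "snd \<beta> @ snd \<alpha>"
    have v: "closed_walk ?v"
      using True \<alpha>\<beta> by (intro qconcat_closed_walk) auto
    show ?thesis
    proof (cases "zero_list (snd \<alpha>)")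
      case True
      have "W (rotate (Suc i) ?v) = 0" if "i < length (snd \<beta>)" for i
        using sublist_butlast_rotate_suffix [OF that, of "snd \<alpha>"] True zero_list_sublist W_butlast by blast
      then show ?thesis
        by (simp add: cochain_def)
    next
      case False
      then have \<beta>: "zero_list (snd \<beta>)"
        using zero \<alpha>\<beta> by (simp add: zero_path_iff)
      then have "zero_list ?v"
        by (rule zero_list_sublist) simp
      then have 0: "(\<Sum>i<length ?v. W (rotate (Suc i) ?v)) = 0"
        by (rule W_sum [OF v])
      have "W (rotate (Suc i) ?v) = 0" if "length (snd \<beta>) \<le> i" "i < length ?v" for i
        using sublist_butlast_rotate_prefix [of "snd \<beta>" i "snd \<alpha>"] that \<beta> zero_list_sublist W_butlast by auto
      then have "(\<Sum>i<length (snd \<beta>). W (rotate (Suc i) ?v)) = (\<Sum>i<length ?v. W (rotate (Suc i) ?v))"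
        by (intro sum.mono_neutral_left) auto
      then show ?thesis
        using 0 by (simp add: cochain_def)
    qed
  qed
  let ?F = "bilinear_extension ?f"
  note F = bilinear_extension_add_left [where f = ?f, OF f_zero] bilinear_extension_add_right [where f = ?f, OF f_zero]
  note F_basis = bilinear_extension_basis [where f = ?f, OF f_zero]
  have F_0: "?F \<zero> y = 0" "?F y \<zero> = 0" if "y \<in> carrier A" for y
  proof -
    have "?F \<zero> y = ?F \<zero> y + ?F \<zero> y" "?F y \<zero> = ?F y \<zero> + ?F y \<zero>"
      using F(1) [of \<zero> \<zero> y] F(2) [of y \<zero> \<zero>] that by (simp_all only: l_zero zero_closed)
    then show "?F \<zero> y = 0" "?F y \<zero> = 0"
      by (metis add.right_neutral add_left_cancel)+
  qed
  have F_smult: "?F (c \<odot> x) y = ?F x (c \<odot> y)" if "x \<in> carrier A" "y \<in> carrier A" for c x y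
    using that(1)
  proof (induction x rule: A_induct)
    case (basis d \<alpha>)
    show ?case
      using that(2)
    proof (induction y rule: A_induct)
      case (basis e \<beta>)
      then show ?case
        using \<open>\<alpha> \<in> qpaths Q\<close> by (simp add: basis_elem_smult F_basis)
    qed (use basis in \<open>simp_all add: smult_zero_A F F_0 smult_add_A smult_closed basis_elem_closed\<close>)
  qed (use that in \<open>simp_all add: smult_zero_A F F_0 smult_add_A smult_closed\<close>)
  have F_cocycle: "?F (x \<otimes> y) z + ?F (z \<otimes> x) y = ?F x (y \<otimes> z)"
    if "x \<in> carrier A" "y \<in> carrier A" "z \<in> carrier A" for x y z
    using that(1)
  proof (induction x rule: A_induct)
    case (basis c \<alpha>)
    note \<alpha> = this
    show ?case
      using that(2)
    proof (induction y rule: A_induct)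
      case (basis d \<beta>)
      note \<beta> = this
      show ?case
        using that(3)
      proof (induction z rule: A_induct)
        case (basis e \<gamma>)
        note \<gamma> = this
        consider (all) "qtarget Q \<beta> = qsource \<alpha>" "qtarget Q \<gamma> = qsource \<beta>" "qtarget Q \<alpha> = qsource \<gamma>"
          | (none) "\<not> (qtarget Q \<beta> = qsource \<alpha> \<and> qtarget Q \<gamma> = qsource \<beta> \<and> qtarget Q \<alpha> = qsource \<gamma>)"
          by blast
        then show ?case
        proof cases
          case all
          have "?F (basis_elem c \<alpha> \<otimes> basis_elem d \<beta>) (basis_elem e \<gamma>) = c * d * e * ?f (qconcat \<alpha> \<beta>) \<gamma>"
            "?F (basis_elem e \<gamma> \<otimes> basis_elem c \<alpha>) (basis_elem d \<beta>) = c * d * e * ?f (qconcat \<gamma> \<alpha>) \<beta>"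
            "?F (basis_elem c \<alpha>) (basis_elem d \<beta> \<otimes> basis_elem e \<gamma>) = c * d * e * ?f \<alpha> (qconcat \<beta> \<gamma>)"
            using all \<alpha> \<beta> \<gamma> by (simp_all add: basis_elem_mult F_basis qpaths_qconcat)
          then show ?thesis
            using cochain_cocycle [OF all, of W] by (simp flip: distrib_left)
        next
          \<comment> \<open>Each of the three terms requires all three compatibilities, either for
            its product or in \<open>cochain\<close>.\<close>
          case none
          have "?F (basis_elem c \<alpha> \<otimes> basis_elem d \<beta>) (basis_elem e \<gamma>) = 0"
            using none \<alpha> \<beta> \<gamma>
            by (auto simp: basis_elem_mult F_basis F_0 basis_elem_closed qpaths_qconcat cochain_def qtarget_qconcat)
          moreover have "?F (basis_elem e \<gamma> \<otimes> basis_elem c \<alpha>) (basis_elem d \<beta>) = 0"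
            using none \<alpha> \<beta> \<gamma>
            by (auto simp: basis_elem_mult F_basis F_0 basis_elem_closed qpaths_qconcat cochain_def qtarget_qconcat)
          moreover have "?F (basis_elem c \<alpha>) (basis_elem d \<beta> \<otimes> basis_elem e \<gamma>) = 0"
            using none \<alpha> \<beta> \<gamma>
            by (auto simp: basis_elem_mult F_basis F_0 basis_elem_closed qpaths_qconcat cochain_def qtarget_qconcat)
          ultimately show ?thesis
            by simp
        qed
      qed (use \<alpha> \<beta> in \<open>simp_all add: F F_0 basis_elem_closed l_distr r_distr algebra_simps\<close>)
    qed (use \<alpha> that in \<open>simp_all add: F F_0 basis_elem_closed l_distr r_distr algebra_simps\<close>)
  qed (use that in \<open>simp_all add: F F_0 l_distr r_distr algebra_simps\<close>)
  \<comment> \<open>Walking backwards makes each commutator the difference of two successive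
    words.\<close>
  define v where "v = (\<lambda>i. (rotate_back ^^ i) w)"
  have v: "closed_walk (v i)" for i
    by (induction i) (simp_all add: v_def w closed_walk_rotate_back)
  have v_Suc: "v (Suc i) = rotate_back (v i)" for i
    by (simp add: v_def)
  let ?x = "\<lambda>i. basis_elem 1 (coarrow (v i))" and ?y = "\<lambda>i. basis_elem 1 (arrow (last (v i)))"
    and ?e = "\<lambda>i. basis_elem 1 (list_path (v i))"
  note co = closed_walk_coarrow [OF v]
  have e: "?e i \<in> carrier A" for i
    using v [of i] by (intro basis_elem_closed walk_list_path) (simp add: closed_walk_def)
  have xy: "?x i \<in> carrier A" "?y i \<in> carrier A" for i
    using co [of i] by (auto intro!: basis_elem_closed arrow_path)
  have "?x i \<otimes> ?y i \<ominus> ?y i \<otimes> ?x i = ?e (Suc i) \<ominus> ?e i" for i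
    using co [of i] arrow_path [OF co(1), of i] by (simp add: basis_elem_mult v_Suc)
  then have "(\<Oplus>\<^bsub>A\<^esub>i\<in>{..r}. ?x i \<otimes> ?y i \<ominus> ?y i \<otimes> ?x i) = (\<Oplus>\<^bsub>A\<^esub>i\<in>{..r}. ?e (Suc i) \<ominus> ?e i)"
    by simp
  also have "\<dots> = ?e (Suc r) \<ominus> ?e 0"
    by (rule finsum_telescope) (rule e)
  also have "\<dots> = \<zero>"
    using cycle e [of 0] by (simp add: v_def minus_eq r_neg)
  finally have "(\<Sum>i\<in>{..r}. ?F (?x i) (?y i)) = 0"
    using xy F F_smult F_cocycle
    by (intro hochschild_cocycle_vanishes [OF triv, where f = ?F]) auto
  moreover have "?F (?x i) (?y i) = W (v i)" for i
  proof -
    have "rotate1 (snd (arrow (last (v i))) @ snd (coarrow (v i))) = v i"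
      using rotate1_rotate_back [OF closed_walk_ne [OF v]] by (simp add: arrow_def coarrow_def rotate_back_def)
    moreover have "length (snd (arrow (last (v i)))) = 1"
      by (simp add: arrow_def)
    ultimately have "?f (coarrow (v i)) (arrow (last (v i))) = W (v i)"
      using co [of i] by (simp add: cochain_def)
    then show ?thesis
      using co [of i] arrow_path [OF co(1), of i] by (simp add: F_basis)
  qed
  ultimately show ?thesis
    by (simp add: v_def)
qed

section \<open>Necessity of the conditions: test weights on words\<close>

lemma sum_rotate_indicator:
  assumes "v \<noteq> []"
  shows "(\<Sum>i<length v. if rotate (Suc i) v = u then 1 else 0) =
    (if u \<in> rotations v then of_nat (multiplicity v) else (0 :: 'k))"
  using sum_rotate_Suc [OF assms, of "\<lambda>w. if w = u then 1 else (0 :: 'k)"]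
  by (simp add: if_distrib [of "\<lambda>x. of_nat (multiplicity v) * x"] sum.delta finite_rotations cong: if_cong)

text \<open>The weight is the indicator of w, and the test chain runs backwards once around the
  period, meeting w exactly once. No zero word is a rotation of w, so the weight is
  admissible.\<close>

lemma trivial_homology_zero_cycle:
  assumes triv: "trivial_group (hochschild_homology A 1)" and w: "closed_walk w"
  shows "\<exists>v\<in>rotations w. zero_list v"
proof (rule ccontr)
  assume "\<not> ?thesis"
  then have nz: "\<not> zero_list v" if "v \<in> rotations w" for v
    using that by blast
  let ?W = "\<lambda>v. if v = w then 1 else (0 :: 'k)"
  note ne = closed_walk_ne [OF w]
  \<comment> \<open>One period, consisting of l + 1 backward steps; a turn by the whole length would
    count w with its multiplicity, which may vanish in k.\<close>
  define l where "l = (LEAST l. (rotate_back ^^ Suc l) w = w)"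
  have "\<exists>l. (rotate_back ^^ Suc l) w = w"
    using rotate_back_power_rotate [OF ne, of "length w"] ne by (intro exI [of _ "length w - 1"]) simp
  then have l: "(rotate_back ^^ Suc l) w = w"
    unfolding l_def by (rule LeastI_ex)
  have "(\<Sum>i\<le>l. ?W ((rotate_back ^^ i) w)) = 0"
  proof (rule trivial_homology_cochain [OF triv _ _ w])
    show "?W v = 0" if "zero_list (butlast v)" for v
      using that nz [of w] zero_list_sublist [of "butlast v" v] sublist_appendI [of "butlast v" "[]" "[last v]"]
      by (cases "v = []") auto
    show "(\<Sum>i<length v. ?W (rotate (Suc i) v)) = 0" if "closed_walk v" "zero_list v" for v
      using sum_rotate_indicator [OF closed_walk_ne [OF that(1)], of w] nz [of v] that rotations_sym [of w v] by auto
  qed (simp only: l)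
  moreover have "(\<Sum>i\<le>l. ?W ((rotate_back ^^ i) w)) = (\<Sum>i\<le>l. if i = 0 then 1 else 0)"
  proof (rule sum.cong [OF refl])
    fix i assume "i \<in> {..l}"
    then show "?W ((rotate_back ^^ i) w) = (if i = 0 then 1 else 0)"
      using not_less_Least [of "i - 1" "\<lambda>l. (rotate_back ^^ Suc l) w = w"]
      unfolding l_def [symmetric] by (cases i) auto
  qed
  ultimately show False
    by simp
qed

text \<open>The test chain starts at the zero word \<omega> and runs backwards to the next zero
  word, so its commutators telescope to zero. The words in between are nonzero and hence not in
  \<Omega>, so the weight sees \<omega> alone. The condition on g makes the weight vanish on full
  rotation sums.\<close>

lemma trivial_homology_end_walks:
  assumes triv: "trivial_group (hochschild_homology A 1)" and \<omega>: "closed_walk \<omega>" "end_walk \<omega>"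
    and \<Omega>: "finite \<Omega>" "\<Omega> \<subseteq> Collect end_walk" "\<omega> \<in> \<Omega>"
    and g: "g \<omega> = 1" "\<And>v. closed_walk v \<Longrightarrow> (\<Sum>u\<in>\<Omega>. if u \<in> rotations v then g u * of_nat (multiplicity v) else 0) = (0 :: 'k)"
  shows False
proof -
  let ?W = "\<lambda>v. if v \<in> \<Omega> then g v else (0 :: 'k)"
  note ne = closed_walk_ne [OF \<omega>(1)]
  define r where "r = (LEAST r. zero_list ((rotate_back ^^ Suc r) \<omega>))"
  have "(rotate_back ^^ Suc (length \<omega> - 1)) \<omega> = \<omega>"
    using rotate_back_power_rotate [OF ne, of "length \<omega>"] ne by simp
  then have "\<exists>r. zero_list ((rotate_back ^^ Suc r) \<omega>)"
    using \<omega>(2) by (intro exI [of _ "length \<omega> - 1"]) (simp only: end_walk_def)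
  then have r: "zero_list ((rotate_back ^^ Suc r) \<omega>)"
    unfolding r_def by (rule LeastI_ex)
  have closed: "closed_walk ((rotate_back ^^ i) \<omega>)" for i
    by (induction i) (simp_all add: \<omega> closed_walk_rotate_back)
  have zero: "basis_elem 1 (list_path v) = \<zero>" if "closed_walk v" "zero_list v" for v
    using that by (intro basis_elem_zero_path) (auto simp: closed_walk_def walk_list_path zero_path_list_path)
  have W_eq: "?W v = (\<Sum>u\<in>\<Omega>. g u * (if v = u then 1 else 0))" for v
    using \<Omega>(1) by (simp add: if_distrib [of "\<lambda>x. g _ * x"] sum.delta cong: if_cong)
  have "(\<Sum>i\<le>r. ?W ((rotate_back ^^ i) \<omega>)) = 0"
  proof (rule trivial_homology_cochain [OF triv _ _ \<omega>(1)])
    show "?W v = 0" if "zero_list (butlast v)" for v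
      using that \<Omega>(2) by (auto simp: end_walk_def)
    show "(\<Sum>i<length v. ?W (rotate (Suc i) v)) = 0" if "closed_walk v" "zero_list v" for v
    proof -
      have "(\<Sum>i<length v. ?W (rotate (Suc i) v)) =
          (\<Sum>u\<in>\<Omega>. g u * (\<Sum>i<length v. if rotate (Suc i) v = u then 1 else 0))"
        unfolding W_eq sum_distrib_left by (rule sum.swap)
      also have "\<dots> = (\<Sum>u\<in>\<Omega>. if u \<in> rotations v then g u * of_nat (multiplicity v) else 0)"
        unfolding sum_rotate_indicator [OF closed_walk_ne [OF that(1)]] by (intro sum.cong) auto
      finally show ?thesis
        using g(2) [OF that(1)] by simp
    qed
    show "basis_elem 1 (list_path ((rotate_back ^^ Suc r) \<omega>)) = basis_elem 1 (list_path \<omega>)"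
      using zero [OF closed r] zero [OF \<omega>(1)] \<omega>(2) by (simp add: end_walk_def)
  qed
  moreover have "(\<Sum>i\<le>r. ?W ((rotate_back ^^ i) \<omega>)) = (\<Sum>i\<le>r. if i = 0 then 1 else 0)"
  proof (rule sum.cong [OF refl])
    fix i assume i: "i \<in> {..r}"
    show "?W ((rotate_back ^^ i) \<omega>) = (if i = 0 then 1 else 0)"
    proof (cases i)
      case 0
      then show ?thesis
        using \<Omega>(3) g(1) by simp
    next
      case (Suc j)
      then have "\<not> zero_list ((rotate_back ^^ i) \<omega>)"
        using not_less_Least [of j "\<lambda>r. zero_list ((rotate_back ^^ Suc r) \<omega>)"] i
        unfolding r_def [symmetric] by simp
      then have "(rotate_back ^^ i) \<omega> \<notin> \<Omega>"
        using \<Omega>(2) by (auto simp: end_walk_def)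
      then show ?thesis
        using Suc by simp
    qed
  qed
  ultimately show False
    by simp
qed

lemma trivial_homology_multiplicity:
  assumes triv: "trivial_group (hochschild_homology A 1)" and w: "closed_walk w"
    and nz: "\<exists>v\<in>rotations w. \<not> zero_list (butlast v)"
  shows "of_nat (multiplicity w) \<noteq> (0 :: 'k) \<and> (\<exists>!v. v \<in> rotations w \<and> end_walk v)"
proof -
  obtain v where v: "v \<in> rotations w" "\<not> zero_list (butlast v)"
    using nz by blast
  have cv: "closed_walk v"
    by (rule closed_walk_rotations [OF w v(1)])
  obtain u where "u \<in> rotations v" "zero_list u"
    using trivial_homology_zero_cycle [OF triv cv] by blast
  then obtain t where "end_walk (rotate t v)"
    using end_walk_exists [of v u] closed_walk_ne [OF cv] v(2) by metis
  then obtain \<omega> where \<omega>: "\<omega> \<in> rotations w" "end_walk \<omega>"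
    using rotations_trans [OF rotate_in_rotations v(1)] by blast
  have c\<omega>: "closed_walk \<omega>"
    by (rule closed_walk_rotations [OF w \<omega>(1)])
  have mult: "multiplicity u = multiplicity w" if "\<omega> \<in> rotations u" for u
    using that \<omega>(1) multiplicity_rotations by metis
  have "of_nat (multiplicity w) \<noteq> (0 :: 'k)"
  proof
    assume "of_nat (multiplicity w) = (0 :: 'k)"
    then have "of_nat (multiplicity u) = (0 :: 'k)" if "\<omega> \<in> rotations u" for u
      using mult [OF that] by simp
    \<comment> \<open>If the multiplicity vanishes in k, the indicator of \<omega> is already an
      admissible weight.\<close>
    then show False
      using \<omega>(2) by (intro trivial_homology_end_walks [OF triv c\<omega> \<omega>(2), of "{\<omega>}" "\<lambda>_. 1"]) auto
  qed
  moreover have "\<omega>' = \<omega>" if \<omega>': "\<omega>' \<in> rotations w" "end_walk \<omega>'" for \<omega>'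
  proof (rule ccontr)
    assume "\<omega>' \<noteq> \<omega>"
    moreover have "\<omega>' \<in> rotations v \<longleftrightarrow> \<omega> \<in> rotations v" for v
      using rotations_eq [OF \<omega>(1)] rotations_eq [OF \<omega>'(1)] rotations_eq rotations_self by metis
    \<comment> \<open>Opposite weights on two end words of one circuit cancel in every rotation sum,
      whatever the multiplicity.\<close>
    ultimately show False
      using \<omega>(2) \<omega>'(2) by (intro trivial_homology_end_walks [OF triv c\<omega> \<omega>(2), of "{\<omega>, \<omega>'}" "\<lambda>v. if v = \<omega> then 1 else - 1"]) auto
  qed
  ultimately show ?thesis
    using \<omega> by blast
qed

section \<open>From words back to circuits\<close>

lemma trivial_homology_iff:
  "trivial_group (hochschild_homology A 1) \<longleftrightarrow>
     (\<forall>w. closed_walk w \<longrightarrow> (\<exists>v\<in>rotations w. zero_list v)) \<and>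
     (\<forall>w. closed_walk w \<longrightarrow> (\<exists>v\<in>rotations w. \<not> zero_list (butlast v)) \<longrightarrow>
       of_nat (multiplicity w) \<noteq> (0 :: 'k) \<and> (\<exists>!v. v \<in> rotations w \<and> end_walk v))"
  (is "_ \<longleftrightarrow> ?zero \<and> ?ends")
proof
  assume "trivial_group (hochschild_homology A 1)"
  then show "?zero \<and> ?ends"
    using trivial_homology_zero_cycle trivial_homology_multiplicity by simp
next
  assume "?zero \<and> ?ends"
  then show "trivial_group (hochschild_homology A 1)"
    by (intro trivial_homology_if) simp_all
qed

text \<open>The first zero word met in rotating forward from a word with nonzero
  \<open>butlast\<close> is an end word and yields a pair. This links the condition on circuits to
  the one on words.\<close>

lemma odot_relations_nonempty:
  assumes w: "closed_walk w" and zero: "\<exists>v\<in>rotations w. zero_list v"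
    and nz: "\<exists>v\<in>rotations w. \<not> zero_list (butlast v)"
  shows "odot_circuit Q Z (nonzero_paths Q Z) (list_path ` rotations w) \<noteq> {}"
proof -
  obtain v where v: "v \<in> rotations w" "\<not> zero_list (butlast v)"
    using nz by blast
  obtain u where "u \<in> rotations v" "zero_list u"
    using zero rotations_eq [OF v(1)] by blast
  then obtain t where "end_walk (rotate t v)"
    using end_walk_exists [of v u] closed_walk_ne [OF closed_walk_rotations [OF w v(1)]] v(2) by metis
  then obtain \<xi> \<beta> where "sole_relation \<xi> \<beta> (rotations w)"
    using end_walk_sole_relation [OF w rotations_trans [OF rotate_in_rotations v(1)]] by metis
  then show ?thesis
    by (auto simp: sole_relation_def)
qed

text \<open>A pair containing an arrow composes to a cycle of positive length, whereas a trivial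
  circuit contains only paths of length 0.\<close>

lemma odot_arrows_trivial:
  assumes "C = rotation_equiv Q `` {(v, [])}"
  shows "odot_circuit Q (qarrows Q) (nonzero_paths Q Z) C = {}"
  using trivial_circuit_vertices unfolding assms
  by (fastforce simp: odot_circuit_def odot_def qarrows_def qconcat_def)

lemma trivial_homology_circuits:
  "trivial_group (hochschild_homology A 1) \<longleftrightarrow>
     (\<forall>C\<in>circuits Q. \<not> trivial_circuit Q C \<longrightarrow> (\<exists>\<gamma>\<in>C. zero_path Q Z \<gamma>)) \<and>
     (\<forall>C\<in>circuits Q.
        odot_circuit Q (qarrows Q) (nonzero_paths Q Z) C \<noteq> {} \<and> odot_circuit Q Z (nonzero_paths Q Z) C \<noteq> {} \<longrightarrow>
        \<not> CHAR('k) dvd circuit_multiplicity Q C \<and>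
        (\<exists>!(\<xi>, \<beta>). (\<xi>, \<beta>) \<in> odot_circuit Q Z (nonzero_paths Q Z) C \<and> no_other_zero_relation Q Z \<xi> \<beta>))"
    (is "_ \<longleftrightarrow> (\<forall>C\<in>circuits Q. \<not> trivial_circuit Q C \<longrightarrow> ?zero C) \<and>
      (\<forall>C\<in>circuits Q. ?arrows C \<and> ?relations C \<longrightarrow> \<not> CHAR('k) dvd circuit_multiplicity Q C \<and> ?unique C)")
proof -
  let ?L = "\<lambda>w. list_path ` rotations w"
  let ?nz = "\<lambda>w. \<exists>v\<in>rotations w. \<not> zero_list (butlast v)" and ?z = "\<lambda>w. \<exists>v\<in>rotations w. zero_list v"
  have 1: "(\<forall>C\<in>circuits Q. \<not> trivial_circuit Q C \<longrightarrow> ?zero C) \<longleftrightarrow> (\<forall>w. closed_walk w \<longrightarrow> ?z w)"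
  proof (intro iffI ballI allI impI)
    fix w assume *: "\<forall>C\<in>circuits Q. \<not> trivial_circuit Q C \<longrightarrow> ?zero C" and "closed_walk w"
    have "?zero (?L w)"
      by (rule *[rule_format, OF list_path_circuits not_trivial_circuit]) fact+
    then show "?z w"
      by (rule iffD1 [OF zero_cycle_iff [OF \<open>closed_walk w\<close>]])
  next
    fix C assume *: "\<forall>w. closed_walk w \<longrightarrow> ?z w" and C: "C \<in> circuits Q" "\<not> trivial_circuit Q C"
    show "?zero C"
      using C(1)
    proof (cases rule: circuits_cases)
      case (1 v)
      then show ?thesis
        using C(2) by (auto simp: trivial_circuit_def)
    next
      case (2 w)
      then show ?thesis
        unfolding 2(2) zero_cycle_iff [OF 2(1)] using * 2(1) by simp
    qed
  qed
  \<comment> \<open>The characteristic divides the multiplicity exactly when the multiplicity is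
    zero in k.\<close>
  have walk_iff: "(?arrows (?L w) \<and> ?relations (?L w) \<longrightarrow> \<not> CHAR('k) dvd circuit_multiplicity Q (?L w) \<and> ?unique (?L w))
      \<longleftrightarrow> (?nz w \<and> ?relations (?L w) \<longrightarrow> of_nat (multiplicity w) \<noteq> (0 :: 'k) \<and> (\<exists>!v. v \<in> rotations w \<and> end_walk v))"
    if "closed_walk w" for w
    unfolding odot_arrows_iff [OF that] ex1_sole_relation_iff [OF that] circuit_multiplicity_list_path [OF that]
      of_nat_eq_0_iff_char_dvd ..
  have 2: "(\<forall>C\<in>circuits Q. ?arrows C \<and> ?relations C \<longrightarrow> \<not> CHAR('k) dvd circuit_multiplicity Q C \<and> ?unique C) \<longleftrightarrow>
      (\<forall>w. closed_walk w \<longrightarrow> ?nz w \<and> ?relations (?L w) \<longrightarrow>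
        of_nat (multiplicity w) \<noteq> (0 :: 'k) \<and> (\<exists>!v. v \<in> rotations w \<and> end_walk v))" (is "?lhs \<longleftrightarrow> ?rhs")
  proof
    assume ?lhs
    then show ?rhs
      using list_path_circuits walk_iff by simp
  next
    assume rhs: ?rhs
    show ?lhs
    proof
      fix C assume "C \<in> circuits Q"
      then show "?arrows C \<and> ?relations C \<longrightarrow> \<not> CHAR('k) dvd circuit_multiplicity Q C \<and> ?unique C"
      proof (cases rule: circuits_cases)
        case (1 v)
        then show ?thesis
          using odot_arrows_trivial by metis
      next
        case (2 w)
        then show ?thesis
          using rhs walk_iff by simp
      qed
    qed
  qed
  \<comment> \<open>Under the first condition every nontrivial circuit has a zero cycle, so
    \<open>odot_relations_nonempty\<close> reconciles the premises of the second.\<close>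
  show ?thesis
    unfolding 1 2 trivial_homology_iff using odot_relations_nonempty by (intro conj_cong refl iffI allI impI) simp_all
qed

end

theorem corollary3p5:
  fixes Q :: "('v, 'e) pre_digraph"
    and Z :: "('v, 'e) qpath set"
    and A :: "('k::field, (('v, 'e) qpath \<Rightarrow>\<^sub>0 'k) set) module"
    and B :: "('v, 'e) qpath set"
    and p :: nat
  assumes "CHAR('k) = p" and "p > 0"
    and "fin_digraph Q" and "Digraph_Component.connected Q"
    and "minimal_relations Q Z"
    and "A = monomial_algebra Q Z"
    and "B = nonzero_paths Q Z"
    and "finite_dimensional A"
  shows "trivial_group (hochschild_homology A 1) \<longleftrightarrow>
     (\<forall>C\<in>circuits Q. \<not> trivial_circuit Q C \<longrightarrow> (\<exists>\<gamma>\<in>C. zero_path Q Z \<gamma>)) \<and>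
     (\<forall>C\<in>circuits Q.
        odot_circuit Q (qarrows Q) B C \<noteq> {} \<and> odot_circuit Q Z B C \<noteq> {} \<longrightarrow>
        \<not> p dvd circuit_multiplicity Q C \<and>
        (\<exists>!(\<xi>, \<beta>). (\<xi>, \<beta>) \<in> odot_circuit Q Z B C \<and> no_other_zero_relation Q Z \<xi> \<beta>))"
proof -
  interpret monomial_quiver Q Z A
    using assms by (simp add: monomial_quiver_def monomial_quiver_axioms_def)
  show ?thesis
    using trivial_homology_circuits unfolding assms(1) [symmetric] assms(7) .
qed

end
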